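(* Let $(\otimes,\mathrm{hom}_\ell,\mathrm{hom}_r)\colon\mathcal K\times\mathcal M\to\mathcal N$ be a two-variable adjunction ($\mathcal K,\mathcal M$ with pullbacks, $\mathcal N$ with pushouts) and let $(\mathbb C',\mathbb F')$, $(\mathbb C,\mathbb F)$, $(\mathbb L,\mathbb R)$ be awfs on $\mathcal K,\mathcal M,\mathcal N$ respectively. If small categories $\mathcal I\to\mathcal K^{\mathbf 2}$ and $\mathcal J\to\mathcal M^{\mathbf 2}$ generate $(\mathbb C',\mathbb F')$ and $(\mathbb C,\mathbb F)$, then there is at most one two-variable adjunction of awfs $(\mathbb C',\mathbb F')\times(\mathbb C,\mathbb F)\to(\mathbb L,\mathbb R)$ (over the given two-variable adjunction) whose lifted left adjoint $\mathbb C'\text{-}\mathbf{coalg}\times\mathbb C\text{-}\mathbf{coalg}\to\mathbb L\text{-}\mathbf{coalg}$ restricts along the unit functors $\mathcal I\to\mathbb C'\text{-}\mathbf{coalg}$ and $\mathcal J\to\mathbb C\text{-}\mathbf{coalg}$ to a given functor $\mathcal I\times\mathcal J\to\mathbb L\text{-}\mathbf{coalg}$.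
   Context: $\mathcal M^{\mathbf 2}$ is the arrow category; a morphism $(u,v)\colon f\Rightarrow g$ is a commutative square $gu=vf$ (a lifting problem of $f$ against $g$). A functorial factorization $\vec E=(L,R)$ factors each arrow functorially as $f=Rf\cdot Lf$ with $Lf\colon\mathrm{dom}f\to Ef$, $Rf\colon Ef\to\mathrm{cod}f$, with canonical $\vec\epsilon_f=(1,Rf)\colon Lf\Rightarrow f$, $\vec\eta_f=(Lf,1)\colon f\Rightarrow Rf$. An algebraic weak factorization system (awfs) $(\mathbb L,\mathbb R)$ is a comonad $\mathbb L=(L,\vec\epsilon,\vec\delta)$ and a monad $\mathbb R=(R,\vec\eta,\vec\mu)$ on the arrow category arising from a functorial factorization, with $\vec\delta_f=(1,\delta_f)$, $\delta_f\colon Ef\to ELf$, $\vec\mu_f=(\mu_f,1)$, $\mu_f\colon ERf\to Ef$, such that $(\delta,\mu)\colon LR\Rightarrow RL$ is a distributive law. A coalgebra structure on $j$ is given by $s\colon\mathrm{cod}j\to Ej$, an algebra structure on $f$ by $r\colon Ef\to\mathrm{dom}f$; the canonical solution to $(u,v)\colon j\Rightarrow f$ is $r\cdot E(u,v)\cdot s$. A lifted functor commutes with forgetful functors to arrow categories. The awfs $(\mathbb C',\mathbb F')$, $(\mathbb C,\mathbb F)$, $(\mathbb L,\mathbb R)$ factor arrows through $Q'$, $Q$, $E$. Generation: for a functor $\mathcal J\to\mathcal M^{\mathbf 2}$ with $\mathcal J$ small, $\mathcal J^{\pitchfork}$ is the category over $\mathcal M^{\mathbf 2}$ of pairs $(f,\phi_f)$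 of an arrow $f$ and a choice $\phi_f$ of solutions to all lifting problems of objects of $\mathcal J$ against $f$, compatible with morphisms of $\mathcal J$. The awfs $(\mathbb C,\mathbb F)$ is generated by $\mathcal J$ if it is the awfs produced by Garner's small object argument; it comes with a unit functor $\mathcal J\to\mathbb C\text{-}\mathbf{coalg}$ over $\mathcal M^{\mathbf 2}$ which is universal among functors over $\mathcal M^{\mathbf 2}$ from $\mathcal J$ to coalgebra categories of awfs on $\mathcal M$ (with respect to morphisms of awfs, i.e. natural transformations $\xi$ between the middle-object functors giving simultaneously a comonad morphism $(1,\xi)$ and a monad morphism $(\xi,1)$), and the functor $\mathbb F\text{-}\mathbf{alg}\to\mathcal J^{\pitchfork}$ given by canonical solutions is an isomorphism. Categories carrying generated awfs are assumed to permit the small object argument (e.g. locally presentable or, more generally, locally bounded). A two-variable adjunction consists of bifunctors $\otimes\colon\mathcal K\times\mathcal M\to\mathcal N$, $\mathrm{hom}_\ell\colon\mathcal K^{\mathrm{op}}\times\mathcal N\to\mathcal M$, $\mathrm{hom}_r\colon\mathcal M^{\mathrm{op}}\times\mathcal N\to\mathcal K$ with natural isomorphisms $\mathcal N(k\otimes m,n)\cong\mathcal M(m,\mathrm{hom}_\ell(k,n))\cong\mathcal K(k,\mathrm{hom}_r(m,n))$. It induces $(\widehat\otimes,\widehat{\mathrm{hom}}_\ell,\widehat{\mathrm{hom}}_r)$ on arrow categories: for $i\colon A\to B$, $j\colon J\to K$, $f\colon X\to Y$, $i\widehat\otimes j\colon A\otimes K\sqcup_{A\otimes J}B\otimes J\to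 B\otimes K$ and $\widehat{\mathrm{hom}}_\ell(i,f)\colon\mathrm{hom}_\ell(B,X)\to\mathrm{hom}_\ell(B,Y)\times_{\mathrm{hom}_\ell(A,Y)}\mathrm{hom}_\ell(A,X)$; $\widehat{\mathrm{hom}}_r$ is analogous. A two-variable adjunction of awfs $(\mathbb C',\mathbb F')\times(\mathbb C,\mathbb F)\to(\mathbb L,\mathbb R)$ consists of lifted functors $\widehat\otimes\colon\mathbb C'\text{-}\mathbf{coalg}\times\mathbb C\text{-}\mathbf{coalg}\to\mathbb L\text{-}\mathbf{coalg}$ (the lifted left adjoint), $\widehat{\mathrm{hom}}_\ell\colon\mathbb C'\text{-}\mathbf{coalg}^{\mathrm{op}}\times\mathbb R\text{-}\mathbf{alg}\to\mathbb F\text{-}\mathbf{alg}$, $\widehat{\mathrm{hom}}_r\colon\mathbb C\text{-}\mathbf{coalg}^{\mathrm{op}}\times\mathbb R\text{-}\mathbf{alg}\to\mathbb F'\text{-}\mathbf{alg}$ whose characterizing natural transformations $\lambda_{i,j}\colon Q'i\otimes Qj\to E(i\widehat\otimes j)$, $\rho^\ell_{i,f}\colon Q\widehat{\mathrm{hom}}_\ell(i,f)\to\mathrm{hom}_\ell(Q'i,Ef)$, $\rho^r_{j,f}\colon Q'\widehat{\mathrm{hom}}_r(j,f)\to\mathrm{hom}_r(Qj,Ef)$ are parameterized mates. Here $\lambda$ characterizes $\widehat\otimes$ if coalgebras $(i,s),(j,t)$ are sent to $i\widehat\otimes j$ with structure $\lambda_{i,j}\cdot(s\otimes t)$; $\rho^\ell$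 characterizes $\widehat{\mathrm{hom}}_\ell$ if $(i,s),(f,r)$ are sent to $\widehat{\mathrm{hom}}_\ell(i,f)$ with structure $\mathrm{hom}_\ell(s,r)\cdot\rho^\ell_{i,f}$; and similarly for $\rho^r$ (each lifted functor has a unique characterizing transformation, given by its values on cofree coalgebras and free algebras). They are parameterized mates if for each $i$, $\lambda_{i,-},\rho^\ell_{i,-}$ are mates with respect to $i\widehat\otimes-\dashv\widehat{\mathrm{hom}}_\ell(i,-)$ and $Q'i\otimes-\dashv\mathrm{hom}_\ell(Q'i,-)$, and for each $j$, $\lambda_{-,j},\rho^r_{j,-}$ are mates with respect to $-\widehat\otimes j\dashv\widehat{\mathrm{hom}}_r(j,-)$ and $-\otimes Qj\dashv\mathrm{hom}_r(Qj,-)$. *)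

theory Defs
  imports Main
begin

section \<open>Categories, functors, natural transformations\<close>

text \<open>Categories are given by carrier sets of objects and arrows; the operations are unconstrained
  outside the carriers, and functors are compared on the carriers only.  Every category has its own
  types of objects and arrows, so a small index category and the large category its diagram lives in
  differ only in these types (every HOL carrier is a set).\<close>

record ('o, 'a) cat =
  Obj :: "'o set"
  Arr :: "'a set"
  Dom :: "'a \<Rightarrow> 'o"
  Cod :: "'a \<Rightarrow> 'o"
  Idt :: "'o \<Rightarrow> 'a"
  Comp :: "'a \<Rightarrow> 'a \<Rightarrow> 'a"  (infixr "\<cdot>\<index>" 70)

definition hom :: "('o, 'a) cat \<Rightarrow> 'o \<Rightarrow> 'o \<Rightarrow> 'a set" where
  "hom C x y = {f \<in> Arr C. Dom C f = x \<and> Cod C f = y}"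

definition category :: "('o, 'a) cat \<Rightarrow> bool" where
  "category C \<longleftrightarrow>
     (\<forall>f\<in>Arr C. Dom C f \<in> Obj C \<and> Cod C f \<in> Obj C) \<and>
     (\<forall>x\<in>Obj C. Idt C x \<in> hom C x x) \<and>
     (\<forall>f\<in>Arr C. \<forall>g\<in>Arr C. Dom C g = Cod C f \<longrightarrow> g \<cdot>\<^bsub>C\<^esub> f \<in> hom C (Dom C f) (Cod C g)) \<and>
     (\<forall>f\<in>Arr C. f \<cdot>\<^bsub>C\<^esub> Idt C (Dom C f) = f \<and> Idt C (Cod C f) \<cdot>\<^bsub>C\<^esub> f = f) \<and>
     (\<forall>f\<in>Arr C. \<forall>g\<in>Arr C. \<forall>h\<in>Arr C. Dom C g = Cod C f \<longrightarrow> Dom C h = Cod C g \<longrightarrow>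
        h \<cdot>\<^bsub>C\<^esub> (g \<cdot>\<^bsub>C\<^esub> f) = (h \<cdot>\<^bsub>C\<^esub> g) \<cdot>\<^bsub>C\<^esub> f)"

definition op_cat :: "('o, 'a) cat \<Rightarrow> ('o, 'a) cat" where
  "op_cat C = \<lparr>Obj = Obj C, Arr = Arr C, Dom = Cod C, Cod = Dom C, Idt = Idt C,
               Comp = (\<lambda>g f. f \<cdot>\<^bsub>C\<^esub> g)\<rparr>"

definition prod_cat :: "('o, 'a) cat \<Rightarrow> ('p, 'b) cat \<Rightarrow> ('o \<times> 'p, 'a \<times> 'b) cat" where
  "prod_cat C D = \<lparr>Obj = Obj C \<times> Obj D, Arr = Arr C \<times> Arr D,
     Dom = map_prod (Dom C) (Dom D), Cod = map_prod (Cod C) (Cod D),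
     Idt = map_prod (Idt C) (Idt D),
     Comp = (\<lambda>(g, g') (f, f'). (g \<cdot>\<^bsub>C\<^esub> f, g' \<cdot>\<^bsub>D\<^esub> f'))\<rparr>"

record ('o, 'a, 'p, 'b) funct =
  FObj :: "'o \<Rightarrow> 'p"
  FArr :: "'a \<Rightarrow> 'b"

definition is_functor :: "('o, 'a) cat \<Rightarrow> ('p, 'b) cat \<Rightarrow> ('o, 'a, 'p, 'b) funct \<Rightarrow> bool" where
  "is_functor C D F \<longleftrightarrow>
     (\<forall>x\<in>Obj C. FObj F x \<in> Obj D) \<and>
     (\<forall>f\<in>Arr C. FArr F f \<in> hom D (FObj F (Dom C f)) (FObj F (Cod C f))) \<and>
     (\<forall>x\<in>Obj C. FArr F (Idt C x) = Idt D (FObj F x)) \<and>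
     (\<forall>f\<in>Arr C. \<forall>g\<in>Arr C. Dom C g = Cod C f \<longrightarrow>
        FArr F (g \<cdot>\<^bsub>C\<^esub> f) = FArr F g \<cdot>\<^bsub>D\<^esub> FArr F f)"

definition id_funct :: "('o, 'a, 'o, 'a) funct" where
  "id_funct = \<lparr>FObj = id, FArr = id\<rparr>"

definition comp_funct ::
    "('p, 'b, 'q, 'c) funct \<Rightarrow> ('o, 'a, 'p, 'b) funct \<Rightarrow> ('o, 'a, 'q, 'c) funct" (infixr "\<circ>\<^sub>F" 55) where
  "G \<circ>\<^sub>F F = \<lparr>FObj = FObj G \<circ> FObj F, FArr = FArr G \<circ> FArr F\<rparr>"

definition prod_funct ::
    "('o, 'a, 'p, 'b) funct \<Rightarrow> ('o', 'a', 'p', 'b') funct \<Rightarrow>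
     ('o \<times> 'o', 'a \<times> 'a', 'p \<times> 'p', 'b \<times> 'b') funct" (infixr "\<times>\<^sub>F" 60) where
  "F \<times>\<^sub>F G = \<lparr>FObj = map_prod (FObj F) (FObj G), FArr = map_prod (FArr F) (FArr G)\<rparr>"

text \<open>Fixing one variable of a bifunctor.\<close>

definition fix_fst ::
    "('o, 'a) cat \<Rightarrow> ('o \<times> 'p, 'a \<times> 'b, 'q, 'c) funct \<Rightarrow> 'o \<Rightarrow> ('p, 'b, 'q, 'c) funct" where
  "fix_fst C T x = \<lparr>FObj = (\<lambda>y. FObj T (x, y)), FArr = (\<lambda>g. FArr T (Idt C x, g))\<rparr>"

definition fix_snd ::
    "('p, 'b) cat \<Rightarrow> ('o \<times> 'p, 'a \<times> 'b, 'q, 'c) funct \<Rightarrow> 'p \<Rightarrow> ('o, 'a, 'q, 'c) funct" where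
  "fix_snd D T y = \<lparr>FObj = (\<lambda>x. FObj T (x, y)), FArr = (\<lambda>f. FArr T (f, Idt D y))\<rparr>"

definition functors_agree ::
    "('o, 'a) cat \<Rightarrow> ('o, 'a, 'p, 'b) funct \<Rightarrow> ('o, 'a, 'p, 'b) funct \<Rightarrow> bool" where
  "functors_agree C F G \<longleftrightarrow>
     (\<forall>x\<in>Obj C. FObj F x = FObj G x) \<and> (\<forall>f\<in>Arr C. FArr F f = FArr G f)"

definition is_isomorphism :: "('o, 'a) cat \<Rightarrow> ('p, 'b) cat \<Rightarrow> ('o, 'a, 'p, 'b) funct \<Rightarrow> bool" where
  "is_isomorphism C D F \<longleftrightarrow> is_functor C D F \<and>
     (\<exists>G. is_functor D C G \<and> functors_agree C (G \<circ>\<^sub>F F) id_funct \<and> functors_agree D (F \<circ>\<^sub>F G) id_funct)"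

definition nat_trans ::
    "('o, 'a) cat \<Rightarrow> ('p, 'b) cat \<Rightarrow> ('o, 'a, 'p, 'b) funct \<Rightarrow> ('o, 'a, 'p, 'b) funct \<Rightarrow>
     ('o \<Rightarrow> 'b) \<Rightarrow> bool" where
  "nat_trans C D F G \<tau> \<longleftrightarrow>
     (\<forall>x\<in>Obj C. \<tau> x \<in> hom D (FObj F x) (FObj G x)) \<and>
     (\<forall>f\<in>Arr C. FArr G f \<cdot>\<^bsub>D\<^esub> \<tau> (Dom C f) = \<tau> (Cod C f) \<cdot>\<^bsub>D\<^esub> FArr F f)"


section \<open>Pullbacks and pushouts\<close>

definition is_pullback :: "('o, 'a) cat \<Rightarrow> 'a \<Rightarrow> 'a \<Rightarrow> 'a \<Rightarrow> 'a \<Rightarrow> bool" where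
  "is_pullback C f g p q \<longleftrightarrow>
     f \<in> Arr C \<and> g \<in> Arr C \<and> Cod C f = Cod C g \<and>
     p \<in> hom C (Dom C p) (Dom C f) \<and> q \<in> hom C (Dom C p) (Dom C g) \<and>
     f \<cdot>\<^bsub>C\<^esub> p = g \<cdot>\<^bsub>C\<^esub> q \<and>
     (\<forall>x\<in>Arr C. \<forall>y\<in>Arr C. Dom C x = Dom C y \<longrightarrow> Cod C x = Dom C f \<longrightarrow> Cod C y = Dom C g \<longrightarrow>
        f \<cdot>\<^bsub>C\<^esub> x = g \<cdot>\<^bsub>C\<^esub> y \<longrightarrow>
        (\<exists>!h. h \<in> hom C (Dom C x) (Dom C p) \<and> p \<cdot>\<^bsub>C\<^esub> h = x \<and> q \<cdot>\<^bsub>C\<^esub> h = y))"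

definition has_pullbacks :: "('o, 'a) cat \<Rightarrow> bool" where
  "has_pullbacks C \<longleftrightarrow>
     (\<forall>f\<in>Arr C. \<forall>g\<in>Arr C. Cod C f = Cod C g \<longrightarrow> (\<exists>p q. is_pullback C f g p q))"

definition has_pushouts :: "('o, 'a) cat \<Rightarrow> bool" where
  "has_pushouts C \<longleftrightarrow> has_pullbacks (op_cat C)"

text \<open>An arbitrary but fixed choice of pullback projections (pushout injections), and the arrow
  into the chosen pullback (out of the chosen pushout) induced by a commuting cone (cocone).\<close>

definition pullback_of :: "('o, 'a) cat \<Rightarrow> 'a \<Rightarrow> 'a \<Rightarrow> 'a \<times> 'a" where
  "pullback_of C f g = (SOME (p, q). is_pullback C f g p q)"

definition pb_pair :: "('o, 'a) cat \<Rightarrow> 'a \<Rightarrow> 'a \<Rightarrow> 'a \<Rightarrow> 'a \<Rightarrow> 'a" where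
  "pb_pair C f g x y = (case pullback_of C f g of (p, q) \<Rightarrow>
     (THE h. h \<in> hom C (Dom C x) (Dom C p) \<and> p \<cdot>\<^bsub>C\<^esub> h = x \<and> q \<cdot>\<^bsub>C\<^esub> h = y))"

definition pushout_of :: "('o, 'a) cat \<Rightarrow> 'a \<Rightarrow> 'a \<Rightarrow> 'a \<times> 'a" where
  "pushout_of C f g = pullback_of (op_cat C) f g"

definition po_copair :: "('o, 'a) cat \<Rightarrow> 'a \<Rightarrow> 'a \<Rightarrow> 'a \<Rightarrow> 'a \<Rightarrow> 'a" where
  "po_copair C f g x y = pb_pair (op_cat C) f g x y"


section \<open>Arrow categories\<close>

text \<open>A triple \<open>(f, (u, v), g)\<close> stands for the square \<open>(u, v) : f \<Rightarrow> g\<close>.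
  The same shape is used for morphisms between arrows equipped with extra structure.\<close>

type_synonym ('x, 'a) sq = "'x \<times> ('a \<times> 'a) \<times> 'x"

definition arrow_cat :: "('o, 'a) cat \<Rightarrow> ('a, ('a, 'a) sq) cat" where
  "arrow_cat C = \<lparr>
     Obj = Arr C,
     Arr = {(f, (u, v), g). f \<in> Arr C \<and> g \<in> Arr C \<and>
              u \<in> hom C (Dom C f) (Dom C g) \<and> v \<in> hom C (Cod C f) (Cod C g) \<and>
              g \<cdot>\<^bsub>C\<^esub> u = v \<cdot>\<^bsub>C\<^esub> f},
     Dom = (\<lambda>(f, w, g). f), Cod = (\<lambda>(f, w, g). g),
     Idt = (\<lambda>f. (f, (Idt C (Dom C f), Idt C (Cod C f)), f)),
     Comp = (\<lambda>(g, (u', v'), h) (f, (u, v), g'). (f, (u' \<cdot>\<^bsub>C\<^esub> u, v' \<cdot>\<^bsub>C\<^esub> v), h))\<rparr>"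

definition dom_funct :: "('o, 'a) cat \<Rightarrow> ('a, ('a, 'a) sq, 'o, 'a) funct" where
  "dom_funct C = \<lparr>FObj = Dom C, FArr = (\<lambda>(f, (u, v), g). u)\<rparr>"

definition cod_funct :: "('o, 'a) cat \<Rightarrow> ('a, ('a, 'a) sq, 'o, 'a) funct" where
  "cod_funct C = \<lparr>FObj = Cod C, FArr = (\<lambda>(f, (u, v), g). v)\<rparr>"

text \<open>Categories over the arrow category: objects are arrows with structure, from a set \<open>S\<close>,
  and morphisms are the squares between underlying arrows that satisfy \<open>P\<close>.\<close>

definition structured_arrow_cat ::
    "('o, 'a) cat \<Rightarrow> ('a \<times> 's) set \<Rightarrow> ('a \<times> 's \<Rightarrow> 'a \<times> 'a \<Rightarrow> 'a \<times> 's \<Rightarrow> bool) \<Rightarrow>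
     ('a \<times> 's, ('a \<times> 's, 'a) sq) cat" where
  "structured_arrow_cat C S P = \<lparr>
     Obj = S,
     Arr = {(x, w, y). x \<in> S \<and> y \<in> S \<and> (fst x, w, fst y) \<in> Arr (arrow_cat C) \<and> P x w y},
     Dom = (\<lambda>(x, w, y). x), Cod = (\<lambda>(x, w, y). y),
     Idt = (\<lambda>x. (x, (Idt C (Dom C (fst x)), Idt C (Cod C (fst x))), x)),
     Comp = (\<lambda>(y, (u', v'), z) (x, (u, v), y'). (x, (u' \<cdot>\<^bsub>C\<^esub> u, v' \<cdot>\<^bsub>C\<^esub> v), z))\<rparr>"

definition forget :: "('a \<times> 's, ('a \<times> 's, 'a) sq, 'a, ('a, 'a) sq) funct" where
  "forget = \<lparr>FObj = fst, FArr = (\<lambda>(x, w, y). (fst x, w, fst y))\<rparr>"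


section \<open>Monads, comonads, distributive laws\<close>

definition comonad ::
    "('o, 'a) cat \<Rightarrow> ('o, 'a, 'o, 'a) funct \<Rightarrow> ('o \<Rightarrow> 'a) \<Rightarrow> ('o \<Rightarrow> 'a) \<Rightarrow> bool" where
  "comonad C G \<epsilon> \<delta> \<longleftrightarrow> is_functor C C G \<and>
     nat_trans C C G id_funct \<epsilon> \<and> nat_trans C C G (G \<circ>\<^sub>F G) \<delta> \<and>
     (\<forall>x\<in>Obj C.
        \<epsilon> (FObj G x) \<cdot>\<^bsub>C\<^esub> \<delta> x = Idt C (FObj G x) \<and>
        FArr G (\<epsilon> x) \<cdot>\<^bsub>C\<^esub> \<delta> x = Idt C (FObj G x) \<and>
        \<delta> (FObj G x) \<cdot>\<^bsub>C\<^esub> \<delta> x = FArr G (\<delta> x) \<cdot>\<^bsub>C\<^esub> \<delta> x)"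

definition monad ::
    "('o, 'a) cat \<Rightarrow> ('o, 'a, 'o, 'a) funct \<Rightarrow> ('o \<Rightarrow> 'a) \<Rightarrow> ('o \<Rightarrow> 'a) \<Rightarrow> bool" where
  "monad C T \<eta> \<mu> \<longleftrightarrow> is_functor C C T \<and>
     nat_trans C C id_funct T \<eta> \<and> nat_trans C C (T \<circ>\<^sub>F T) T \<mu> \<and>
     (\<forall>x\<in>Obj C.
        \<mu> x \<cdot>\<^bsub>C\<^esub> \<eta> (FObj T x) = Idt C (FObj T x) \<and>
        \<mu> x \<cdot>\<^bsub>C\<^esub> FArr T (\<eta> x) = Idt C (FObj T x) \<and>
        \<mu> x \<cdot>\<^bsub>C\<^esub> \<mu> (FObj T x) = \<mu> x \<cdot>\<^bsub>C\<^esub> FArr T (\<mu> x))"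

text \<open>Distributive law \<open>\<chi> : G T \<Rightarrow> T G\<close> of a comonad \<open>G\<close> over a monad \<open>T\<close>.\<close>

definition distributive_law ::
    "('o, 'a) cat \<Rightarrow> ('o, 'a, 'o, 'a) funct \<Rightarrow> ('o \<Rightarrow> 'a) \<Rightarrow> ('o \<Rightarrow> 'a) \<Rightarrow>
     ('o, 'a, 'o, 'a) funct \<Rightarrow> ('o \<Rightarrow> 'a) \<Rightarrow> ('o \<Rightarrow> 'a) \<Rightarrow> ('o \<Rightarrow> 'a) \<Rightarrow> bool" where
  "distributive_law C G \<epsilon> \<delta> T \<eta> \<mu> \<chi> \<longleftrightarrow>
     nat_trans C C (G \<circ>\<^sub>F T) (T \<circ>\<^sub>F G) \<chi> \<and>
     (\<forall>x\<in>Obj C.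
        \<chi> x \<cdot>\<^bsub>C\<^esub> FArr G (\<eta> x) = \<eta> (FObj G x) \<and>
        FArr T (\<epsilon> x) \<cdot>\<^bsub>C\<^esub> \<chi> x = \<epsilon> (FObj T x) \<and>
        \<chi> x \<cdot>\<^bsub>C\<^esub> FArr G (\<mu> x) = \<mu> (FObj G x) \<cdot>\<^bsub>C\<^esub> FArr T (\<chi> x) \<cdot>\<^bsub>C\<^esub> \<chi> (FObj T x) \<and>
        FArr T (\<delta> x) \<cdot>\<^bsub>C\<^esub> \<chi> x = \<chi> (FObj G x) \<cdot>\<^bsub>C\<^esub> FArr G (\<chi> x) \<cdot>\<^bsub>C\<^esub> \<delta> (FObj T x))"

definition comonad_morphism ::
    "('o, 'a) cat \<Rightarrow> ('o, 'a, 'o, 'a) funct \<Rightarrow> ('o \<Rightarrow> 'a) \<Rightarrow> ('o \<Rightarrow> 'a) \<Rightarrow>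
     ('o, 'a, 'o, 'a) funct \<Rightarrow> ('o \<Rightarrow> 'a) \<Rightarrow> ('o \<Rightarrow> 'a) \<Rightarrow> ('o \<Rightarrow> 'a) \<Rightarrow> bool" where
  "comonad_morphism C G \<epsilon> \<delta> G' \<epsilon>' \<delta>' \<theta> \<longleftrightarrow> nat_trans C C G G' \<theta> \<and>
     (\<forall>x\<in>Obj C. \<epsilon>' x \<cdot>\<^bsub>C\<^esub> \<theta> x = \<epsilon> x \<and>
        \<delta>' x \<cdot>\<^bsub>C\<^esub> \<theta> x = \<theta> (FObj G' x) \<cdot>\<^bsub>C\<^esub> FArr G (\<theta> x) \<cdot>\<^bsub>C\<^esub> \<delta> x)"

definition monad_morphism ::
    "('o, 'a) cat \<Rightarrow> ('o, 'a, 'o, 'a) funct \<Rightarrow> ('o \<Rightarrow> 'a) \<Rightarrow> ('o \<Rightarrow> 'a) \<Rightarrow>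
     ('o, 'a, 'o, 'a) funct \<Rightarrow> ('o \<Rightarrow> 'a) \<Rightarrow> ('o \<Rightarrow> 'a) \<Rightarrow> ('o \<Rightarrow> 'a) \<Rightarrow> bool" where
  "monad_morphism C T \<eta> \<mu> T' \<eta>' \<mu>' \<theta> \<longleftrightarrow> nat_trans C C T T' \<theta> \<and>
     (\<forall>x\<in>Obj C. \<theta> x \<cdot>\<^bsub>C\<^esub> \<eta> x = \<eta>' x \<and>
        \<theta> x \<cdot>\<^bsub>C\<^esub> \<mu> x = \<mu>' x \<cdot>\<^bsub>C\<^esub> \<theta> (FObj T' x) \<cdot>\<^bsub>C\<^esub> FArr T (\<theta> x))"

definition comonad_coalgebra ::
    "('o, 'a) cat \<Rightarrow> ('o, 'a, 'o, 'a) funct \<Rightarrow> ('o \<Rightarrow> 'a) \<Rightarrow> ('o \<Rightarrow> 'a) \<Rightarrow> 'o \<Rightarrow> 'a \<Rightarrow> bool" where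
  "comonad_coalgebra C G \<epsilon> \<delta> x s \<longleftrightarrow> x \<in> Obj C \<and> s \<in> hom C x (FObj G x) \<and>
     \<epsilon> x \<cdot>\<^bsub>C\<^esub> s = Idt C x \<and> \<delta> x \<cdot>\<^bsub>C\<^esub> s = FArr G s \<cdot>\<^bsub>C\<^esub> s"

definition monad_algebra ::
    "('o, 'a) cat \<Rightarrow> ('o, 'a, 'o, 'a) funct \<Rightarrow> ('o \<Rightarrow> 'a) \<Rightarrow> ('o \<Rightarrow> 'a) \<Rightarrow> 'o \<Rightarrow> 'a \<Rightarrow> bool" where
  "monad_algebra C T \<eta> \<mu> x r \<longleftrightarrow> x \<in> Obj C \<and> r \<in> hom C (FObj T x) x \<and>
     r \<cdot>\<^bsub>C\<^esub> \<eta> x = Idt C x \<and> r \<cdot>\<^bsub>C\<^esub> \<mu> x = r \<cdot>\<^bsub>C\<^esub> FArr T r"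


section \<open>Algebraic weak factorization systems\<close>

text \<open>\<open>mid\<close> is the middle-object functor of the factorization, \<open>lft\<close> and \<open>rgt\<close> its two factors;
  \<open>comult\<close> and \<open>mult\<close> are the arrows \<open>\<delta>\<^sub>f : Ef \<rightarrow> ELf\<close> and \<open>\<mu>\<^sub>f : ERf \<rightarrow> Ef\<close>.\<close>

record ('o, 'a) awfs_data =
  mid :: "('a, ('a, 'a) sq, 'o, 'a) funct"
  lft :: "'a \<Rightarrow> 'a"
  rgt :: "'a \<Rightarrow> 'a"
  comult :: "'a \<Rightarrow> 'a"
  mult :: "'a \<Rightarrow> 'a"

definition functorial_factorization :: "('o, 'a) cat \<Rightarrow> ('o, 'a) awfs_data \<Rightarrow> bool" where
  "functorial_factorization C W \<longleftrightarrow>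
     is_functor (arrow_cat C) C (mid W) \<and>
     nat_trans (arrow_cat C) C (dom_funct C) (mid W) (lft W) \<and>
     nat_trans (arrow_cat C) C (mid W) (cod_funct C) (rgt W) \<and>
     (\<forall>f\<in>Arr C. rgt W f \<cdot>\<^bsub>C\<^esub> lft W f = f)"

definition L_funct :: "('o, 'a) awfs_data \<Rightarrow> ('a, ('a, 'a) sq, 'a, ('a, 'a) sq) funct" where
  "L_funct W = \<lparr>FObj = lft W,
     FArr = (\<lambda>(f, (u, v), g). (lft W f, (u, FArr (mid W) (f, (u, v), g)), lft W g))\<rparr>"

definition R_funct :: "('o, 'a) awfs_data \<Rightarrow> ('a, ('a, 'a) sq, 'a, ('a, 'a) sq) funct" where
  "R_funct W = \<lparr>FObj = rgt W,
     FArr = (\<lambda>(f, (u, v), g). (rgt W f, (FArr (mid W) (f, (u, v), g), v), rgt W g))\<rparr>"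

definition eps_sq :: "('o, 'a) cat \<Rightarrow> ('o, 'a) awfs_data \<Rightarrow> 'a \<Rightarrow> ('a, 'a) sq" where
  "eps_sq C W f = (lft W f, (Idt C (Dom C f), rgt W f), f)"

definition eta_sq :: "('o, 'a) cat \<Rightarrow> ('o, 'a) awfs_data \<Rightarrow> 'a \<Rightarrow> ('a, 'a) sq" where
  "eta_sq C W f = (f, (lft W f, Idt C (Cod C f)), rgt W f)"

definition delta_sq :: "('o, 'a) cat \<Rightarrow> ('o, 'a) awfs_data \<Rightarrow> 'a \<Rightarrow> ('a, 'a) sq" where
  "delta_sq C W f = (lft W f, (Idt C (Dom C f), comult W f), lft W (lft W f))"

definition mu_sq :: "('o, 'a) cat \<Rightarrow> ('o, 'a) awfs_data \<Rightarrow> 'a \<Rightarrow> ('a, 'a) sq" where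
  "mu_sq C W f = (rgt W (rgt W f), (mult W f, Idt C (Cod C f)), rgt W f)"

definition awfs :: "('o, 'a) cat \<Rightarrow> ('o, 'a) awfs_data \<Rightarrow> bool" where
  "awfs C W \<longleftrightarrow> functorial_factorization C W \<and>
     comonad (arrow_cat C) (L_funct W) (eps_sq C W) (delta_sq C W) \<and>
     monad (arrow_cat C) (R_funct W) (eta_sq C W) (mu_sq C W) \<and>
     distributive_law (arrow_cat C)
       (L_funct W) (eps_sq C W) (delta_sq C W) (R_funct W) (eta_sq C W) (mu_sq C W)
       (\<lambda>f. (lft W (rgt W f), (comult W f, mult W f), rgt W (lft W f)))"

text \<open>The counit (unit) law forces the domain (codomain) component of a structure square to be an
  identity, so objects are pairs \<open>(j, s)\<close> with \<open>s : cod j \<rightarrow> Ej\<close>, resp. \<open>(f, r)\<close> with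
  \<open>r : Ef \<rightarrow> dom f\<close>.\<close>

definition coalg_sq :: "('o, 'a) cat \<Rightarrow> ('o, 'a) awfs_data \<Rightarrow> 'a \<times> 'a \<Rightarrow> ('a, 'a) sq" where
  "coalg_sq C W = (\<lambda>(j, s). (j, (Idt C (Dom C j), s), lft W j))"

definition alg_sq :: "('o, 'a) cat \<Rightarrow> ('o, 'a) awfs_data \<Rightarrow> 'a \<times> 'a \<Rightarrow> ('a, 'a) sq" where
  "alg_sq C W = (\<lambda>(f, r). (rgt W f, (r, Idt C (Cod C f)), f))"

definition coalg ::
    "('o, 'a) cat \<Rightarrow> ('o, 'a) awfs_data \<Rightarrow> ('a \<times> 'a, ('a \<times> 'a, 'a) sq) cat" where
  "coalg C W = structured_arrow_cat C
     {x. comonad_coalgebra (arrow_cat C) (L_funct W) (eps_sq C W) (delta_sq C W)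
           (fst x) (coalg_sq C W x)}
     (\<lambda>x w y. FArr (L_funct W) (fst x, w, fst y) \<cdot>\<^bsub>arrow_cat C\<^esub> coalg_sq C W x =
              coalg_sq C W y \<cdot>\<^bsub>arrow_cat C\<^esub> (fst x, w, fst y))"

definition alg ::
    "('o, 'a) cat \<Rightarrow> ('o, 'a) awfs_data \<Rightarrow> ('a \<times> 'a, ('a \<times> 'a, 'a) sq) cat" where
  "alg C W = structured_arrow_cat C
     {x. monad_algebra (arrow_cat C) (R_funct W) (eta_sq C W) (mu_sq C W)
           (fst x) (alg_sq C W x)}
     (\<lambda>x w y. (fst x, w, fst y) \<cdot>\<^bsub>arrow_cat C\<^esub> alg_sq C W x =
              alg_sq C W y \<cdot>\<^bsub>arrow_cat C\<^esub> FArr (R_funct W) (fst x, w, fst y))"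

definition canonical_solution ::
    "('o, 'a) cat \<Rightarrow> ('o, 'a) awfs_data \<Rightarrow> 'a \<times> 'a \<Rightarrow> 'a \<times> 'a \<Rightarrow> 'a \<times> 'a \<Rightarrow> 'a" where
  "canonical_solution C W = (\<lambda>(j, s) (u, v) (f, r).
     r \<cdot>\<^bsub>C\<^esub> FArr (mid W) (j, (u, v), f) \<cdot>\<^bsub>C\<^esub> s)"


section \<open>Generation by a category of arrows\<close>

definition awfs_morphism ::
    "('o, 'a) cat \<Rightarrow> ('o, 'a) awfs_data \<Rightarrow> ('o, 'a) awfs_data \<Rightarrow> ('a \<Rightarrow> 'a) \<Rightarrow> bool" where
  "awfs_morphism C W W' \<xi> \<longleftrightarrow>
     nat_trans (arrow_cat C) C (mid W) (mid W') \<xi> \<and>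
     comonad_morphism (arrow_cat C) (L_funct W) (eps_sq C W) (delta_sq C W)
       (L_funct W') (eps_sq C W') (delta_sq C W')
       (\<lambda>f. (lft W f, (Idt C (Dom C f), \<xi> f), lft W' f)) \<and>
     monad_morphism (arrow_cat C) (R_funct W) (eta_sq C W) (mu_sq C W)
       (R_funct W') (eta_sq C W') (mu_sq C W')
       (\<lambda>f. (rgt W f, (\<xi> f, Idt C (Cod C f)), rgt W' f))"

definition coalg_change ::
    "('o, 'a) cat \<Rightarrow> ('a \<Rightarrow> 'a) \<Rightarrow> ('a \<times> 'a, ('a \<times> 'a, 'a) sq, 'a \<times> 'a, ('a \<times> 'a, 'a) sq) funct" where
  "coalg_change C \<xi> = \<lparr>FObj = (\<lambda>(j, s). (j, \<xi> j \<cdot>\<^bsub>C\<^esub> s)),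
     FArr = (\<lambda>((j, s), w, (k, t)). ((j, \<xi> j \<cdot>\<^bsub>C\<^esub> s), w, (k, \<xi> k \<cdot>\<^bsub>C\<^esub> t)))\<rparr>"

definition functor_over ::
    "('j, 'ja) cat \<Rightarrow> ('a \<times> 's, ('a \<times> 's, 'a) sq) cat \<Rightarrow>
     ('j, 'ja, 'a, ('a, 'a) sq) funct \<Rightarrow> ('j, 'ja, 'a \<times> 's, ('a \<times> 's, 'a) sq) funct \<Rightarrow> bool" where
  "functor_over J D P U \<longleftrightarrow> is_functor J D U \<and> functors_agree J (forget \<circ>\<^sub>F U) P"

text \<open>Lifting functions are \<open>undefined\<close> on everything that is not a lifting problem, so that equal
  choices of solutions are equal objects.\<close>

definition pitchfork_obj ::
    "('o, 'a) cat \<Rightarrow> ('j, 'ja) cat \<Rightarrow> ('j, 'ja, 'a, ('a, 'a) sq) funct \<Rightarrow>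
     ('a \<times> ('j \<Rightarrow> 'a \<times> 'a \<Rightarrow> 'a)) set" where
  "pitchfork_obj C J P = {(f, \<phi>). f \<in> Arr C \<and>
     (\<forall>j\<in>Obj J. \<forall>u v. (FObj P j, (u, v), f) \<in> Arr (arrow_cat C) \<longrightarrow>
        \<phi> j (u, v) \<in> hom C (Cod C (FObj P j)) (Dom C f) \<and>
        \<phi> j (u, v) \<cdot>\<^bsub>C\<^esub> FObj P j = u \<and> f \<cdot>\<^bsub>C\<^esub> \<phi> j (u, v) = v) \<and>
     (\<forall>a\<in>Arr J. \<forall>u v u' v'.
        FArr P a = (FObj P (Dom J a), (u', v'), FObj P (Cod J a)) \<longrightarrow>
        (FObj P (Cod J a), (u, v), f) \<in> Arr (arrow_cat C) \<longrightarrow>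
        \<phi> (Dom J a) (u \<cdot>\<^bsub>C\<^esub> u', v \<cdot>\<^bsub>C\<^esub> v') = \<phi> (Cod J a) (u, v) \<cdot>\<^bsub>C\<^esub> v') \<and>
     (\<forall>j w. \<not> (j \<in> Obj J \<and> (FObj P j, w, f) \<in> Arr (arrow_cat C)) \<longrightarrow> \<phi> j w = undefined)}"

definition pitchfork ::
    "('o, 'a) cat \<Rightarrow> ('j, 'ja) cat \<Rightarrow> ('j, 'ja, 'a, ('a, 'a) sq) funct \<Rightarrow>
     ('a \<times> ('j \<Rightarrow> 'a \<times> 'a \<Rightarrow> 'a), ('a \<times> ('j \<Rightarrow> 'a \<times> 'a \<Rightarrow> 'a), 'a) sq) cat" where
  "pitchfork C J P = structured_arrow_cat C (pitchfork_obj C J P)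
     (\<lambda>(f, \<phi>) (x, y) (g, \<psi>). \<forall>j\<in>Obj J. \<forall>u v. (FObj P j, (u, v), f) \<in> Arr (arrow_cat C) \<longrightarrow>
        x \<cdot>\<^bsub>C\<^esub> \<phi> j (u, v) = \<psi> j (x \<cdot>\<^bsub>C\<^esub> u, y \<cdot>\<^bsub>C\<^esub> v))"

definition canonical_lifts ::
    "('o, 'a) cat \<Rightarrow> ('o, 'a) awfs_data \<Rightarrow> ('j, 'ja) cat \<Rightarrow>
     ('j, 'ja, 'a \<times> 'a, ('a \<times> 'a, 'a) sq) funct \<Rightarrow> 'a \<times> 'a \<Rightarrow> 'a \<times> ('j \<Rightarrow> 'a \<times> 'a \<Rightarrow> 'a)" where
  "canonical_lifts C W J U x = (fst x, (\<lambda>j w.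
     if j \<in> Obj J \<and> (fst (FObj U j), w, fst x) \<in> Arr (arrow_cat C)
     then canonical_solution C W (FObj U j) w x else undefined))"

definition canonical_lifts_funct ::
    "('o, 'a) cat \<Rightarrow> ('o, 'a) awfs_data \<Rightarrow> ('j, 'ja) cat \<Rightarrow>
     ('j, 'ja, 'a \<times> 'a, ('a \<times> 'a, 'a) sq) funct \<Rightarrow>
     ('a \<times> 'a, ('a \<times> 'a, 'a) sq,
      'a \<times> ('j \<Rightarrow> 'a \<times> 'a \<Rightarrow> 'a), ('a \<times> ('j \<Rightarrow> 'a \<times> 'a \<Rightarrow> 'a), 'a) sq) funct" where
  "canonical_lifts_funct C W J U = \<lparr>FObj = canonical_lifts C W J U,
     FArr = (\<lambda>(x, w, y). (canonical_lifts C W J U x, w, canonical_lifts C W J U y))\<rparr>"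

text \<open>The output of Garner's small object argument on \<open>P : J \<rightarrow> C\<^sup>2\<close> is determined up to isomorphism
  by the universal property of its unit functor \<open>U\<close>; it is moreover algebraically free, that is, algebras
  are the same as arrows with chosen, compatible lifts against \<open>J\<close>.\<close>

definition generated_by ::
    "('o, 'a) cat \<Rightarrow> ('o, 'a) awfs_data \<Rightarrow> ('j, 'ja) cat \<Rightarrow> ('j, 'ja, 'a, ('a, 'a) sq) funct \<Rightarrow>
     ('j, 'ja, 'a \<times> 'a, ('a \<times> 'a, 'a) sq) funct \<Rightarrow> bool" where
  "generated_by C W J P U \<longleftrightarrow>
     functor_over J (coalg C W) P U \<and>
     (\<forall>W' V. awfs C W' \<longrightarrow> functor_over J (coalg C W') P V \<longrightarrow>
        (\<exists>\<xi>. awfs_morphism C W W' \<xi> \<and> functors_agree J (coalg_change C \<xi> \<circ>\<^sub>F U) V \<and>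
           (\<forall>\<xi>'. awfs_morphism C W W' \<xi>' \<longrightarrow> functors_agree J (coalg_change C \<xi>' \<circ>\<^sub>F U) V \<longrightarrow>
              (\<forall>f\<in>Arr C. \<xi>' f = \<xi> f)))) \<and>
     is_isomorphism (alg C W) (pitchfork C J P) (canonical_lifts_funct C W J U)"


section \<open>Two-variable adjunctions\<close>

text \<open>\<open>trl k m n\<close> and \<open>trr k m n\<close> transpose arrows \<open>k \<otimes> m \<rightarrow> n\<close> to arrows
  \<open>m \<rightarrow> hom\<^sub>l(k, n)\<close> and \<open>k \<rightarrow> hom\<^sub>r(m, n)\<close>.\<close>

record ('k, 'ka, 'm, 'ma, 'n, 'na) two_var =
  tens :: "('k \<times> 'm, 'ka \<times> 'ma, 'n, 'na) funct"
  homl :: "('k \<times> 'n, 'ka \<times> 'na, 'm, 'ma) funct"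
  homr :: "('m \<times> 'n, 'ma \<times> 'na, 'k, 'ka) funct"
  trl :: "'k \<Rightarrow> 'm \<Rightarrow> 'n \<Rightarrow> 'na \<Rightarrow> 'ma"
  trr :: "'k \<Rightarrow> 'm \<Rightarrow> 'n \<Rightarrow> 'na \<Rightarrow> 'ka"

definition two_var_adjunction ::
    "('k, 'ka) cat \<Rightarrow> ('m, 'ma) cat \<Rightarrow> ('n, 'na) cat \<Rightarrow> ('k, 'ka, 'm, 'ma, 'n, 'na) two_var \<Rightarrow> bool" where
  "two_var_adjunction K M N A \<longleftrightarrow>
     is_functor (prod_cat K M) N (tens A) \<and>
     is_functor (prod_cat (op_cat K) N) M (homl A) \<and>
     is_functor (prod_cat (op_cat M) N) K (homr A) \<and>
     (\<forall>k\<in>Obj K. \<forall>m\<in>Obj M. \<forall>n\<in>Obj N.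
        bij_betw (trl A k m n) (hom N (FObj (tens A) (k, m)) n) (hom M m (FObj (homl A) (k, n))) \<and>
        bij_betw (trr A k m n) (hom N (FObj (tens A) (k, m)) n) (hom K k (FObj (homr A) (m, n)))) \<and>
     (\<forall>a\<in>Arr K. \<forall>b\<in>Arr M. \<forall>c\<in>Arr N.
        \<forall>g\<in>hom N (FObj (tens A) (Cod K a, Cod M b)) (Dom N c).
        trl A (Dom K a) (Dom M b) (Cod N c) (c \<cdot>\<^bsub>N\<^esub> g \<cdot>\<^bsub>N\<^esub> FArr (tens A) (a, b)) =
          FArr (homl A) (a, c) \<cdot>\<^bsub>M\<^esub> trl A (Cod K a) (Cod M b) (Dom N c) g \<cdot>\<^bsub>M\<^esub> b \<and>
        trr A (Dom K a) (Dom M b) (Cod N c) (c \<cdot>\<^bsub>N\<^esub> g \<cdot>\<^bsub>N\<^esub> FArr (tens A) (a, b)) =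
          FArr (homr A) (b, c) \<cdot>\<^bsub>K\<^esub> trr A (Cod K a) (Cod M b) (Dom N c) g \<cdot>\<^bsub>K\<^esub> a)"


section \<open>The induced two-variable adjunction on arrow categories\<close>

text \<open>The span \<open>A \<otimes> K \<leftarrow> A \<otimes> J \<rightarrow> B \<otimes> J\<close> for \<open>i : A \<rightarrow> B\<close> and \<open>j : J \<rightarrow> K\<close>.\<close>

definition span_fst ::
    "('k, 'ka) cat \<Rightarrow> ('k \<times> 'm, 'ka \<times> 'ma, 'n, 'na) funct \<Rightarrow> 'ka \<Rightarrow> 'ma \<Rightarrow> 'na" where
  "span_fst K T i j = FArr T (Idt K (Dom K i), j)"

definition span_snd ::
    "('m, 'ma) cat \<Rightarrow> ('k \<times> 'm, 'ka \<times> 'ma, 'n, 'na) funct \<Rightarrow> 'ka \<Rightarrow> 'ma \<Rightarrow> 'na" where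
  "span_snd M T i j = FArr T (i, Idt M (Dom M j))"

definition leibniz_injs ::
    "('k, 'ka) cat \<Rightarrow> ('m, 'ma) cat \<Rightarrow> ('n, 'na) cat \<Rightarrow> ('k \<times> 'm, 'ka \<times> 'ma, 'n, 'na) funct \<Rightarrow>
     'ka \<Rightarrow> 'ma \<Rightarrow> 'na \<times> 'na" where
  "leibniz_injs K M N T i j = pushout_of N (span_fst K T i j) (span_snd M T i j)"

definition leibniz_tens_obj ::
    "('k, 'ka) cat \<Rightarrow> ('m, 'ma) cat \<Rightarrow> ('n, 'na) cat \<Rightarrow> ('k \<times> 'm, 'ka \<times> 'ma, 'n, 'na) funct \<Rightarrow>
     'ka \<Rightarrow> 'ma \<Rightarrow> 'na" where
  "leibniz_tens_obj K M N T i j = po_copair N (span_fst K T i j) (span_snd M T i j)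
     (FArr T (i, Idt M (Cod M j))) (FArr T (Idt K (Cod K i), j))"

definition leibniz_tens ::
    "('k, 'ka) cat \<Rightarrow> ('m, 'ma) cat \<Rightarrow> ('n, 'na) cat \<Rightarrow> ('k \<times> 'm, 'ka \<times> 'ma, 'n, 'na) funct \<Rightarrow>
     ('ka \<times> 'ma, ('ka, 'ka) sq \<times> ('ma, 'ma) sq, 'na, ('na, 'na) sq) funct" where
  "leibniz_tens K M N T = \<lparr>
     FObj = (\<lambda>(i, j). leibniz_tens_obj K M N T i j),
     FArr = (\<lambda>((i, (a, b), i'), (j, (c, d), j')).
       (leibniz_tens_obj K M N T i j,
        (po_copair N (span_fst K T i j) (span_snd M T i j)
           (fst (leibniz_injs K M N T i' j') \<cdot>\<^bsub>N\<^esub> FArr T (a, d))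
           (snd (leibniz_injs K M N T i' j') \<cdot>\<^bsub>N\<^esub> FArr T (b, c)),
         FArr T (b, d)),
        leibniz_tens_obj K M N T i' j'))\<rparr>"

text \<open>The cospan \<open>H(B, Y) \<rightarrow> H(A, Y) \<leftarrow> H(A, X)\<close> for \<open>i : A \<rightarrow> B\<close>, \<open>f : X \<rightarrow> Y\<close> and a bifunctor
  \<open>H : P\<^sup>o\<^sup>p \<times> N \<rightarrow> Q\<close>.\<close>

definition cospan_fst ::
    "('n, 'na) cat \<Rightarrow> ('p \<times> 'n, 'pa \<times> 'na, 'q, 'qa) funct \<Rightarrow> 'pa \<Rightarrow> 'na \<Rightarrow> 'qa" where
  "cospan_fst N H i f = FArr H (i, Idt N (Cod N f))"

definition cospan_snd ::
    "('p, 'pa) cat \<Rightarrow> ('p \<times> 'n, 'pa \<times> 'na, 'q, 'qa) funct \<Rightarrow> 'pa \<Rightarrow> 'na \<Rightarrow> 'qa" where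
  "cospan_snd P H i f = FArr H (Idt P (Dom P i), f)"

definition leibniz_projs ::
    "('p, 'pa) cat \<Rightarrow> ('n, 'na) cat \<Rightarrow> ('q, 'qa) cat \<Rightarrow> ('p \<times> 'n, 'pa \<times> 'na, 'q, 'qa) funct \<Rightarrow>
     'pa \<Rightarrow> 'na \<Rightarrow> 'qa \<times> 'qa" where
  "leibniz_projs P N Q H i f = pullback_of Q (cospan_fst N H i f) (cospan_snd P H i f)"

definition leibniz_hom_obj ::
    "('p, 'pa) cat \<Rightarrow> ('n, 'na) cat \<Rightarrow> ('q, 'qa) cat \<Rightarrow> ('p \<times> 'n, 'pa \<times> 'na, 'q, 'qa) funct \<Rightarrow>
     'pa \<Rightarrow> 'na \<Rightarrow> 'qa" where
  "leibniz_hom_obj P N Q H i f = pb_pair Q (cospan_fst N H i f) (cospan_snd P H i f)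
     (FArr H (Idt P (Cod P i), f)) (FArr H (i, Idt N (Dom N f)))"

text \<open>An arrow \<open>i \<rightarrow> i'\<close> of \<open>(P\<^sup>2)\<^sup>o\<^sup>p\<close> is a square \<open>(a, b) : i' \<Rightarrow> i\<close>.\<close>

definition leibniz_hom ::
    "('p, 'pa) cat \<Rightarrow> ('n, 'na) cat \<Rightarrow> ('q, 'qa) cat \<Rightarrow> ('p \<times> 'n, 'pa \<times> 'na, 'q, 'qa) funct \<Rightarrow>
     ('pa \<times> 'na, ('pa, 'pa) sq \<times> ('na, 'na) sq, 'qa, ('qa, 'qa) sq) funct" where
  "leibniz_hom P N Q H = \<lparr>
     FObj = (\<lambda>(i, f). leibniz_hom_obj P N Q H i f),
     FArr = (\<lambda>((i', (a, b), i), (f, (x, y), f')).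
       (leibniz_hom_obj P N Q H i f,
        (FArr H (b, x),
         pb_pair Q (cospan_fst N H i' f') (cospan_snd P H i' f')
           (FArr H (b, y) \<cdot>\<^bsub>Q\<^esub> fst (leibniz_projs P N Q H i f))
           (FArr H (a, x) \<cdot>\<^bsub>Q\<^esub> snd (leibniz_projs P N Q H i f))),
        leibniz_hom_obj P N Q H i' f'))\<rparr>"

text \<open>A square \<open>(p, q) : i \<otimes> j \<Rightarrow> f\<close> is transposed by transposing \<open>q\<close> and the two components of
  \<open>p\<close> on the pushout.\<close>

definition leibniz_two_var ::
    "('k, 'ka) cat \<Rightarrow> ('m, 'ma) cat \<Rightarrow> ('n, 'na) cat \<Rightarrow> ('k, 'ka, 'm, 'ma, 'n, 'na) two_var \<Rightarrow>
     ('ka, ('ka, 'ka) sq, 'ma, ('ma, 'ma) sq, 'na, ('na, 'na) sq) two_var" where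
  "leibniz_two_var K M N A = \<lparr>
     tens = leibniz_tens K M N (tens A),
     homl = leibniz_hom K N M (homl A),
     homr = leibniz_hom M N K (homr A),
     trl = (\<lambda>i j f (_, (p, q), _).
       (j,
        (trl A (Cod K i) (Dom M j) (Dom N f) (p \<cdot>\<^bsub>N\<^esub> snd (leibniz_injs K M N (tens A) i j)),
         pb_pair M (cospan_fst N (homl A) i f) (cospan_snd K (homl A) i f)
           (trl A (Cod K i) (Cod M j) (Cod N f) q)
           (trl A (Dom K i) (Cod M j) (Dom N f) (p \<cdot>\<^bsub>N\<^esub> fst (leibniz_injs K M N (tens A) i j)))),
        leibniz_hom_obj K N M (homl A) i f)),
     trr = (\<lambda>i j f (_, (p, q), _).
       (i,
        (trr A (Dom K i) (Cod M j) (Dom N f) (p \<cdot>\<^bsub>N\<^esub> fst (leibniz_injs K M N (tens A) i j)),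
         pb_pair K (cospan_fst N (homr A) j f) (cospan_snd M (homr A) j f)
           (trr A (Cod K i) (Cod M j) (Cod N f) q)
           (trr A (Cod K i) (Dom M j) (Dom N f) (p \<cdot>\<^bsub>N\<^esub> snd (leibniz_injs K M N (tens A) i j)))),
        leibniz_hom_obj M N K (homr A) j f))\<rparr>"


section \<open>Mates\<close>

text \<open>Adjunctions \<open>F \<stileturn> G\<close> between \<open>C\<close> and \<open>D\<close>, and \<open>F' \<stileturn> G'\<close> between \<open>C'\<close> and \<open>D'\<close>, are given by
  transposition maps \<open>\<phi> x y : D(Fx, y) \<rightarrow> C(x, Gy)\<close> and \<open>\<phi>'\<close>.  For functors \<open>U : C \<rightarrow> C'\<close> and
  \<open>V : D \<rightarrow> D'\<close>, the mate of \<open>\<lambda> : F' U \<Rightarrow> V F\<close> is \<open>G' V \<epsilon> \<cdot> G' \<lambda> G \<cdot> \<eta>' U G : U G \<Rightarrow> G' V\<close>.\<close>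

definition adj_unit ::
    "('p, 'b) cat \<Rightarrow> ('o, 'a, 'p, 'b) funct \<Rightarrow> ('o \<Rightarrow> 'p \<Rightarrow> 'b \<Rightarrow> 'a) \<Rightarrow> 'o \<Rightarrow> 'a" where
  "adj_unit D F \<phi> x = \<phi> x (FObj F x) (Idt D (FObj F x))"

definition adj_counit ::
    "('o, 'a) cat \<Rightarrow> ('p, 'b) cat \<Rightarrow> ('o, 'a, 'p, 'b) funct \<Rightarrow> ('p, 'b, 'o, 'a) funct \<Rightarrow>
     ('o \<Rightarrow> 'p \<Rightarrow> 'b \<Rightarrow> 'a) \<Rightarrow> 'p \<Rightarrow> 'b" where
  "adj_counit C D F G \<phi> y =
     the_inv_into (hom D (FObj F (FObj G y)) y) (\<phi> (FObj G y) y) (Idt C (FObj G y))"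

definition mates ::
    "('o, 'a) cat \<Rightarrow> ('p, 'b) cat \<Rightarrow> ('o, 'a, 'p, 'b) funct \<Rightarrow> ('p, 'b, 'o, 'a) funct \<Rightarrow>
     ('o \<Rightarrow> 'p \<Rightarrow> 'b \<Rightarrow> 'a) \<Rightarrow>
     ('o', 'a') cat \<Rightarrow> ('p', 'b') cat \<Rightarrow> ('o', 'a', 'p', 'b') funct \<Rightarrow> ('p', 'b', 'o', 'a') funct \<Rightarrow>
     ('o' \<Rightarrow> 'p' \<Rightarrow> 'b' \<Rightarrow> 'a') \<Rightarrow>
     ('o, 'a, 'o', 'a') funct \<Rightarrow> ('p, 'b, 'p', 'b') funct \<Rightarrow> ('o \<Rightarrow> 'b') \<Rightarrow> ('p \<Rightarrow> 'a') \<Rightarrow> bool" where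
  "mates C D F G \<phi> C' D' F' G' \<phi>' U V lam rho \<longleftrightarrow>
     (\<forall>y\<in>Obj D. rho y =
        FArr G' (FArr V (adj_counit C D F G \<phi> y)) \<cdot>\<^bsub>C'\<^esub> FArr G' (lam (FObj G y)) \<cdot>\<^bsub>C'\<^esub>
        adj_unit D' F' \<phi>' (FObj U (FObj G y)))"


section \<open>Two-variable adjunctions of awfs\<close>

record ('ka, 'ma, 'na) lifted_two_var =
  ltens :: "(('ka \<times> 'ka) \<times> ('ma \<times> 'ma), ('ka \<times> 'ka, 'ka) sq \<times> ('ma \<times> 'ma, 'ma) sq,
             'na \<times> 'na, ('na \<times> 'na, 'na) sq) funct"
  lhoml :: "(('ka \<times> 'ka) \<times> ('na \<times> 'na), ('ka \<times> 'ka, 'ka) sq \<times> ('na \<times> 'na, 'na) sq,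
             'ma \<times> 'ma, ('ma \<times> 'ma, 'ma) sq) funct"
  lhomr :: "(('ma \<times> 'ma) \<times> ('na \<times> 'na), ('ma \<times> 'ma, 'ma) sq \<times> ('na \<times> 'na, 'na) sq,
             'ka \<times> 'ka, ('ka \<times> 'ka, 'ka) sq) funct"

text \<open>\<open>S\<close> lifts the bifunctor \<open>B\<close> on arrow categories to categories \<open>X\<close>, \<open>Y\<close>, \<open>Z\<close> of arrows with
  structure (the first of which may be an opposite).\<close>

definition is_lift ::
    "('a \<times> 's, ('a \<times> 's, 'a) sq) cat \<Rightarrow> ('b \<times> 't, ('b \<times> 't, 'b) sq) cat \<Rightarrow>
     ('c \<times> 'r, ('c \<times> 'r, 'c) sq) cat \<Rightarrow>
     ('a \<times> 'b, ('a, 'a) sq \<times> ('b, 'b) sq, 'c, ('c, 'c) sq) funct \<Rightarrow>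
     (('a \<times> 's) \<times> ('b \<times> 't), ('a \<times> 's, 'a) sq \<times> ('b \<times> 't, 'b) sq,
      'c \<times> 'r, ('c \<times> 'r, 'c) sq) funct \<Rightarrow> bool" where
  "is_lift X Y Z B S \<longleftrightarrow> is_functor (prod_cat X Y) Z S \<and>
     functors_agree (prod_cat X Y) (forget \<circ>\<^sub>F S) (B \<circ>\<^sub>F (forget \<times>\<^sub>F forget))"

definition characterizes_tens ::
    "('k, 'ka) cat \<Rightarrow> ('m, 'ma) cat \<Rightarrow> ('n, 'na) cat \<Rightarrow> ('k \<times> 'm, 'ka \<times> 'ma, 'n, 'na) funct \<Rightarrow>
     ('k, 'ka) awfs_data \<Rightarrow> ('m, 'ma) awfs_data \<Rightarrow> ('n, 'na) awfs_data \<Rightarrow>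
     ('ka \<times> 'ma \<Rightarrow> 'na) \<Rightarrow>
     (('ka \<times> 'ka) \<times> ('ma \<times> 'ma), ('ka \<times> 'ka, 'ka) sq \<times> ('ma \<times> 'ma, 'ma) sq,
      'na \<times> 'na, ('na \<times> 'na, 'na) sq) funct \<Rightarrow> bool" where
  "characterizes_tens K M N T W\<^sub>K W\<^sub>M W\<^sub>N lam S \<longleftrightarrow>
     nat_trans (prod_cat (arrow_cat K) (arrow_cat M)) N
       (T \<circ>\<^sub>F (mid W\<^sub>K \<times>\<^sub>F mid W\<^sub>M)) (mid W\<^sub>N \<circ>\<^sub>F leibniz_tens K M N T) lam \<and>
     (\<forall>(i, s)\<in>Obj (coalg K W\<^sub>K). \<forall>(j, t)\<in>Obj (coalg M W\<^sub>M).
        FObj S ((i, s), (j, t)) =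
          (leibniz_tens_obj K M N T i j, lam (i, j) \<cdot>\<^bsub>N\<^esub> FArr T (s, t)))"

definition characterizes_hom ::
    "('p, 'pa) cat \<Rightarrow> ('n, 'na) cat \<Rightarrow> ('q, 'qa) cat \<Rightarrow> ('p \<times> 'n, 'pa \<times> 'na, 'q, 'qa) funct \<Rightarrow>
     ('p, 'pa) awfs_data \<Rightarrow> ('n, 'na) awfs_data \<Rightarrow> ('q, 'qa) awfs_data \<Rightarrow>
     ('pa \<times> 'na \<Rightarrow> 'qa) \<Rightarrow>
     (('pa \<times> 'pa) \<times> ('na \<times> 'na), ('pa \<times> 'pa, 'pa) sq \<times> ('na \<times> 'na, 'na) sq,
      'qa \<times> 'qa, ('qa \<times> 'qa, 'qa) sq) funct \<Rightarrow> bool" where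
  "characterizes_hom P N Q H W\<^sub>P W\<^sub>N W\<^sub>Q rho S \<longleftrightarrow>
     nat_trans (prod_cat (op_cat (arrow_cat P)) (arrow_cat N)) Q
       (mid W\<^sub>Q \<circ>\<^sub>F leibniz_hom P N Q H) (H \<circ>\<^sub>F (mid W\<^sub>P \<times>\<^sub>F mid W\<^sub>N)) rho \<and>
     (\<forall>(i, s)\<in>Obj (coalg P W\<^sub>P). \<forall>(f, r)\<in>Obj (alg N W\<^sub>N).
        FObj S ((i, s), (f, r)) =
          (leibniz_hom_obj P N Q H i f, FArr H (s, r) \<cdot>\<^bsub>Q\<^esub> rho (i, f)))"

definition parameterized_mates ::
    "('k, 'ka) cat \<Rightarrow> ('m, 'ma) cat \<Rightarrow> ('n, 'na) cat \<Rightarrow> ('k, 'ka, 'm, 'ma, 'n, 'na) two_var \<Rightarrow>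
     ('k, 'ka) awfs_data \<Rightarrow> ('m, 'ma) awfs_data \<Rightarrow> ('n, 'na) awfs_data \<Rightarrow>
     ('ka \<times> 'ma \<Rightarrow> 'na) \<Rightarrow> ('ka \<times> 'na \<Rightarrow> 'ma) \<Rightarrow> ('ma \<times> 'na \<Rightarrow> 'ka) \<Rightarrow> bool" where
  "parameterized_mates K M N A W\<^sub>K W\<^sub>M W\<^sub>N lam rhol rhor \<longleftrightarrow>
     (let A' = leibniz_two_var K M N A in
       (\<forall>i\<in>Arr K. let q = FObj (mid W\<^sub>K) i in
          mates
            (arrow_cat M) (arrow_cat N)
            (fix_fst (arrow_cat K) (tens A') i) (fix_fst (arrow_cat K) (homl A') i) (trl A' i)
            M N (fix_fst K (tens A) q) (fix_fst K (homl A) q) (trl A q)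
            (mid W\<^sub>M) (mid W\<^sub>N) (\<lambda>j. lam (i, j)) (\<lambda>f. rhol (i, f))) \<and>
       (\<forall>j\<in>Arr M. let q = FObj (mid W\<^sub>M) j in
          mates
            (arrow_cat K) (arrow_cat N)
            (fix_snd (arrow_cat M) (tens A') j) (fix_fst (arrow_cat M) (homr A') j) (\<lambda>i. trr A' i j)
            K N (fix_snd M (tens A) q) (fix_fst M (homr A) q) (\<lambda>k. trr A k q)
            (mid W\<^sub>K) (mid W\<^sub>N) (\<lambda>i. lam (i, j)) (\<lambda>f. rhor (j, f))))"

definition two_var_adjunction_of_awfs ::
    "('k, 'ka) cat \<Rightarrow> ('m, 'ma) cat \<Rightarrow> ('n, 'na) cat \<Rightarrow> ('k, 'ka, 'm, 'ma, 'n, 'na) two_var \<Rightarrow>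
     ('k, 'ka) awfs_data \<Rightarrow> ('m, 'ma) awfs_data \<Rightarrow> ('n, 'na) awfs_data \<Rightarrow>
     ('ka, 'ma, 'na) lifted_two_var \<Rightarrow> bool" where
  "two_var_adjunction_of_awfs K M N A W\<^sub>K W\<^sub>M W\<^sub>N S \<longleftrightarrow>
     is_lift (coalg K W\<^sub>K) (coalg M W\<^sub>M) (coalg N W\<^sub>N) (leibniz_tens K M N (tens A)) (ltens S) \<and>
     is_lift (op_cat (coalg K W\<^sub>K)) (alg N W\<^sub>N) (alg M W\<^sub>M) (leibniz_hom K N M (homl A)) (lhoml S) \<and>
     is_lift (op_cat (coalg M W\<^sub>M)) (alg N W\<^sub>N) (alg K W\<^sub>K) (leibniz_hom M N K (homr A)) (lhomr S) \<and>
     (\<exists>lam rhol rhor.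
        characterizes_tens K M N (tens A) W\<^sub>K W\<^sub>M W\<^sub>N lam (ltens S) \<and>
        characterizes_hom K N M (homl A) W\<^sub>K W\<^sub>N W\<^sub>M rhol (lhoml S) \<and>
        characterizes_hom M N K (homr A) W\<^sub>M W\<^sub>N W\<^sub>K rhor (lhomr S) \<and>
        parameterized_mates K M N A W\<^sub>K W\<^sub>M W\<^sub>N lam rhol rhor)"

definition lifted_two_var_agree ::
    "('k, 'ka) cat \<Rightarrow> ('m, 'ma) cat \<Rightarrow> ('n, 'na) cat \<Rightarrow>
     ('k, 'ka) awfs_data \<Rightarrow> ('m, 'ma) awfs_data \<Rightarrow> ('n, 'na) awfs_data \<Rightarrow>
     ('ka, 'ma, 'na) lifted_two_var \<Rightarrow> ('ka, 'ma, 'na) lifted_two_var \<Rightarrow> bool" where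
  "lifted_two_var_agree K M N W\<^sub>K W\<^sub>M W\<^sub>N S S' \<longleftrightarrow>
     functors_agree (prod_cat (coalg K W\<^sub>K) (coalg M W\<^sub>M)) (ltens S) (ltens S') \<and>
     functors_agree (prod_cat (op_cat (coalg K W\<^sub>K)) (alg N W\<^sub>N)) (lhoml S) (lhoml S') \<and>
     functors_agree (prod_cat (op_cat (coalg M W\<^sub>M)) (alg N W\<^sub>N)) (lhomr S) (lhomr S')"

end

theory Submission
  imports Defs
begin

text \<open>
  Write \<open>x = (i, s)\<close> and \<open>y = (j, t)\<close> for coalgebras of the two left classes and \<open>z = (f, r)\<close> for an
  algebra of the right class on \<open>N\<close>.  A two-variable adjunction of awfs assigns to each such triple
  three families of canonical solutions: of \<open>x \<otimes> y\<close> against \<open>z\<close>, of \<open>y\<close> against \<open>hom\<^sub>l(x, z)\<close>, and of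
  \<open>x\<close> against \<open>hom\<^sub>r(y, z)\<close>.  That the characterizing transformations are mates says precisely that
  these families are transposes of each other along the ordinary two-variable adjunction
  (\<open>mate_transpose\<close>, \<open>transpose_solution\<close>, \<open>solution_transposes\<close>).  Transposition of lifting
  problems and of their solutions is bijective, so any one of the families determines the other two.

  Generation enters through the isomorphism between algebras and chosen lifts: an algebra is
  determined by its canonical solutions against the generators (\<open>generated_algebra_eqI\<close>).  Hence, if
  two lifted adjunctions solve the problems of \<open>x \<otimes> y\<close> against \<open>z\<close> in the same way for all \<open>y\<close> in the
  image of \<open>J\<close>, they give the same algebra \<open>hom\<^sub>l(x, z)\<close>, and transposing back they agree for all
  coalgebras \<open>y\<close> (\<open>determined_by_generators\<close>).  Applied with \<open>x\<close> in the image of \<open>I\<close> this extends the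
  agreement from generators \<open>(x, y)\<close> to arbitrary \<open>y\<close>; applied to the other variable it extends it to
  arbitrary \<open>x\<close>.  At that point the two algebra-valued functors agree on objects.  The coalgebra
  \<open>x \<otimes> y\<close> is recovered from its canonical solutions as well: its structure map is the solution of the
  unit square against a free algebra (\<open>coalgebra_eqI\<close>).  On morphisms there is nothing left to
  compare, because the forgetful functors to arrow categories are faithful (\<open>lifts_agreeI\<close>).
\<close>

section \<open>Composition, functors and pullbacks\<close>

lemma homD:
  assumes "f \<in> hom C x y"
  shows "f \<in> Arr C" "Dom C f = x" "Cod C f = y"
  using assms by (auto simp: hom_def)

lemma Arr_hom: "f \<in> Arr C \<Longrightarrow> f \<in> hom C (Dom C f) (Cod C f)"
  by (simp add: hom_def)

lemma category_hom_Obj: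
  assumes "category C" "f \<in> hom C x y"
  shows "x \<in> Obj C" "y \<in> Obj C"
  using assms by (auto simp: category_def hom_def)

lemma category_id: "category C \<Longrightarrow> x \<in> Obj C \<Longrightarrow> Idt C x \<in> hom C x x"
  by (auto simp: category_def)

lemma category_comp:
  "category C \<Longrightarrow> f \<in> hom C x y \<Longrightarrow> g \<in> hom C y z \<Longrightarrow> g \<cdot>\<^bsub>C\<^esub> f \<in> hom C x z"
  by (fastforce simp: category_def hom_def)

lemma category_id_right: "category C \<Longrightarrow> f \<in> hom C x y \<Longrightarrow> f \<cdot>\<^bsub>C\<^esub> Idt C x = f"
  and category_id_left: "category C \<Longrightarrow> f \<in> hom C x y \<Longrightarrow> Idt C y \<cdot>\<^bsub>C\<^esub> f = f"
  by (auto simp: category_def hom_def)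

lemma category_assoc:
  "category C \<Longrightarrow> f \<in> hom C w x \<Longrightarrow> g \<in> hom C x y \<Longrightarrow> h \<in> hom C y z \<Longrightarrow>
     (h \<cdot>\<^bsub>C\<^esub> g) \<cdot>\<^bsub>C\<^esub> f = h \<cdot>\<^bsub>C\<^esub> (g \<cdot>\<^bsub>C\<^esub> f)"
  by (simp add: category_def hom_def)

lemma hom_op_cat [simp]: "hom (op_cat C) x y = hom C y x"
  by (auto simp: hom_def op_cat_def)

lemma op_cat_simps [simp]:
  "Obj (op_cat C) = Obj C" "Arr (op_cat C) = Arr C" "Dom (op_cat C) = Cod C"
  "Cod (op_cat C) = Dom C" "Idt (op_cat C) = Idt C" "g \<cdot>\<^bsub>op_cat C\<^esub> f = f \<cdot>\<^bsub>C\<^esub> g"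
  by (auto simp: op_cat_def)

lemma hom_prod_cat [simp]:
  "(f, g) \<in> hom (prod_cat C D) (x, y) (x', y') \<longleftrightarrow> f \<in> hom C x x' \<and> g \<in> hom D y y'"
  by (auto simp: hom_def prod_cat_def)

lemma prod_cat_simps [simp]:
  "Obj (prod_cat C D) = Obj C \<times> Obj D" "Arr (prod_cat C D) = Arr C \<times> Arr D"
  "Dom (prod_cat C D) (f, g) = (Dom C f, Dom D g)" "Cod (prod_cat C D) (f, g) = (Cod C f, Cod D g)"
  "Idt (prod_cat C D) (x, y) = (Idt C x, Idt D y)"
  "(f', g') \<cdot>\<^bsub>prod_cat C D\<^esub> (f, g) = (f' \<cdot>\<^bsub>C\<^esub> f, g' \<cdot>\<^bsub>D\<^esub> g)"
  by (auto simp: prod_cat_def)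

lemma functor_Obj: "is_functor C D F \<Longrightarrow> x \<in> Obj C \<Longrightarrow> FObj F x \<in> Obj D"
  by (simp add: is_functor_def)

lemma functor_hom: "is_functor C D F \<Longrightarrow> f \<in> hom C x y \<Longrightarrow> FArr F f \<in> hom D (FObj F x) (FObj F y)"
  by (auto simp: is_functor_def hom_def)

lemma functor_id: "is_functor C D F \<Longrightarrow> x \<in> Obj C \<Longrightarrow> FArr F (Idt C x) = Idt D (FObj F x)"
  by (simp add: is_functor_def)

lemma functor_comp:
  "is_functor C D F \<Longrightarrow> f \<in> hom C x y \<Longrightarrow> g \<in> hom C y z \<Longrightarrow>
     FArr F (g \<cdot>\<^bsub>C\<^esub> f) = FArr F g \<cdot>\<^bsub>D\<^esub> FArr F f"
  by (simp add: is_functor_def hom_def)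

lemma nat_trans_hom: "nat_trans C D F G \<tau> \<Longrightarrow> x \<in> Obj C \<Longrightarrow> \<tau> x \<in> hom D (FObj F x) (FObj G x)"
  by (simp add: nat_trans_def)

lemma nat_trans_square:
  "nat_trans C D F G \<tau> \<Longrightarrow> f \<in> hom C x y \<Longrightarrow> FArr G f \<cdot>\<^bsub>D\<^esub> \<tau> x = \<tau> y \<cdot>\<^bsub>D\<^esub> FArr F f"
  by (auto simp: nat_trans_def hom_def)

lemma hom_arrow_cat_iff:
  "(f', (u, v), g') \<in> hom (arrow_cat C) f g \<longleftrightarrow> f' = f \<and> g' = g \<and> f \<in> Arr C \<and> g \<in> Arr C \<and>
     u \<in> hom C (Dom C f) (Dom C g) \<and> v \<in> hom C (Cod C f) (Cod C g) \<and> g \<cdot>\<^bsub>C\<^esub> u = v \<cdot>\<^bsub>C\<^esub> f"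
  by (auto simp: hom_def arrow_cat_def)

lemma hom_arrow_catE:
  assumes "w \<in> hom (arrow_cat C) f g"
  obtains u v where "w = (f, (u, v), g)" "f \<in> Arr C" "g \<in> Arr C"
    "u \<in> hom C (Dom C f) (Dom C g)" "v \<in> hom C (Cod C f) (Cod C g)" "g \<cdot>\<^bsub>C\<^esub> u = v \<cdot>\<^bsub>C\<^esub> f"
  using assms by (auto simp: hom_def arrow_cat_def)

lemma arrow_cat_simps [simp]:
  "Obj (arrow_cat C) = Arr C"
  "Dom (arrow_cat C) (f, w, g) = f" "Cod (arrow_cat C) (f, w, g) = g"
  "Idt (arrow_cat C) f = (f, (Idt C (Dom C f), Idt C (Cod C f)), f)"
  "(g, (u', v'), h) \<cdot>\<^bsub>arrow_cat C\<^esub> (f, (u, v), g') = (f, (u' \<cdot>\<^bsub>C\<^esub> u, v' \<cdot>\<^bsub>C\<^esub> v), h)"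
  by (auto simp: arrow_cat_def)

lemma Arr_arrow_cat_iff: "(f, w, g) \<in> Arr (arrow_cat C) \<longleftrightarrow> (f, w, g) \<in> hom (arrow_cat C) f g"
  by (simp add: hom_def)

lemma comp_sq_hom:
  assumes C: "category C" and w: "w \<in> hom (arrow_cat C) f g" and w': "w' \<in> hom (arrow_cat C) g h"
  shows "w' \<cdot>\<^bsub>arrow_cat C\<^esub> w \<in> hom (arrow_cat C) f h"
proof -
  obtain u v where 1: "w = (f, (u, v), g)" "f \<in> Arr C" "g \<in> Arr C"
    "u \<in> hom C (Dom C f) (Dom C g)" "v \<in> hom C (Cod C f) (Cod C g)" "g \<cdot>\<^bsub>C\<^esub> u = v \<cdot>\<^bsub>C\<^esub> f"
    using w by (rule hom_arrow_catE)
  obtain u' v' where 2: "w' = (g, (u', v'), h)" "h \<in> Arr C"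
    "u' \<in> hom C (Dom C g) (Dom C h)" "v' \<in> hom C (Cod C g) (Cod C h)" "h \<cdot>\<^bsub>C\<^esub> u' = v' \<cdot>\<^bsub>C\<^esub> g"
    using w' by (rule hom_arrow_catE)
  note a = category_assoc[OF C] and h = Arr_hom[OF 1(2)] Arr_hom[OF 1(3)] Arr_hom[OF 2(2)]
  have "h \<cdot>\<^bsub>C\<^esub> (u' \<cdot>\<^bsub>C\<^esub> u) = (v' \<cdot>\<^bsub>C\<^esub> v) \<cdot>\<^bsub>C\<^esub> f"
    by (metis a[OF 1(4) 2(3) h(3)] a[OF 1(4) h(2) 2(4)] a[OF h(1) 1(5) 2(4)] 1(6) 2(5))
  with 1 2 show ?thesis by (auto simp: hom_arrow_cat_iff intro: category_comp[OF C])
qed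

lemma category_arrow_cat:
  assumes C: "category C"
  shows "category (arrow_cat C)"
proof -
  let ?A = "arrow_cat C"
  have id: "Idt ?A f \<in> hom ?A f f" if "f \<in> Arr C" for f
  proof -
    note f = Arr_hom[OF that]
    show ?thesis
      using category_id[OF C category_hom_Obj(1)[OF C f]] category_id[OF C category_hom_Obj(2)[OF C f]]
        category_id_left[OF C f] category_id_right[OF C f] that
      by (simp add: hom_arrow_cat_iff)
  qed
  have sq: "w \<in> hom ?A (Dom ?A w) (Cod ?A w)" if "w \<in> Arr ?A" for w
    using Arr_hom[OF that] .
  have unit: "w \<cdot>\<^bsub>?A\<^esub> Idt ?A f = w \<and> Idt ?A g \<cdot>\<^bsub>?A\<^esub> w = w" if "w \<in> hom ?A f g" for w f g
    using that by (elim hom_arrow_catE) (simp add: category_id_left[OF C] category_id_right[OF C])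
  have assoc: "w'' \<cdot>\<^bsub>?A\<^esub> (w' \<cdot>\<^bsub>?A\<^esub> w) = (w'' \<cdot>\<^bsub>?A\<^esub> w') \<cdot>\<^bsub>?A\<^esub> w"
    if "w \<in> hom ?A f g" "w' \<in> hom ?A g h" "w'' \<in> hom ?A h k" for w w' w'' f g h k
    using that by (elim hom_arrow_catE) (simp add: category_assoc[OF C])
  have obj: "f \<in> Arr C \<and> g \<in> Arr C" if "w \<in> hom ?A f g" for w f g
    using that by (elim hom_arrow_catE) simp
  show ?thesis
    unfolding category_def
  proof (intro conjI ballI impI)
    fix w assume w: "w \<in> Arr ?A"
    show "Dom ?A w \<in> Obj ?A" "Cod ?A w \<in> Obj ?A" using obj[OF sq[OF w]] by simp_all
    show "w \<cdot>\<^bsub>?A\<^esub> Idt ?A (Dom ?A w) = w" "Idt ?A (Cod ?A w) \<cdot>\<^bsub>?A\<^esub> w = w"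
      using unit[OF sq[OF w]] by simp_all
    fix w' assume w': "w' \<in> Arr ?A" and c: "Dom ?A w' = Cod ?A w"
    show "w' \<cdot>\<^bsub>?A\<^esub> w \<in> hom ?A (Dom ?A w) (Cod ?A w')"
      using comp_sq_hom[OF C sq[OF w]] sq[OF w'] c by simp
    fix w'' assume w'': "w'' \<in> Arr ?A" and c': "Dom ?A w'' = Cod ?A w'"
    show "w'' \<cdot>\<^bsub>?A\<^esub> (w' \<cdot>\<^bsub>?A\<^esub> w) = (w'' \<cdot>\<^bsub>?A\<^esub> w') \<cdot>\<^bsub>?A\<^esub> w"
      using assoc[OF sq[OF w]] sq[OF w'] sq[OF w''] c c' by simp
  next
    fix f assume "f \<in> Obj ?A"
    then show "Idt ?A f \<in> hom ?A f f" using id by simp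
  qed
qed

text \<open>Pullbacks in the opposite category are pushouts, so the following facts serve for both.\<close>

lemma pullback_of_is_pullback:
  assumes "has_pullbacks C" "f \<in> Arr C" "g \<in> Arr C" "Cod C f = Cod C g"
  shows "is_pullback C f g (fst (pullback_of C f g)) (snd (pullback_of C f g))"
proof -
  have "\<exists>pq. case pq of (p, q) \<Rightarrow> is_pullback C f g p q"
    using assms by (auto simp: has_pullbacks_def)
  from someI_ex[OF this] show ?thesis
    unfolding pullback_of_def case_prod_beta .
qed

lemma is_pullbackD:
  assumes "is_pullback C f g p q"
  shows "p \<in> hom C (Dom C p) (Dom C f)" "q \<in> hom C (Dom C p) (Dom C g)" "f \<cdot>\<^bsub>C\<^esub> p = g \<cdot>\<^bsub>C\<^esub> q"
  using assms by (auto simp: is_pullback_def)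

lemma is_pullback_pair:
  assumes "is_pullback C f g p q" "x \<in> hom C z (Dom C f)" "y \<in> hom C z (Dom C g)"
    "f \<cdot>\<^bsub>C\<^esub> x = g \<cdot>\<^bsub>C\<^esub> y"
  shows "\<exists>!h. h \<in> hom C z (Dom C p) \<and> p \<cdot>\<^bsub>C\<^esub> h = x \<and> q \<cdot>\<^bsub>C\<^esub> h = y"
  using assms(1) homD[OF assms(2)] homD[OF assms(3)] assms(4) unfolding is_pullback_def by metis

lemma is_pullback_sym:
  assumes pb: "is_pullback C f g p q"
  shows "is_pullback C g f q p"
proof -
  have pq: "Dom C p = Dom C q" using homD(2)[OF is_pullbackD(2)[OF pb]] by simp
  have "\<exists>!h. h \<in> hom C (Dom C x) (Dom C q) \<and> q \<cdot>\<^bsub>C\<^esub> h = x \<and> p \<cdot>\<^bsub>C\<^esub> h = y"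
    if "x \<in> Arr C" "y \<in> Arr C" "Dom C x = Dom C y" "Cod C x = Dom C g" "Cod C y = Dom C f"
      "g \<cdot>\<^bsub>C\<^esub> x = f \<cdot>\<^bsub>C\<^esub> y" for x y
    using is_pullback_pair[OF pb, of y "Dom C x" x] that pq by (simp add: hom_def conj_commute)
  then show ?thesis using pb pq by (simp add: is_pullback_def)
qed

lemma is_pullback_eqI:
  assumes C: "category C" and pb: "is_pullback C f g p q"
    and h: "h \<in> hom C z (Dom C p)" "h' \<in> hom C z (Dom C p)"
    and eq: "p \<cdot>\<^bsub>C\<^esub> h = p \<cdot>\<^bsub>C\<^esub> h'" "q \<cdot>\<^bsub>C\<^esub> h = q \<cdot>\<^bsub>C\<^esub> h'"
  shows "h = h'"
proof -
  note p = is_pullbackD(1)[OF pb] and q = is_pullbackD(2)[OF pb]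
  have fg: "f \<in> hom C (Dom C f) (Cod C f)" "g \<in> hom C (Dom C g) (Cod C f)"
    using pb by (auto simp: is_pullback_def hom_def)
  have "f \<cdot>\<^bsub>C\<^esub> (p \<cdot>\<^bsub>C\<^esub> h) = g \<cdot>\<^bsub>C\<^esub> (q \<cdot>\<^bsub>C\<^esub> h)"
    using category_assoc[OF C h(1) p fg(1)] category_assoc[OF C h(1) q fg(2)] is_pullbackD(3)[OF pb]
    by simp
  from is_pullback_pair[OF pb category_comp[OF C h(1) p] category_comp[OF C h(1) q] this]
  show ?thesis using h eq by metis
qed

lemma pb_pair:
  assumes "has_pullbacks C" "f \<in> Arr C" "g \<in> Arr C" "Cod C f = Cod C g"
    and "x \<in> hom C z (Dom C f)" "y \<in> hom C z (Dom C g)" "f \<cdot>\<^bsub>C\<^esub> x = g \<cdot>\<^bsub>C\<^esub> y"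
  shows "pb_pair C f g x y \<in> hom C z (Dom C (fst (pullback_of C f g)))"
    and "fst (pullback_of C f g) \<cdot>\<^bsub>C\<^esub> pb_pair C f g x y = x"
    and "snd (pullback_of C f g) \<cdot>\<^bsub>C\<^esub> pb_pair C f g x y = y"
proof -
  have "\<exists>!h. h \<in> hom C z (Dom C (fst (pullback_of C f g))) \<and>
      fst (pullback_of C f g) \<cdot>\<^bsub>C\<^esub> h = x \<and> snd (pullback_of C f g) \<cdot>\<^bsub>C\<^esub> h = y"
    using is_pullback_pair[OF pullback_of_is_pullback[OF assms(1-4)] assms(5-7)] .
  from theI'[OF this] homD(2)[OF assms(5)]
  show "pb_pair C f g x y \<in> hom C z (Dom C (fst (pullback_of C f g)))"
    and "fst (pullback_of C f g) \<cdot>\<^bsub>C\<^esub> pb_pair C f g x y = x"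
    and "snd (pullback_of C f g) \<cdot>\<^bsub>C\<^esub> pb_pair C f g x y = y"
    by (simp_all add: pb_pair_def split_beta)
qed


section \<open>Parameterized adjunctions\<close>

text \<open>A two-variable adjunction is, for each of its two hom functors, a bifunctor \<open>T\<close> with a right adjoint
  \<open>H\<close> in the variable \<open>X\<close>, depending on a parameter in \<open>P\<close>.  For \<open>hom\<^sub>l\<close> the parameter lives in \<open>K\<close>, for
  \<open>hom\<^sub>r\<close> it lives in \<open>M\<close> and the arguments of \<open>\<otimes>\<close> are exchanged.  Everything on one side is proved
  once for this situation.\<close>

locale parameterized_adjunction =
  fixes P :: "('p, 'pa) cat" and X :: "('x, 'xa) cat" and Y :: "('y, 'ya) cat"
    and T :: "('p \<times> 'x, 'pa \<times> 'xa, 'y, 'ya) funct"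
    and H :: "('p \<times> 'y, 'pa \<times> 'ya, 'x, 'xa) funct"
    and tr :: "'p \<Rightarrow> 'x \<Rightarrow> 'y \<Rightarrow> 'ya \<Rightarrow> 'xa"
  assumes P: "category P" and X: "category X" and Y: "category Y"
    and T: "is_functor (prod_cat P X) Y T" and H: "is_functor (prod_cat (op_cat P) Y) X H"
    and tr_bij: "p \<in> Obj P \<Longrightarrow> x \<in> Obj X \<Longrightarrow> y \<in> Obj Y \<Longrightarrow>
      bij_betw (tr p x y) (hom Y (FObj T (p, x)) y) (hom X x (FObj H (p, y)))"
    and tr_natural: "a \<in> hom P p' p \<Longrightarrow> b \<in> hom X x' x \<Longrightarrow> c \<in> hom Y y y' \<Longrightarrow>
      g \<in> hom Y (FObj T (p, x)) y \<Longrightarrow>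
      tr p' x' y' (c \<cdot>\<^bsub>Y\<^esub> g \<cdot>\<^bsub>Y\<^esub> FArr T (a, b)) = FArr H (a, c) \<cdot>\<^bsub>X\<^esub> tr p x y g \<cdot>\<^bsub>X\<^esub> b"
begin

lemma T_Obj: "p \<in> Obj P \<Longrightarrow> x \<in> Obj X \<Longrightarrow> FObj T (p, x) \<in> Obj Y"
  using functor_Obj[OF T] by simp

lemma H_Obj: "p \<in> Obj P \<Longrightarrow> y \<in> Obj Y \<Longrightarrow> FObj H (p, y) \<in> Obj X"
  using functor_Obj[OF H] by simp

lemma T_hom:
  "a \<in> hom P p p' \<Longrightarrow> b \<in> hom X x x' \<Longrightarrow> FArr T (a, b) \<in> hom Y (FObj T (p, x)) (FObj T (p', x'))"
  using functor_hom[OF T] by simp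

lemma H_hom:
  "a \<in> hom P p' p \<Longrightarrow> c \<in> hom Y y y' \<Longrightarrow> FArr H (a, c) \<in> hom X (FObj H (p, y)) (FObj H (p', y'))"
  using functor_hom[OF H] by simp

lemma T_id: "p \<in> Obj P \<Longrightarrow> x \<in> Obj X \<Longrightarrow> FArr T (Idt P p, Idt X x) = Idt Y (FObj T (p, x))"
  using functor_id[OF T, of "(p, x)"] by simp

lemma H_id: "p \<in> Obj P \<Longrightarrow> y \<in> Obj Y \<Longrightarrow> FArr H (Idt P p, Idt Y y) = Idt X (FObj H (p, y))"
  using functor_id[OF H, of "(p, y)"] by simp

lemma T_comp:
  assumes "a \<in> hom P p p'" "a' \<in> hom P p' p''" "b \<in> hom X x x'" "b' \<in> hom X x' x''"
  shows "FArr T (a', b') \<cdot>\<^bsub>Y\<^esub> FArr T (a, b) = FArr T (a' \<cdot>\<^bsub>P\<^esub> a, b' \<cdot>\<^bsub>X\<^esub> b)"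
  using functor_comp[OF T, of "(a, b)" "(p, x)" "(p', x')" "(a', b')" "(p'', x'')"] assms by simp

lemma H_comp:
  assumes "a \<in> hom P p p'" "a' \<in> hom P p' p''" "c \<in> hom Y y y'" "c' \<in> hom Y y' y''"
  shows "FArr H (a, c') \<cdot>\<^bsub>X\<^esub> FArr H (a', c) = FArr H (a' \<cdot>\<^bsub>P\<^esub> a, c' \<cdot>\<^bsub>Y\<^esub> c)"
  using functor_comp[OF H, of "(a', c)" "(p'', y)" "(p', y')" "(a, c')" "(p, y'')"] assms by simp

lemma tr_hom:
  "p \<in> Obj P \<Longrightarrow> x \<in> Obj X \<Longrightarrow> y \<in> Obj Y \<Longrightarrow> g \<in> hom Y (FObj T (p, x)) y \<Longrightarrow>
     tr p x y g \<in> hom X x (FObj H (p, y))"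
  by (rule bij_betw_apply[OF tr_bij])

lemma tr_inj:
  "p \<in> Obj P \<Longrightarrow> x \<in> Obj X \<Longrightarrow> y \<in> Obj Y \<Longrightarrow> tr p x y g = tr p x y g' \<Longrightarrow>
     g \<in> hom Y (FObj T (p, x)) y \<Longrightarrow> g' \<in> hom Y (FObj T (p, x)) y \<Longrightarrow> g = g'"
  by (rule inj_onD[OF bij_betw_imp_inj_on[OF tr_bij]])

lemma tr_eq_iff:
  assumes "p \<in> Obj P" "x \<in> Obj X" "y \<in> Obj Y"
    and "g \<in> hom Y (FObj T (p, x)) y" "g' \<in> hom Y (FObj T (p, x)) y"
  shows "tr p x y g = tr p x y g' \<longleftrightarrow> g = g'"
  using tr_inj[OF assms(1-3) _ assms(4,5)] by blast

lemma tr_surj: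
  assumes "p \<in> Obj P" "x \<in> Obj X" "y \<in> Obj Y" "h \<in> hom X x (FObj H (p, y))"
  obtains g where "g \<in> hom Y (FObj T (p, x)) y" "tr p x y g = h"
proof -
  have "h \<in> tr p x y ` hom Y (FObj T (p, x)) y"
    using assms(4) by (simp add: bij_betw_imp_surj_on[OF tr_bij[OF assms(1-3)]])
  then show ?thesis using that by (elim imageE) simp
qed

lemma tr_precomp_param:
  assumes a: "a \<in> hom P p' p" and x: "x \<in> Obj X" and g: "g \<in> hom Y (FObj T (p, x)) y"
  shows "tr p' x y (g \<cdot>\<^bsub>Y\<^esub> FArr T (a, Idt X x)) = FArr H (a, Idt Y y) \<cdot>\<^bsub>X\<^esub> tr p x y g"
proof -
  note y = category_hom_Obj(2)[OF Y g] and p = category_hom_Obj(2)[OF P a]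
  note i = category_id[OF X x] category_id[OF Y y]
  show ?thesis
    using tr_natural[OF a i g] category_id_left[OF Y category_comp[OF Y T_hom[OF a i(1)] g]]
      category_id_right[OF X tr_hom[OF p x y g]] by simp
qed

lemma tr_precomp:
  assumes b: "b \<in> hom X x' x" and p: "p \<in> Obj P" and g: "g \<in> hom Y (FObj T (p, x)) y"
  shows "tr p x' y (g \<cdot>\<^bsub>Y\<^esub> FArr T (Idt P p, b)) = tr p x y g \<cdot>\<^bsub>X\<^esub> b"
proof -
  note y = category_hom_Obj(2)[OF Y g] and x = category_hom_Obj(2)[OF X b]
  note i = category_id[OF P p] category_id[OF Y y]
  show ?thesis
    using tr_natural[OF i(1) b i(2) g] H_id[OF p y]
      category_id_left[OF Y category_comp[OF Y T_hom[OF i(1) b] g]]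
      category_id_left[OF X category_comp[OF X b tr_hom[OF p x y g]]] by simp
qed

lemma tr_postcomp:
  assumes c: "c \<in> hom Y y y'" and p: "p \<in> Obj P" and x: "x \<in> Obj X"
    and g: "g \<in> hom Y (FObj T (p, x)) y"
  shows "tr p x y' (c \<cdot>\<^bsub>Y\<^esub> g) = FArr H (Idt P p, c) \<cdot>\<^bsub>X\<^esub> tr p x y g"
proof -
  note y = category_hom_Obj(1)[OF Y c]
  note i = category_id[OF P p] category_id[OF X x]
  show ?thesis
    using tr_natural[OF i c g] T_id[OF p x] category_id_right[OF Y g]
      category_id_right[OF X tr_hom[OF p x y g]] by simp
qed

end


section \<open>Transposition along mates\<close>

text \<open>A left adjoint presented by its transposition maps.  Naturality is required in the variable of \<open>C\<close>;
  it makes every arrow \<open>F x \<rightarrow> y\<close> factor through the counit, which is how mates are computed with.\<close>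

definition transposes ::
    "('o, 'a) cat \<Rightarrow> ('p, 'b) cat \<Rightarrow> ('o, 'a, 'p, 'b) funct \<Rightarrow> ('p, 'b, 'o, 'a) funct \<Rightarrow>
     ('o \<Rightarrow> 'p \<Rightarrow> 'b \<Rightarrow> 'a) \<Rightarrow> bool" where
  "transposes C D F G \<phi> \<longleftrightarrow>
     (\<forall>x\<in>Obj C. FObj F x \<in> Obj D) \<and> (\<forall>y\<in>Obj D. FObj G y \<in> Obj C) \<and>
     (\<forall>x x' k. k \<in> hom C x x' \<longrightarrow> FArr F k \<in> hom D (FObj F x) (FObj F x')) \<and>
     (\<forall>x\<in>Obj C. \<forall>y\<in>Obj D. bij_betw (\<phi> x y) (hom D (FObj F x) y) (hom C x (FObj G y))) \<and>
     (\<forall>x x' y k h. k \<in> hom C x' x \<longrightarrow> h \<in> hom D (FObj F x) y \<longrightarrow>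
        \<phi> x' y (h \<cdot>\<^bsub>D\<^esub> FArr F k) = \<phi> x y h \<cdot>\<^bsub>C\<^esub> k)"

text \<open>Let \<open>k\<close> be the transpose of \<open>h\<close>, so that \<open>h\<close> is the counit \<open>e\<close> after \<open>F k\<close>.  By naturality of \<open>lam\<close> at
  \<open>k\<close>, the left-hand side is the transpose of \<open>V e \<cdot> lam\<close> followed by precomposition with \<open>U k\<close>, and the
  transpose of \<open>V e \<cdot> lam\<close> is what the mate \<open>rho\<close> is defined to be.\<close>

lemma mate_transpose:
  assumes cats: "category C" "category D" "category C'" "category D'"
    and \<phi>: "transposes C D F G \<phi>" and \<phi>': "transposes C' D' F' G' \<phi>'"
    and G': "is_functor D' C' G'"
    and post: "\<And>x y y' c g. x \<in> Obj C' \<Longrightarrow> c \<in> hom D' y y' \<Longrightarrow> g \<in> hom D' (FObj F' x) y \<Longrightarrow>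
      \<phi>' x y' (c \<cdot>\<^bsub>D'\<^esub> g) = FArr G' c \<cdot>\<^bsub>C'\<^esub> \<phi>' x y g"
    and U: "is_functor C C' U" and V: "is_functor D D' V"
    and lam: "nat_trans C D' (F' \<circ>\<^sub>F U) (V \<circ>\<^sub>F F) lam"
    and mates: "mates C D F G \<phi> C' D' F' G' \<phi>' U V lam rho"
    and x: "x \<in> Obj C" and h: "h \<in> hom D (FObj F x) y"
  shows "\<phi>' (FObj U x) (FObj V y) (FArr V h \<cdot>\<^bsub>D'\<^esub> lam x) = rho y \<cdot>\<^bsub>C'\<^esub> FArr U (\<phi> x y h)"
proof -
  note C = cats(1) and D = cats(2) and C' = cats(3) and D' = cats(4)
  have F: "FObj F x \<in> Obj D" "FArr F k \<in> hom D (FObj F x) (FObj F x')"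
    if "k \<in> hom C x x'" for k x x'
    using \<phi> that category_hom_Obj(1)[OF C that] by (auto simp: transposes_def)
  have F': "FArr F' k \<in> hom D' (FObj F' x) (FObj F' x')" if "k \<in> hom C' x x'" for k x x'
    using \<phi>' that by (auto simp: transposes_def)
  have nat: "\<phi> x' y (h \<cdot>\<^bsub>D\<^esub> FArr F k) = \<phi> x y h \<cdot>\<^bsub>C\<^esub> k"
    if "k \<in> hom C x' x" "h \<in> hom D (FObj F x) y" for k h x x' y
    using \<phi> that unfolding transposes_def by blast
  have nat': "\<phi>' x' y (h \<cdot>\<^bsub>D'\<^esub> FArr F' k) = \<phi>' x y h \<cdot>\<^bsub>C'\<^esub> k"
    if "k \<in> hom C' x' x" "h \<in> hom D' (FObj F' x) y" for k h x x' y
    using \<phi>' that unfolding transposes_def by blast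
  have lam_hom: "lam x \<in> hom D' (FObj F' (FObj U x)) (FObj V (FObj F x))" if "x \<in> Obj C" for x
    using nat_trans_hom[OF lam that] by (simp add: comp_funct_def)
  define k where "k = \<phi> x y h"
  have y: "y \<in> Obj D" using category_hom_Obj(2)[OF D h] .
  have Gy: "FObj G y \<in> Obj C" using \<phi> y by (simp add: transposes_def)
  have bij: "bij_betw (\<phi> x y) (hom D (FObj F x) y) (hom C x (FObj G y))" if "x \<in> Obj C" for x
    using \<phi> y that by (simp add: transposes_def)
  have k: "k \<in> hom C x (FObj G y)" unfolding k_def by (rule bij_betw_apply[OF bij[OF x] h])
  define e where "e = adj_counit C D F G \<phi> y"
  have id: "Idt C (FObj G y) \<in> hom C (FObj G y) (FObj G y)" by (rule category_id[OF C Gy])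
  have e: "e \<in> hom D (FObj F (FObj G y)) y"
    unfolding e_def adj_counit_def
    by (rule bij_betw_apply[OF bij_betw_the_inv_into[OF bij[OF Gy]] id])
  have \<phi>e: "\<phi> (FObj G y) y e = Idt C (FObj G y)"
    unfolding e_def adj_counit_def by (rule f_the_inv_into_f_bij_betw[OF bij[OF Gy] id])
  \<comment> \<open>Every arrow out of \<open>F x\<close> is the counit composed with the image of its transpose.\<close>
  have eFk: "e \<cdot>\<^bsub>D\<^esub> FArr F k = h"
  proof (rule inj_onD[OF bij_betw_imp_inj_on[OF bij[OF x]] _ _ h])
    show "\<phi> x y (e \<cdot>\<^bsub>D\<^esub> FArr F k) = \<phi> x y h"
      using nat[OF k e] \<phi>e category_id_left[OF C k] by (simp add: k_def)
    show "e \<cdot>\<^bsub>D\<^esub> FArr F k \<in> hom D (FObj F x) y" by (rule category_comp[OF D F(2)[OF k] e])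
  qed
  define x0 where "x0 = FObj U (FObj G y)"
  define f0 where "f0 = FObj F' x0"
  have x0: "x0 \<in> Obj C'" unfolding x0_def by (rule functor_Obj[OF U Gy])
  have f0: "f0 \<in> Obj D'" using \<phi>' x0 by (simp add: transposes_def f0_def)
  have Uk: "FArr U k \<in> hom C' (FObj U x) x0"
    unfolding x0_def by (rule functor_hom[OF U k])
  have Ve: "FArr V e \<in> hom D' (FObj V (FObj F (FObj G y))) (FObj V y)"
    by (rule functor_hom[OF V e])
  have VFk: "FArr V (FArr F k) \<in> hom D' (FObj V (FObj F x)) (FObj V (FObj F (FObj G y)))"
    by (rule functor_hom[OF V F(2)[OF k]])
  have l: "lam (FObj G y) \<in> hom D' f0 (FObj V (FObj F (FObj G y)))"
    using lam_hom[OF Gy] by (simp add: f0_def x0_def)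
  define m where "m = FArr V e \<cdot>\<^bsub>D'\<^esub> lam (FObj G y)"
  have m: "m \<in> hom D' f0 (FObj V y)" unfolding m_def by (rule category_comp[OF D' l Ve])
  have unit: "adj_unit D' F' \<phi>' x0 = \<phi>' x0 f0 (Idt D' f0)"
    by (simp add: adj_unit_def f0_def)
  have "rho y = FArr G' (FArr V e) \<cdot>\<^bsub>C'\<^esub> FArr G' (lam (FObj G y)) \<cdot>\<^bsub>C'\<^esub> \<phi>' x0 f0 (Idt D' f0)"
    using mates y unfolding unit[symmetric] by (simp add: mates_def x0_def e_def)
  also have "\<dots> = FArr G' (FArr V e) \<cdot>\<^bsub>C'\<^esub> \<phi>' x0 (FObj V (FObj F (FObj G y))) (lam (FObj G y))"
    using post[OF x0 l, of "Idt D' f0"] category_id[OF D' f0] category_id_right[OF D' l]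
    by (simp add: f0_def)
  also have "\<dots> = \<phi>' x0 (FObj V y) m"
    using post[OF x0 Ve, of "lam (FObj G y)"] l by (simp add: f0_def m_def)
  finally have "rho y \<cdot>\<^bsub>C'\<^esub> FArr U k = \<phi>' x0 (FObj V y) m \<cdot>\<^bsub>C'\<^esub> FArr U k" by simp
  also have "\<dots> = \<phi>' (FObj U x) (FObj V y) (m \<cdot>\<^bsub>D'\<^esub> FArr F' (FArr U k))"
    using nat'[OF Uk, of m] m by (simp add: f0_def)
  also have "m \<cdot>\<^bsub>D'\<^esub> FArr F' (FArr U k) = FArr V e \<cdot>\<^bsub>D'\<^esub> (FArr V (FArr F k) \<cdot>\<^bsub>D'\<^esub> lam x)"
    using nat_trans_square[OF lam k] category_assoc[OF D' F'[OF Uk] _ Ve] l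
    by (simp add: m_def comp_funct_def f0_def)
  also have "\<dots> = FArr V h \<cdot>\<^bsub>D'\<^esub> lam x"
    using category_assoc[OF D' lam_hom[OF x] VFk Ve] functor_comp[OF V F(2)[OF k] e] eFk by simp
  finally show ?thesis by (simp add: k_def)
qed

context parameterized_adjunction
begin

lemma fix_fst_transposes:
  assumes p: "p \<in> Obj P"
  shows "transposes X Y (fix_fst P T p) (fix_fst P H p) (tr p)"
  unfolding transposes_def
  using T_Obj[OF p] H_Obj[OF p] T_hom[OF category_id[OF P p]] tr_bij[OF p] tr_precomp[OF _ p]
  by (simp add: fix_fst_def)

lemma fix_fst_H_functor:
  assumes p: "p \<in> Obj P"
  shows "is_functor Y X (fix_fst P H p)"
proof -
  note i = category_id[OF P p]
  show ?thesis
    unfolding is_functor_def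
    using H_Obj[OF p] H_hom[OF i] H_id[OF p] H_comp[OF i i] category_id_left[OF P i]
    by (simp add: fix_fst_def Arr_hom) (metis Arr_hom)
qed

end


section \<open>The Leibniz construction on one side\<close>

text \<open>The adjunction \<open>i \<otimes> - \<stileturn> hom(i, -)\<close> between arrow categories for a fixed arrow \<open>i\<close> of the parameter
  category.  The injections \<open>\<kappa>\<^sub>1\<close>, \<open>\<kappa>\<^sub>2\<close> may be those of any pushout of the span, not just of the chosen
  one: when the two variables are exchanged the legs of the span change places, and the chosen pushout of
  the reversed span is in general a different one.\<close>

locale leibniz_adjunction = parameterized_adjunction P X Y T H tr
  for P :: "('p, 'pa) cat" and X :: "('x, 'xa) cat" and Y :: "('y, 'ya) cat"
    and T :: "('p \<times> 'x, 'pa \<times> 'xa, 'y, 'ya) funct"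
    and H :: "('p \<times> 'y, 'pa \<times> 'ya, 'x, 'xa) funct"
    and tr :: "'p \<Rightarrow> 'x \<Rightarrow> 'y \<Rightarrow> 'ya \<Rightarrow> 'xa" +
  fixes i :: 'pa
    and \<kappa>\<^sub>1 \<kappa>\<^sub>2 :: "'xa \<Rightarrow> 'ya"
    and F :: "('xa, ('xa, 'xa) sq, 'ya, ('ya, 'ya) sq) funct"
    and \<phi> :: "'xa \<Rightarrow> 'ya \<Rightarrow> ('ya, 'ya) sq \<Rightarrow> ('xa, 'xa) sq"
  assumes pullbacks: "has_pullbacks X"
    and i: "i \<in> Arr P"
    and pushout: "j \<in> Arr X \<Longrightarrow>
      is_pullback (op_cat Y) (FArr T (Idt P (Dom P i), j)) (FArr T (i, Idt X (Dom X j))) (\<kappa>\<^sub>1 j) (\<kappa>\<^sub>2 j)"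
    and F_hom: "j \<in> Arr X \<Longrightarrow>
      FObj F j \<in> hom Y (Cod Y (\<kappa>\<^sub>1 j)) (FObj T (Cod P i, Cod X j))"
    and F_\<kappa>\<^sub>1: "j \<in> Arr X \<Longrightarrow> FObj F j \<cdot>\<^bsub>Y\<^esub> \<kappa>\<^sub>1 j = FArr T (i, Idt X (Cod X j))"
    and F_\<kappa>\<^sub>2: "j \<in> Arr X \<Longrightarrow> FObj F j \<cdot>\<^bsub>Y\<^esub> \<kappa>\<^sub>2 j = FArr T (Idt P (Cod P i), j)"
    and F_sq: "(j, (c, d), j') \<in> hom (arrow_cat X) j j' \<Longrightarrow>
      \<exists>m\<in>hom Y (Cod Y (\<kappa>\<^sub>1 j)) (Cod Y (\<kappa>\<^sub>1 j')).
        FArr F (j, (c, d), j') = (FObj F j, (m, FArr T (Idt P (Cod P i), d)), FObj F j') \<and>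
        m \<cdot>\<^bsub>Y\<^esub> \<kappa>\<^sub>1 j = \<kappa>\<^sub>1 j' \<cdot>\<^bsub>Y\<^esub> FArr T (Idt P (Dom P i), d) \<and>
        m \<cdot>\<^bsub>Y\<^esub> \<kappa>\<^sub>2 j = \<kappa>\<^sub>2 j' \<cdot>\<^bsub>Y\<^esub> FArr T (Idt P (Cod P i), c)"
    and \<phi>: "\<phi> j f (g, (p, q), g') =
      (j, (tr (Cod P i) (Dom X j) (Dom Y f) (p \<cdot>\<^bsub>Y\<^esub> \<kappa>\<^sub>2 j),
           pb_pair X (cospan_fst Y H i f) (cospan_snd P H i f)
             (tr (Cod P i) (Cod X j) (Cod Y f) q)
             (tr (Dom P i) (Cod X j) (Dom Y f) (p \<cdot>\<^bsub>Y\<^esub> \<kappa>\<^sub>1 j))),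
       leibniz_hom_obj P Y X H i f)"
begin

abbreviation A where "A \<equiv> Dom P i"
abbreviation B where "B \<equiv> Cod P i"

lemma i_hom: "i \<in> hom P A B"
  and A_Obj: "A \<in> Obj P" and B_Obj: "B \<in> Obj P"
  using Arr_hom[OF i] category_hom_Obj[OF P Arr_hom[OF i]] by auto

lemma id_A: "Idt P A \<in> hom P A A" and id_B: "Idt P B \<in> hom P B B"
  using category_id[OF P] A_Obj B_Obj by auto

abbreviation "\<pi>\<^sub>1 f \<equiv> fst (leibniz_projs P Y X H i f)"
abbreviation "\<pi>\<^sub>2 f \<equiv> snd (leibniz_projs P Y X H i f)"
abbreviation "G\<^sub>o f \<equiv> leibniz_hom_obj P Y X H i f"

context
  fixes f x y
  assumes f: "f \<in> hom Y x y"
begin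

lemma xy_Obj: "x \<in> Obj Y" "y \<in> Obj Y"
  using category_hom_Obj[OF Y f] .

lemma cospan:
  "FArr H (i, Idt Y y) \<in> hom X (FObj H (B, y)) (FObj H (A, y))"
  "FArr H (Idt P A, f) \<in> hom X (FObj H (A, x)) (FObj H (A, y))"
  "cospan_fst Y H i f = FArr H (i, Idt Y y)"
  "cospan_snd P H i f = FArr H (Idt P A, f)"
  using H_hom[OF i_hom category_id[OF Y xy_Obj(2)]] H_hom[OF id_A f] homD[OF f]
  by (simp_all add: cospan_fst_def cospan_snd_def)

lemma projs_pullback:
  "is_pullback X (FArr H (i, Idt Y y)) (FArr H (Idt P A, f)) (\<pi>\<^sub>1 f) (\<pi>\<^sub>2 f)"
  using pullback_of_is_pullback[OF pullbacks, of "FArr H (i, Idt Y y)" "FArr H (Idt P A, f)"]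
    homD[OF cospan(1)] homD[OF cospan(2)] by (simp add: leibniz_projs_def cospan)

lemma projs_hom:
  "\<pi>\<^sub>1 f \<in> hom X (Dom X (\<pi>\<^sub>1 f)) (FObj H (B, y))"
  "\<pi>\<^sub>2 f \<in> hom X (Dom X (\<pi>\<^sub>1 f)) (FObj H (A, x))"
  using is_pullbackD[OF projs_pullback] homD[OF cospan(1)] homD[OF cospan(2)] by simp_all

lemma pair:
  assumes "u \<in> hom X z (FObj H (B, y))" "v \<in> hom X z (FObj H (A, x))"
    "FArr H (i, Idt Y y) \<cdot>\<^bsub>X\<^esub> u = FArr H (Idt P A, f) \<cdot>\<^bsub>X\<^esub> v"
  shows "pb_pair X (cospan_fst Y H i f) (cospan_snd P H i f) u v \<in> hom X z (Dom X (\<pi>\<^sub>1 f))"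
    and "\<pi>\<^sub>1 f \<cdot>\<^bsub>X\<^esub> pb_pair X (cospan_fst Y H i f) (cospan_snd P H i f) u v = u"
    and "\<pi>\<^sub>2 f \<cdot>\<^bsub>X\<^esub> pb_pair X (cospan_fst Y H i f) (cospan_snd P H i f) u v = v"
  using pb_pair[OF pullbacks, of "FArr H (i, Idt Y y)" "FArr H (Idt P A, f)" u z v] assms
    homD[OF cospan(1)] homD[OF cospan(2)] by (simp_all add: leibniz_projs_def cospan)

lemma G_hom: "G\<^sub>o f \<in> hom X (FObj H (B, x)) (Dom X (\<pi>\<^sub>1 f))"
  and \<pi>\<^sub>1_G: "\<pi>\<^sub>1 f \<cdot>\<^bsub>X\<^esub> G\<^sub>o f = FArr H (Idt P B, f)"
  and \<pi>\<^sub>2_G: "\<pi>\<^sub>2 f \<cdot>\<^bsub>X\<^esub> G\<^sub>o f = FArr H (i, Idt Y x)"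
proof -
  note ix = category_id[OF Y xy_Obj(1)] and iy = category_id[OF Y xy_Obj(2)]
  have "FArr H (i, Idt Y y) \<cdot>\<^bsub>X\<^esub> FArr H (Idt P B, f) = FArr H (Idt P A, f) \<cdot>\<^bsub>X\<^esub> FArr H (i, Idt Y x)"
    using H_comp[OF i_hom id_B f iy] H_comp[OF id_A i_hom ix f]
      category_id_left[OF P i_hom] category_id_right[OF P i_hom]
      category_id_left[OF Y f] category_id_right[OF Y f] by simp
  from pair[OF H_hom[OF id_B f] H_hom[OF i_hom ix] this]
  show "G\<^sub>o f \<in> hom X (FObj H (B, x)) (Dom X (\<pi>\<^sub>1 f))"
    and "\<pi>\<^sub>1 f \<cdot>\<^bsub>X\<^esub> G\<^sub>o f = FArr H (Idt P B, f)"
    and "\<pi>\<^sub>2 f \<cdot>\<^bsub>X\<^esub> G\<^sub>o f = FArr H (i, Idt Y x)"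
    by (simp_all add: leibniz_hom_obj_def homD[OF f])
qed

end

context
  fixes j J L
  assumes j: "j \<in> hom X J L"
begin

lemma JL_Obj: "J \<in> Obj X" "L \<in> Obj X"
  using category_hom_Obj[OF X j] .

lemma id_J: "Idt X J \<in> hom X J J" and id_L: "Idt X L \<in> hom X L L"
  using category_id[OF X] JL_Obj by auto

lemma F_hom': "FObj F j \<in> hom Y (Cod Y (\<kappa>\<^sub>1 j)) (FObj T (B, L))"
  and F_\<kappa>\<^sub>1': "FObj F j \<cdot>\<^bsub>Y\<^esub> \<kappa>\<^sub>1 j = FArr T (i, Idt X L)"
  and F_\<kappa>\<^sub>2': "FObj F j \<cdot>\<^bsub>Y\<^esub> \<kappa>\<^sub>2 j = FArr T (Idt P B, j)"
  using F_hom[of j] F_\<kappa>\<^sub>1[of j] F_\<kappa>\<^sub>2[of j] homD[OF j] by simp_all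

lemma injs_pushout:
  "is_pullback (op_cat Y) (FArr T (Idt P A, j)) (FArr T (i, Idt X J)) (\<kappa>\<^sub>1 j) (\<kappa>\<^sub>2 j)"
  using pushout[of j] homD[OF j] by simp

lemma injs_hom:
  "\<kappa>\<^sub>1 j \<in> hom Y (FObj T (A, L)) (Cod Y (\<kappa>\<^sub>1 j))"
  "\<kappa>\<^sub>2 j \<in> hom Y (FObj T (B, J)) (Cod Y (\<kappa>\<^sub>1 j))"
  and injs_comm: "\<kappa>\<^sub>1 j \<cdot>\<^bsub>Y\<^esub> FArr T (Idt P A, j) = \<kappa>\<^sub>2 j \<cdot>\<^bsub>Y\<^esub> FArr T (i, Idt X J)"
  using is_pullbackD[OF injs_pushout] homD(3)[OF T_hom[OF id_A j]] homD(3)[OF T_hom[OF i_hom id_J]]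
  by simp_all

lemma copair:
  assumes "p\<^sub>1 \<in> hom Y (FObj T (A, L)) z" "p\<^sub>2 \<in> hom Y (FObj T (B, J)) z"
    "p\<^sub>1 \<cdot>\<^bsub>Y\<^esub> FArr T (Idt P A, j) = p\<^sub>2 \<cdot>\<^bsub>Y\<^esub> FArr T (i, Idt X J)"
  obtains p where "p \<in> hom Y (Cod Y (\<kappa>\<^sub>1 j)) z" "p \<cdot>\<^bsub>Y\<^esub> \<kappa>\<^sub>1 j = p\<^sub>1" "p \<cdot>\<^bsub>Y\<^esub> \<kappa>\<^sub>2 j = p\<^sub>2"
  using is_pullback_pair[OF injs_pushout, of p\<^sub>1 z p\<^sub>2] assms
    homD(3)[OF T_hom[OF id_A j]] homD(3)[OF T_hom[OF i_hom id_J]] by auto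

lemma copair_eqI:
  assumes "p \<in> hom Y (Cod Y (\<kappa>\<^sub>1 j)) z" "p' \<in> hom Y (Cod Y (\<kappa>\<^sub>1 j)) z"
    "p \<cdot>\<^bsub>Y\<^esub> \<kappa>\<^sub>1 j = p' \<cdot>\<^bsub>Y\<^esub> \<kappa>\<^sub>1 j" "p \<cdot>\<^bsub>Y\<^esub> \<kappa>\<^sub>2 j = p' \<cdot>\<^bsub>Y\<^esub> \<kappa>\<^sub>2 j"
  shows "p = p'"
proof -
  have "is_pullback (op_cat Y) (FArr T (Idt P A, j)) (FArr T (i, Idt X J)) (\<kappa>\<^sub>1 j) (\<kappa>\<^sub>2 j)"
    by (rule injs_pushout)
  moreover have "category (op_cat Y)"
    using Y by (auto simp: category_def)
  ultimately show ?thesis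
    using is_pullback_eqI[of "op_cat Y"] assms by simp
qed

text \<open>A square from \<open>i \<otimes> j\<close> involves three equations: the cocone condition on the pushout and one equation for
  each injection.  A square into \<open>hom(i, f)\<close> involves three as well: the cone condition on the pullback and
  one equation for each projection.  This lemma and the next match the former with the latter; the
  cocone condition becomes the equation for the projection to \<open>H(A, z)\<close>.\<close>

lemma compatible_iff_transpose:
  assumes p\<^sub>1: "p\<^sub>1 \<in> hom Y (FObj T (A, L)) z" and p\<^sub>2: "p\<^sub>2 \<in> hom Y (FObj T (B, J)) z"
  shows "p\<^sub>1 \<cdot>\<^bsub>Y\<^esub> FArr T (Idt P A, j) = p\<^sub>2 \<cdot>\<^bsub>Y\<^esub> FArr T (i, Idt X J) \<longleftrightarrow>
    tr A L z p\<^sub>1 \<cdot>\<^bsub>X\<^esub> j = FArr H (i, Idt Y z) \<cdot>\<^bsub>X\<^esub> tr B J z p\<^sub>2"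
proof -
  have z: "z \<in> Obj Y" by (rule category_hom_Obj(2)[OF Y p\<^sub>1])
  have "p\<^sub>1 \<cdot>\<^bsub>Y\<^esub> FArr T (Idt P A, j) = p\<^sub>2 \<cdot>\<^bsub>Y\<^esub> FArr T (i, Idt X J) \<longleftrightarrow>
      tr A J z (p\<^sub>1 \<cdot>\<^bsub>Y\<^esub> FArr T (Idt P A, j)) = tr A J z (p\<^sub>2 \<cdot>\<^bsub>Y\<^esub> FArr T (i, Idt X J))"
    by (rule tr_eq_iff[OF A_Obj JL_Obj(1) z category_comp[OF Y T_hom[OF id_A j] p\<^sub>1]
          category_comp[OF Y T_hom[OF i_hom id_J] p\<^sub>2], symmetric])
  then show ?thesis
    by (simp add: tr_precomp[OF j A_Obj p\<^sub>1] tr_precomp_param[OF i_hom JL_Obj(1) p\<^sub>2])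
qed

context
  fixes f x y
  assumes f: "f \<in> hom Y x y"
begin

text \<open>An equation between arrows out of the pushout splits into one equation for each injection, and each
  of the two is transposed separately: the first becomes the cone condition, the second the equation
  for the projection to \<open>H(B, y)\<close>.\<close>

lemma square_iff_transpose:
  assumes p: "p \<in> hom Y (Cod Y (\<kappa>\<^sub>1 j)) x" and q: "q \<in> hom Y (FObj T (B, L)) y"
  shows "f \<cdot>\<^bsub>Y\<^esub> p = q \<cdot>\<^bsub>Y\<^esub> FObj F j \<longleftrightarrow>
    FArr H (i, Idt Y y) \<cdot>\<^bsub>X\<^esub> tr B L y q = FArr H (Idt P A, f) \<cdot>\<^bsub>X\<^esub> tr A L x (p \<cdot>\<^bsub>Y\<^esub> \<kappa>\<^sub>1 j) \<and>
    FArr H (Idt P B, f) \<cdot>\<^bsub>X\<^esub> tr B J x (p \<cdot>\<^bsub>Y\<^esub> \<kappa>\<^sub>2 j) = tr B L y q \<cdot>\<^bsub>X\<^esub> j"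
proof -
  note xy = xy_Obj[OF f]
  have p1: "p \<cdot>\<^bsub>Y\<^esub> \<kappa>\<^sub>1 j \<in> hom Y (FObj T (A, L)) x" and p2: "p \<cdot>\<^bsub>Y\<^esub> \<kappa>\<^sub>2 j \<in> hom Y (FObj T (B, J)) x"
    using category_comp[OF Y _ p] injs_hom by auto
  have "f \<cdot>\<^bsub>Y\<^esub> p = q \<cdot>\<^bsub>Y\<^esub> FObj F j \<longleftrightarrow>
      (f \<cdot>\<^bsub>Y\<^esub> p) \<cdot>\<^bsub>Y\<^esub> \<kappa>\<^sub>1 j = (q \<cdot>\<^bsub>Y\<^esub> FObj F j) \<cdot>\<^bsub>Y\<^esub> \<kappa>\<^sub>1 j \<and>
      (f \<cdot>\<^bsub>Y\<^esub> p) \<cdot>\<^bsub>Y\<^esub> \<kappa>\<^sub>2 j = (q \<cdot>\<^bsub>Y\<^esub> FObj F j) \<cdot>\<^bsub>Y\<^esub> \<kappa>\<^sub>2 j"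
    using copair_eqI[OF category_comp[OF Y p f] category_comp[OF Y F_hom' q]] by auto
  also have "\<dots> \<longleftrightarrow> f \<cdot>\<^bsub>Y\<^esub> (p \<cdot>\<^bsub>Y\<^esub> \<kappa>\<^sub>1 j) = q \<cdot>\<^bsub>Y\<^esub> FArr T (i, Idt X L) \<and>
      f \<cdot>\<^bsub>Y\<^esub> (p \<cdot>\<^bsub>Y\<^esub> \<kappa>\<^sub>2 j) = q \<cdot>\<^bsub>Y\<^esub> FArr T (Idt P B, j)"
    using category_assoc[OF Y _ p f] category_assoc[OF Y _ F_hom' q] injs_hom F_\<kappa>\<^sub>1' F_\<kappa>\<^sub>2' by metis
  also have "f \<cdot>\<^bsub>Y\<^esub> (p \<cdot>\<^bsub>Y\<^esub> \<kappa>\<^sub>1 j) = q \<cdot>\<^bsub>Y\<^esub> FArr T (i, Idt X L) \<longleftrightarrow>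
      tr A L y (q \<cdot>\<^bsub>Y\<^esub> FArr T (i, Idt X L)) = tr A L y (f \<cdot>\<^bsub>Y\<^esub> (p \<cdot>\<^bsub>Y\<^esub> \<kappa>\<^sub>1 j))"
    by (subst tr_eq_iff[OF A_Obj JL_Obj(2) xy(2) category_comp[OF Y T_hom[OF i_hom id_L] q]
          category_comp[OF Y p1 f]]) (rule eq_commute)
  also have "f \<cdot>\<^bsub>Y\<^esub> (p \<cdot>\<^bsub>Y\<^esub> \<kappa>\<^sub>2 j) = q \<cdot>\<^bsub>Y\<^esub> FArr T (Idt P B, j) \<longleftrightarrow>
      tr B J y (f \<cdot>\<^bsub>Y\<^esub> (p \<cdot>\<^bsub>Y\<^esub> \<kappa>\<^sub>2 j)) = tr B J y (q \<cdot>\<^bsub>Y\<^esub> FArr T (Idt P B, j))"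
    by (rule tr_eq_iff[OF B_Obj JL_Obj(1) xy(2) category_comp[OF Y p2 f]
          category_comp[OF Y T_hom[OF id_B j] q], symmetric])
  finally show ?thesis
    by (simp add: tr_precomp[OF j B_Obj q] tr_precomp_param[OF i_hom JL_Obj(2) q]
        tr_postcomp[OF f A_Obj JL_Obj(2) p1] tr_postcomp[OF f B_Obj JL_Obj(1) p2])
qed

lemma hom_F_iff:
  "(g, (p, q), g') \<in> hom (arrow_cat Y) (FObj F j) f \<longleftrightarrow> g = FObj F j \<and> g' = f \<and>
     p \<in> hom Y (Cod Y (\<kappa>\<^sub>1 j)) x \<and> q \<in> hom Y (FObj T (B, L)) y \<and> f \<cdot>\<^bsub>Y\<^esub> p = q \<cdot>\<^bsub>Y\<^esub> FObj F j"
  using homD[OF F_hom'] homD[OF f] by (auto simp: hom_arrow_cat_iff)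

lemma hom_G_iff:
  "(g, (u, w), g') \<in> hom (arrow_cat X) j (G\<^sub>o f) \<longleftrightarrow> g = j \<and> g' = G\<^sub>o f \<and>
     u \<in> hom X J (FObj H (B, x)) \<and> w \<in> hom X L (Dom X (\<pi>\<^sub>1 f)) \<and>
     FArr H (Idt P B, f) \<cdot>\<^bsub>X\<^esub> u = (\<pi>\<^sub>1 f \<cdot>\<^bsub>X\<^esub> w) \<cdot>\<^bsub>X\<^esub> j \<and>
     FArr H (i, Idt Y x) \<cdot>\<^bsub>X\<^esub> u = (\<pi>\<^sub>2 f \<cdot>\<^bsub>X\<^esub> w) \<cdot>\<^bsub>X\<^esub> j"
proof -
  note \<pi> = projs_hom[OF f]
  have "G\<^sub>o f \<cdot>\<^bsub>X\<^esub> u = w \<cdot>\<^bsub>X\<^esub> j \<longleftrightarrow>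
     FArr H (Idt P B, f) \<cdot>\<^bsub>X\<^esub> u = (\<pi>\<^sub>1 f \<cdot>\<^bsub>X\<^esub> w) \<cdot>\<^bsub>X\<^esub> j \<and>
     FArr H (i, Idt Y x) \<cdot>\<^bsub>X\<^esub> u = (\<pi>\<^sub>2 f \<cdot>\<^bsub>X\<^esub> w) \<cdot>\<^bsub>X\<^esub> j"
    if u: "u \<in> hom X J (FObj H (B, x))" and w: "w \<in> hom X L (Dom X (\<pi>\<^sub>1 f))"
  proof -
    have "FArr H (Idt P B, f) \<cdot>\<^bsub>X\<^esub> u = \<pi>\<^sub>1 f \<cdot>\<^bsub>X\<^esub> (G\<^sub>o f \<cdot>\<^bsub>X\<^esub> u)"
      "FArr H (i, Idt Y x) \<cdot>\<^bsub>X\<^esub> u = \<pi>\<^sub>2 f \<cdot>\<^bsub>X\<^esub> (G\<^sub>o f \<cdot>\<^bsub>X\<^esub> u)"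
      using category_assoc[OF X u G_hom[OF f]] \<pi> by (simp_all flip: \<pi>\<^sub>1_G[OF f] \<pi>\<^sub>2_G[OF f])
    moreover have "(\<pi>\<^sub>1 f \<cdot>\<^bsub>X\<^esub> w) \<cdot>\<^bsub>X\<^esub> j = \<pi>\<^sub>1 f \<cdot>\<^bsub>X\<^esub> (w \<cdot>\<^bsub>X\<^esub> j)"
      "(\<pi>\<^sub>2 f \<cdot>\<^bsub>X\<^esub> w) \<cdot>\<^bsub>X\<^esub> j = \<pi>\<^sub>2 f \<cdot>\<^bsub>X\<^esub> (w \<cdot>\<^bsub>X\<^esub> j)"
      using category_assoc[OF X j w] \<pi> by auto
    ultimately show ?thesis
      using is_pullback_eqI[OF X projs_pullback[OF f] category_comp[OF X u G_hom[OF f]]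
          category_comp[OF X j w]] by auto
  qed
  then show ?thesis
    using homD[OF G_hom[OF f]] homD[OF j] by (auto simp: hom_arrow_cat_iff)
qed

lemma \<phi>_components:
  assumes h: "(FObj F j, (p, q), f) \<in> hom (arrow_cat Y) (FObj F j) f"
  obtains w where "\<phi> j f (FObj F j, (p, q), f) = (j, (tr B J x (p \<cdot>\<^bsub>Y\<^esub> \<kappa>\<^sub>2 j), w), G\<^sub>o f)"
    "w \<in> hom X L (Dom X (\<pi>\<^sub>1 f))"
    "\<pi>\<^sub>1 f \<cdot>\<^bsub>X\<^esub> w = tr B L y q" "\<pi>\<^sub>2 f \<cdot>\<^bsub>X\<^esub> w = tr A L x (p \<cdot>\<^bsub>Y\<^esub> \<kappa>\<^sub>1 j)"
proof -
  have p: "p \<in> hom Y (Cod Y (\<kappa>\<^sub>1 j)) x" and q: "q \<in> hom Y (FObj T (B, L)) y"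
    and sq: "f \<cdot>\<^bsub>Y\<^esub> p = q \<cdot>\<^bsub>Y\<^esub> FObj F j"
    using h by (simp_all add: hom_F_iff)
  note w = pair[OF f tr_hom[OF B_Obj JL_Obj(2) xy_Obj(2)[OF f] q]
      tr_hom[OF A_Obj JL_Obj(2) xy_Obj(1)[OF f] category_comp[OF Y injs_hom(1) p]]]
  show ?thesis
    using that[OF _ w] square_iff_transpose[OF p q] sq homD[OF j] homD[OF f] by (simp add: \<phi>)
qed

lemma \<phi>_hom:
  assumes h: "h \<in> hom (arrow_cat Y) (FObj F j) f"
  shows "\<phi> j f h \<in> hom (arrow_cat X) j (G\<^sub>o f)"
proof -
  obtain p q where h_eq: "h = (FObj F j, (p, q), f)" using h by (rule hom_arrow_catE)
  note h' = h[unfolded h_eq]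
  obtain w where w: "\<phi> j f (FObj F j, (p, q), f) = (j, (tr B J x (p \<cdot>\<^bsub>Y\<^esub> \<kappa>\<^sub>2 j), w), G\<^sub>o f)"
    "w \<in> hom X L (Dom X (\<pi>\<^sub>1 f))"
    "\<pi>\<^sub>1 f \<cdot>\<^bsub>X\<^esub> w = tr B L y q" "\<pi>\<^sub>2 f \<cdot>\<^bsub>X\<^esub> w = tr A L x (p \<cdot>\<^bsub>Y\<^esub> \<kappa>\<^sub>1 j)"
    using h' by (rule \<phi>_components)
  have p: "p \<in> hom Y (Cod Y (\<kappa>\<^sub>1 j)) x" and q: "q \<in> hom Y (FObj T (B, L)) y"
    and sq: "f \<cdot>\<^bsub>Y\<^esub> p = q \<cdot>\<^bsub>Y\<^esub> FObj F j"
    using h' by (simp_all add: hom_F_iff)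
  have p1: "p \<cdot>\<^bsub>Y\<^esub> \<kappa>\<^sub>1 j \<in> hom Y (FObj T (A, L)) x" and p2: "p \<cdot>\<^bsub>Y\<^esub> \<kappa>\<^sub>2 j \<in> hom Y (FObj T (B, J)) x"
    using category_comp[OF Y _ p] injs_hom by auto
  have "(p \<cdot>\<^bsub>Y\<^esub> \<kappa>\<^sub>1 j) \<cdot>\<^bsub>Y\<^esub> FArr T (Idt P A, j) = (p \<cdot>\<^bsub>Y\<^esub> \<kappa>\<^sub>2 j) \<cdot>\<^bsub>Y\<^esub> FArr T (i, Idt X J)"
    using category_assoc[OF Y T_hom[OF id_A j] injs_hom(1) p]
      category_assoc[OF Y T_hom[OF i_hom id_J] injs_hom(2) p] injs_comm by simp
  then show ?thesis
    using square_iff_transpose[OF p q] sq compatible_iff_transpose[OF p1 p2] w(2-4)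
      tr_hom[OF B_Obj JL_Obj(1) xy_Obj(1)[OF f] p2]
    by (simp add: h_eq w(1) hom_G_iff)
qed

lemma \<phi>_inj:
  assumes h: "h \<in> hom (arrow_cat Y) (FObj F j) f" and h': "h' \<in> hom (arrow_cat Y) (FObj F j) f"
    and eq: "\<phi> j f h = \<phi> j f h'"
  shows "h = h'"
proof -
  obtain p q where h_eq: "h = (FObj F j, (p, q), f)" using h by (rule hom_arrow_catE)
  obtain p' q' where h'_eq: "h' = (FObj F j, (p', q'), f)" using h' by (rule hom_arrow_catE)
  obtain w where w: "\<phi> j f (FObj F j, (p, q), f) = (j, (tr B J x (p \<cdot>\<^bsub>Y\<^esub> \<kappa>\<^sub>2 j), w), G\<^sub>o f)"
    "\<pi>\<^sub>1 f \<cdot>\<^bsub>X\<^esub> w = tr B L y q" "\<pi>\<^sub>2 f \<cdot>\<^bsub>X\<^esub> w = tr A L x (p \<cdot>\<^bsub>Y\<^esub> \<kappa>\<^sub>1 j)"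
    using h[unfolded h_eq] by (rule \<phi>_components)
  obtain w' where w': "\<phi> j f (FObj F j, (p', q'), f) = (j, (tr B J x (p' \<cdot>\<^bsub>Y\<^esub> \<kappa>\<^sub>2 j), w'), G\<^sub>o f)"
    "\<pi>\<^sub>1 f \<cdot>\<^bsub>X\<^esub> w' = tr B L y q'" "\<pi>\<^sub>2 f \<cdot>\<^bsub>X\<^esub> w' = tr A L x (p' \<cdot>\<^bsub>Y\<^esub> \<kappa>\<^sub>1 j)"
    using h'[unfolded h'_eq] by (rule \<phi>_components)
  have p: "p \<in> hom Y (Cod Y (\<kappa>\<^sub>1 j)) x" "p' \<in> hom Y (Cod Y (\<kappa>\<^sub>1 j)) x"
    and q: "q \<in> hom Y (FObj T (B, L)) y" "q' \<in> hom Y (FObj T (B, L)) y"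
    using h h' by (simp_all add: hom_F_iff h_eq h'_eq)
  note xy = xy_Obj[OF f]
  have tr: "tr B J x (p \<cdot>\<^bsub>Y\<^esub> \<kappa>\<^sub>2 j) = tr B J x (p' \<cdot>\<^bsub>Y\<^esub> \<kappa>\<^sub>2 j)" "w = w'"
    using eq by (simp_all add: h_eq h'_eq w(1) w'(1))
  have "q = q'"
    using w(2) w'(2) tr by (intro tr_inj[OF B_Obj JL_Obj(2) xy(2) _ q]) simp
  moreover have "p \<cdot>\<^bsub>Y\<^esub> \<kappa>\<^sub>1 j = p' \<cdot>\<^bsub>Y\<^esub> \<kappa>\<^sub>1 j"
    using w(3) w'(3) tr category_comp[OF Y injs_hom(1)] p
    by (intro tr_inj[OF A_Obj JL_Obj(2) xy(1)]) simp_all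
  moreover have "p \<cdot>\<^bsub>Y\<^esub> \<kappa>\<^sub>2 j = p' \<cdot>\<^bsub>Y\<^esub> \<kappa>\<^sub>2 j"
    using tr category_comp[OF Y injs_hom(2)] p
    by (intro tr_inj[OF B_Obj JL_Obj(1) xy(1)]) simp_all
  ultimately show ?thesis using copair_eqI[OF p] by (simp add: h_eq h'_eq)
qed

lemma \<phi>_surj:
  assumes g: "g \<in> hom (arrow_cat X) j (G\<^sub>o f)"
  obtains h where "h \<in> hom (arrow_cat Y) (FObj F j) f" "\<phi> j f h = g"
proof -
  obtain u w where g_eq: "g = (j, (u, w), G\<^sub>o f)" using g by (rule hom_arrow_catE)
  have u: "u \<in> hom X J (FObj H (B, x))" and w: "w \<in> hom X L (Dom X (\<pi>\<^sub>1 f))"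
    and sq: "FArr H (Idt P B, f) \<cdot>\<^bsub>X\<^esub> u = (\<pi>\<^sub>1 f \<cdot>\<^bsub>X\<^esub> w) \<cdot>\<^bsub>X\<^esub> j"
      "FArr H (i, Idt Y x) \<cdot>\<^bsub>X\<^esub> u = (\<pi>\<^sub>2 f \<cdot>\<^bsub>X\<^esub> w) \<cdot>\<^bsub>X\<^esub> j"
    using g by (simp_all add: g_eq hom_G_iff)
  note xy = xy_Obj[OF f] and \<pi> = projs_hom[OF f]
  obtain q where q: "q \<in> hom Y (FObj T (B, L)) y" "tr B L y q = \<pi>\<^sub>1 f \<cdot>\<^bsub>X\<^esub> w"
    using tr_surj[OF B_Obj JL_Obj(2) xy(2) category_comp[OF X w \<pi>(1)]] .
  obtain p\<^sub>1 where p\<^sub>1: "p\<^sub>1 \<in> hom Y (FObj T (A, L)) x" "tr A L x p\<^sub>1 = \<pi>\<^sub>2 f \<cdot>\<^bsub>X\<^esub> w"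
    using tr_surj[OF A_Obj JL_Obj(2) xy(1) category_comp[OF X w \<pi>(2)]] .
  obtain p\<^sub>2 where p\<^sub>2: "p\<^sub>2 \<in> hom Y (FObj T (B, J)) x" "tr B J x p\<^sub>2 = u"
    using tr_surj[OF B_Obj JL_Obj(1) xy(1) u] .
  have "p\<^sub>1 \<cdot>\<^bsub>Y\<^esub> FArr T (Idt P A, j) = p\<^sub>2 \<cdot>\<^bsub>Y\<^esub> FArr T (i, Idt X J)"
    using compatible_iff_transpose[OF p\<^sub>1(1) p\<^sub>2(1)] p\<^sub>1(2) p\<^sub>2(2) sq(2) by simp
  then obtain p where p: "p \<in> hom Y (Cod Y (\<kappa>\<^sub>1 j)) x" "p \<cdot>\<^bsub>Y\<^esub> \<kappa>\<^sub>1 j = p\<^sub>1" "p \<cdot>\<^bsub>Y\<^esub> \<kappa>\<^sub>2 j = p\<^sub>2"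
    using copair[OF p\<^sub>1(1) p\<^sub>2(1)] by blast
  have "FArr H (i, Idt Y y) \<cdot>\<^bsub>X\<^esub> (\<pi>\<^sub>1 f \<cdot>\<^bsub>X\<^esub> w) = FArr H (Idt P A, f) \<cdot>\<^bsub>X\<^esub> (\<pi>\<^sub>2 f \<cdot>\<^bsub>X\<^esub> w)"
    using is_pullbackD(3)[OF projs_pullback[OF f]] category_assoc[OF X w \<pi>(1) cospan(1)[OF f]]
      category_assoc[OF X w \<pi>(2) cospan(2)[OF f]] by simp
  then have "f \<cdot>\<^bsub>Y\<^esub> p = q \<cdot>\<^bsub>Y\<^esub> FObj F j"
    using square_iff_transpose[OF p(1) q(1)] q(2) p(2,3) p\<^sub>1(2) p\<^sub>2(2) sq(1) by simp
  then have h: "(FObj F j, (p, q), f) \<in> hom (arrow_cat Y) (FObj F j) f"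
    using p(1) q(1) by (simp add: hom_F_iff)
  obtain w' where w': "\<phi> j f (FObj F j, (p, q), f) = (j, (tr B J x (p \<cdot>\<^bsub>Y\<^esub> \<kappa>\<^sub>2 j), w'), G\<^sub>o f)"
    "w' \<in> hom X L (Dom X (\<pi>\<^sub>1 f))"
    "\<pi>\<^sub>1 f \<cdot>\<^bsub>X\<^esub> w' = tr B L y q" "\<pi>\<^sub>2 f \<cdot>\<^bsub>X\<^esub> w' = tr A L x (p \<cdot>\<^bsub>Y\<^esub> \<kappa>\<^sub>1 j)"
    using h by (rule \<phi>_components)
  have "w' = w"
    using w'(3,4) q(2) p(2) p\<^sub>1(2) by (intro is_pullback_eqI[OF X projs_pullback[OF f] w'(2) w]) simp_all
  then have "\<phi> j f (FObj F j, (p, q), f) = g"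
    using w'(1) p(3) p\<^sub>2(2) by (simp add: g_eq)
  with h that show ?thesis by blast
qed

end

end

lemma F_sq_hom:
  assumes k: "k \<in> hom (arrow_cat X) j' j"
  shows "FArr F k \<in> hom (arrow_cat Y) (FObj F j') (FObj F j)"
proof -
  obtain c d where k_eq: "k = (j', (c, d), j)" and Arr: "j' \<in> Arr X" "j \<in> Arr X"
    and c: "c \<in> hom X (Dom X j') (Dom X j)" and d: "d \<in> hom X (Cod X j') (Cod X j)"
    and sq: "j \<cdot>\<^bsub>X\<^esub> c = d \<cdot>\<^bsub>X\<^esub> j'"
    using k by (rule hom_arrow_catE)
  note j' = Arr_hom[OF Arr(1)] and j = Arr_hom[OF Arr(2)]
  obtain m where m: "m \<in> hom Y (Cod Y (\<kappa>\<^sub>1 j')) (Cod Y (\<kappa>\<^sub>1 j))"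
    and Fk: "FArr F k = (FObj F j', (m, FArr T (Idt P B, d)), FObj F j)"
    and m1: "m \<cdot>\<^bsub>Y\<^esub> \<kappa>\<^sub>1 j' = \<kappa>\<^sub>1 j \<cdot>\<^bsub>Y\<^esub> FArr T (Idt P A, d)"
    and m2: "m \<cdot>\<^bsub>Y\<^esub> \<kappa>\<^sub>2 j' = \<kappa>\<^sub>2 j \<cdot>\<^bsub>Y\<^esub> FArr T (Idt P B, c)"
    using F_sq k unfolding k_eq by blast
  note Td = T_hom[OF id_B d]
  have "FObj F j \<cdot>\<^bsub>Y\<^esub> m = FArr T (Idt P B, d) \<cdot>\<^bsub>Y\<^esub> FObj F j'"
  proof (rule copair_eqI[OF j' category_comp[OF Y m F_hom'[OF j]] category_comp[OF Y F_hom'[OF j'] Td]])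
    have "(FObj F j \<cdot>\<^bsub>Y\<^esub> m) \<cdot>\<^bsub>Y\<^esub> \<kappa>\<^sub>1 j' = (FObj F j \<cdot>\<^bsub>Y\<^esub> \<kappa>\<^sub>1 j) \<cdot>\<^bsub>Y\<^esub> FArr T (Idt P A, d)"
      by (simp add: category_assoc[OF Y injs_hom(1)[OF j'] m F_hom'[OF j]] m1
          category_assoc[OF Y T_hom[OF id_A d] injs_hom(1)[OF j] F_hom'[OF j]])
    also have "\<dots> = FArr T (i, d)"
      using T_comp[OF id_A i_hom d id_L[OF j]] category_id_left[OF X d] category_id_right[OF P i_hom]
      by (simp add: F_\<kappa>\<^sub>1'[OF j])
    also have "\<dots> = FArr T (Idt P B, d) \<cdot>\<^bsub>Y\<^esub> (FObj F j' \<cdot>\<^bsub>Y\<^esub> \<kappa>\<^sub>1 j')"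
      using T_comp[OF i_hom id_B id_L[OF j'] d] category_id_right[OF X d] category_id_left[OF P i_hom]
      by (simp add: F_\<kappa>\<^sub>1'[OF j'])
    finally show "(FObj F j \<cdot>\<^bsub>Y\<^esub> m) \<cdot>\<^bsub>Y\<^esub> \<kappa>\<^sub>1 j' = (FArr T (Idt P B, d) \<cdot>\<^bsub>Y\<^esub> FObj F j') \<cdot>\<^bsub>Y\<^esub> \<kappa>\<^sub>1 j'"
      by (simp add: category_assoc[OF Y injs_hom(1)[OF j'] F_hom'[OF j'] Td])
    have "(FObj F j \<cdot>\<^bsub>Y\<^esub> m) \<cdot>\<^bsub>Y\<^esub> \<kappa>\<^sub>2 j' = (FObj F j \<cdot>\<^bsub>Y\<^esub> \<kappa>\<^sub>2 j) \<cdot>\<^bsub>Y\<^esub> FArr T (Idt P B, c)"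
      by (simp add: category_assoc[OF Y injs_hom(2)[OF j'] m F_hom'[OF j]] m2
          category_assoc[OF Y T_hom[OF id_B c] injs_hom(2)[OF j] F_hom'[OF j]])
    also have "\<dots> = FArr T (Idt P B, d) \<cdot>\<^bsub>Y\<^esub> (FObj F j' \<cdot>\<^bsub>Y\<^esub> \<kappa>\<^sub>2 j')"
      using T_comp[OF id_B id_B c j] T_comp[OF id_B id_B j' d]
      by (simp add: F_\<kappa>\<^sub>2'[OF j'] F_\<kappa>\<^sub>2'[OF j] sq)
    finally show "(FObj F j \<cdot>\<^bsub>Y\<^esub> m) \<cdot>\<^bsub>Y\<^esub> \<kappa>\<^sub>2 j' = (FArr T (Idt P B, d) \<cdot>\<^bsub>Y\<^esub> FObj F j') \<cdot>\<^bsub>Y\<^esub> \<kappa>\<^sub>2 j'"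
      by (simp add: category_assoc[OF Y injs_hom(2)[OF j'] F_hom'[OF j'] Td])
  qed
  then show ?thesis
    using m Td homD[OF F_hom'[OF j]] homD[OF F_hom'[OF j']] by (simp add: Fk hom_arrow_cat_iff)
qed

lemma \<phi>_natural:
  assumes f: "f \<in> hom Y x y"
    and h: "h \<in> hom (arrow_cat Y) (FObj F j) f" and k: "k \<in> hom (arrow_cat X) j' j"
  shows "\<phi> j' f (h \<cdot>\<^bsub>arrow_cat Y\<^esub> FArr F k) = \<phi> j f h \<cdot>\<^bsub>arrow_cat X\<^esub> k"
proof -
  obtain c d where k_eq: "k = (j', (c, d), j)" and Arr: "j' \<in> Arr X" "j \<in> Arr X"
    and c: "c \<in> hom X (Dom X j') (Dom X j)" and d: "d \<in> hom X (Cod X j') (Cod X j)"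
    using k by (rule hom_arrow_catE)
  note j' = Arr_hom[OF Arr(1)] and j = Arr_hom[OF Arr(2)]
  let ?J = "Dom X j" and ?J' = "Dom X j'" and ?L = "Cod X j" and ?L' = "Cod X j'"
  obtain m where m: "m \<in> hom Y (Cod Y (\<kappa>\<^sub>1 j')) (Cod Y (\<kappa>\<^sub>1 j))"
    and Fk: "FArr F k = (FObj F j', (m, FArr T (Idt P B, d)), FObj F j)"
    and m1: "m \<cdot>\<^bsub>Y\<^esub> \<kappa>\<^sub>1 j' = \<kappa>\<^sub>1 j \<cdot>\<^bsub>Y\<^esub> FArr T (Idt P A, d)"
    and m2: "m \<cdot>\<^bsub>Y\<^esub> \<kappa>\<^sub>2 j' = \<kappa>\<^sub>2 j \<cdot>\<^bsub>Y\<^esub> FArr T (Idt P B, c)"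
    using F_sq k unfolding k_eq by blast
  obtain p q where h_eq: "h = (FObj F j, (p, q), f)" using h by (rule hom_arrow_catE)
  note h' = h[unfolded h_eq]
  have p: "p \<in> hom Y (Cod Y (\<kappa>\<^sub>1 j)) x" and q: "q \<in> hom Y (FObj T (B, ?L)) y"
    using h' by (simp_all add: hom_F_iff[OF j f])
  have hk_eq: "h \<cdot>\<^bsub>arrow_cat Y\<^esub> FArr F k =
      (FObj F j', (p \<cdot>\<^bsub>Y\<^esub> m, q \<cdot>\<^bsub>Y\<^esub> FArr T (Idt P B, d)), f)"
    by (simp add: h_eq Fk)
  have hk: "(FObj F j', (p \<cdot>\<^bsub>Y\<^esub> m, q \<cdot>\<^bsub>Y\<^esub> FArr T (Idt P B, d)), f) \<in>
      hom (arrow_cat Y) (FObj F j') f"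
    using comp_sq_hom[OF Y F_sq_hom[OF k] h] by (simp add: hk_eq)
  obtain w where w: "\<phi> j f (FObj F j, (p, q), f) = (j, (tr B ?J x (p \<cdot>\<^bsub>Y\<^esub> \<kappa>\<^sub>2 j), w), G\<^sub>o f)"
    "w \<in> hom X ?L (Dom X (\<pi>\<^sub>1 f))"
    "\<pi>\<^sub>1 f \<cdot>\<^bsub>X\<^esub> w = tr B ?L y q" "\<pi>\<^sub>2 f \<cdot>\<^bsub>X\<^esub> w = tr A ?L x (p \<cdot>\<^bsub>Y\<^esub> \<kappa>\<^sub>1 j)"
    using h' by (rule \<phi>_components[OF j f])
  obtain w' where w': "\<phi> j' f (FObj F j', (p \<cdot>\<^bsub>Y\<^esub> m, q \<cdot>\<^bsub>Y\<^esub> FArr T (Idt P B, d)), f) =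
      (j', (tr B ?J' x ((p \<cdot>\<^bsub>Y\<^esub> m) \<cdot>\<^bsub>Y\<^esub> \<kappa>\<^sub>2 j'), w'), G\<^sub>o f)"
    "w' \<in> hom X ?L' (Dom X (\<pi>\<^sub>1 f))"
    "\<pi>\<^sub>1 f \<cdot>\<^bsub>X\<^esub> w' = tr B ?L' y (q \<cdot>\<^bsub>Y\<^esub> FArr T (Idt P B, d))"
    "\<pi>\<^sub>2 f \<cdot>\<^bsub>X\<^esub> w' = tr A ?L' x ((p \<cdot>\<^bsub>Y\<^esub> m) \<cdot>\<^bsub>Y\<^esub> \<kappa>\<^sub>1 j')"
    using hk by (rule \<phi>_components[OF j' f])
  have pm1: "(p \<cdot>\<^bsub>Y\<^esub> m) \<cdot>\<^bsub>Y\<^esub> \<kappa>\<^sub>1 j' = (p \<cdot>\<^bsub>Y\<^esub> \<kappa>\<^sub>1 j) \<cdot>\<^bsub>Y\<^esub> FArr T (Idt P A, d)"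
    by (simp add: category_assoc[OF Y injs_hom(1)[OF j'] m p] m1
        category_assoc[OF Y T_hom[OF id_A d] injs_hom(1)[OF j] p])
  have pm2: "(p \<cdot>\<^bsub>Y\<^esub> m) \<cdot>\<^bsub>Y\<^esub> \<kappa>\<^sub>2 j' = (p \<cdot>\<^bsub>Y\<^esub> \<kappa>\<^sub>2 j) \<cdot>\<^bsub>Y\<^esub> FArr T (Idt P B, c)"
    by (simp add: category_assoc[OF Y injs_hom(2)[OF j'] m p] m2
        category_assoc[OF Y T_hom[OF id_B c] injs_hom(2)[OF j] p])
  have "w' = w \<cdot>\<^bsub>X\<^esub> d"
  proof (rule is_pullback_eqI[OF X projs_pullback[OF f] w'(2) category_comp[OF X d w(2)]])
    show "\<pi>\<^sub>1 f \<cdot>\<^bsub>X\<^esub> w' = \<pi>\<^sub>1 f \<cdot>\<^bsub>X\<^esub> (w \<cdot>\<^bsub>X\<^esub> d)"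
      using category_assoc[OF X d w(2) projs_hom(1)[OF f]] w(3)
      by (simp add: w'(3) tr_precomp[OF d B_Obj q])
    show "\<pi>\<^sub>2 f \<cdot>\<^bsub>X\<^esub> w' = \<pi>\<^sub>2 f \<cdot>\<^bsub>X\<^esub> (w \<cdot>\<^bsub>X\<^esub> d)"
      using category_assoc[OF X d w(2) projs_hom(2)[OF f]] w(4)
      by (simp add: w'(4) pm1 tr_precomp[OF d A_Obj category_comp[OF Y injs_hom(1)[OF j] p]])
  qed
  moreover have "tr B ?J' x ((p \<cdot>\<^bsub>Y\<^esub> m) \<cdot>\<^bsub>Y\<^esub> \<kappa>\<^sub>2 j') = tr B ?J x (p \<cdot>\<^bsub>Y\<^esub> \<kappa>\<^sub>2 j) \<cdot>\<^bsub>X\<^esub> c"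
    by (simp add: pm2 tr_precomp[OF c B_Obj category_comp[OF Y injs_hom(2)[OF j] p]])
  ultimately show ?thesis
    by (simp add: hk_eq w'(1)) (simp add: h_eq w(1) k_eq)
qed

lemma leibniz_transposes:
  assumes G: "\<And>f. FObj G f = G\<^sub>o f"
  shows "transposes (arrow_cat X) (arrow_cat Y) F G \<phi>"
  unfolding transposes_def
proof (intro conjI ballI allI impI)
  fix j assume "j \<in> Obj (arrow_cat X)"
  then have j: "j \<in> hom X (Dom X j) (Cod X j)" by (simp add: Arr_hom)
  show "FObj F j \<in> Obj (arrow_cat Y)" using homD[OF F_hom'[OF j]] by simp
  fix f assume "f \<in> Obj (arrow_cat Y)"
  then have f: "f \<in> hom Y (Dom Y f) (Cod Y f)" by (simp add: Arr_hom)
  show "bij_betw (\<phi> j f) (hom (arrow_cat Y) (FObj F j) f) (hom (arrow_cat X) j (FObj G f))"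
    unfolding bij_betw_def G
  proof
    show "inj_on (\<phi> j f) (hom (arrow_cat Y) (FObj F j) f)"
      by (rule inj_onI) (rule \<phi>_inj[OF j f])
    show "\<phi> j f ` hom (arrow_cat Y) (FObj F j) f = hom (arrow_cat X) j (G\<^sub>o f)"
    proof (intro equalityI subsetI)
      fix g assume "g \<in> hom (arrow_cat X) j (G\<^sub>o f)"
      then obtain h where "h \<in> hom (arrow_cat Y) (FObj F j) f" "\<phi> j f h = g"
        by (rule \<phi>_surj[OF j f])
      then show "g \<in> \<phi> j f ` hom (arrow_cat Y) (FObj F j) f" by (intro image_eqI) simp_all
    qed (auto simp: \<phi>_hom[OF j f])
  qed
next
  fix f assume "f \<in> Obj (arrow_cat Y)"
  then have f: "f \<in> hom Y (Dom Y f) (Cod Y f)" by (simp add: Arr_hom)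
  show "FObj G f \<in> Obj (arrow_cat X)" using homD[OF G_hom[OF f]] by (simp add: G)
next
  fix j j' k assume "k \<in> hom (arrow_cat X) j j'"
  then show "FArr F k \<in> hom (arrow_cat Y) (FObj F j) (FObj F j')" by (rule F_sq_hom)
next
  fix j j' f k h
  assume k: "k \<in> hom (arrow_cat X) j' j" and h: "h \<in> hom (arrow_cat Y) (FObj F j) f"
  from h have "f \<in> Arr Y" by (auto elim: hom_arrow_catE)
  from \<phi>_natural[OF Arr_hom[OF this] h k]
  show "\<phi> j' f (h \<cdot>\<^bsub>arrow_cat Y\<^esub> FArr F k) = \<phi> j f h \<cdot>\<^bsub>arrow_cat X\<^esub> k" .
qed

text \<open>The transpose of the canonical solution of \<open>i \<otimes> j\<close> against \<open>f\<close> is the canonical solution of \<open>j\<close> against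
  \<open>hom(i, f)\<close>: the mate property moves \<open>lam\<close> across the transposition, and naturality in all three
  variables moves the structure maps \<open>s\<close>, \<open>t\<close>, \<open>r\<close> across it.\<close>

lemma transpose_solution:
  assumes G: "\<And>f. FObj G f = G\<^sub>o f"
    and E\<^sub>X: "is_functor (arrow_cat X) X E\<^sub>X" and E\<^sub>Y: "is_functor (arrow_cat Y) Y E\<^sub>Y"
    and lam: "nat_trans (arrow_cat X) Y (fix_fst P T e \<circ>\<^sub>F E\<^sub>X) (E\<^sub>Y \<circ>\<^sub>F F) lam"
    and mates: "mates (arrow_cat X) (arrow_cat Y) F G \<phi>
      X Y (fix_fst P T e) (fix_fst P H e) (tr e) E\<^sub>X E\<^sub>Y lam rho"
    and rho: "rho f \<in> hom X (FObj E\<^sub>X (FObj G f)) (FObj H (e, FObj E\<^sub>Y f))"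
    and s: "s \<in> hom P B e"
    and t: "t \<in> hom X (Cod X j) (FObj E\<^sub>X j)" and j: "j \<in> Arr X"
    and r: "r \<in> hom Y (FObj E\<^sub>Y f) (Dom Y f)"
    and h: "h \<in> hom (arrow_cat Y) (FObj F j) f"
  shows "(FArr H (s, r) \<cdot>\<^bsub>X\<^esub> rho f) \<cdot>\<^bsub>X\<^esub> FArr E\<^sub>X (\<phi> j f h) \<cdot>\<^bsub>X\<^esub> t =
    tr B (Cod X j) (Dom Y f) (r \<cdot>\<^bsub>Y\<^esub> FArr E\<^sub>Y h \<cdot>\<^bsub>Y\<^esub> lam j \<cdot>\<^bsub>Y\<^esub> FArr T (s, t))"
proof -
  have e: "e \<in> Obj P" using category_hom_Obj[OF P s] by simp
  have f: "f \<in> Arr Y" using h by (auto elim: hom_arrow_catE)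
  note tG = leibniz_transposes[OF G]
  have rho_h: "tr e (FObj E\<^sub>X j) (FObj E\<^sub>Y f) (FArr E\<^sub>Y h \<cdot>\<^bsub>Y\<^esub> lam j) = rho f \<cdot>\<^bsub>X\<^esub> FArr E\<^sub>X (\<phi> j f h)"
  proof (rule mate_transpose[OF category_arrow_cat[OF X] category_arrow_cat[OF Y] X Y tG
        fix_fst_transposes[OF e] fix_fst_H_functor[OF e] _ E\<^sub>X E\<^sub>Y lam mates _ h])
    show "j \<in> Obj (arrow_cat X)" using j by simp
    show "tr e x y' (c \<cdot>\<^bsub>Y\<^esub> g) = FArr (fix_fst P H e) c \<cdot>\<^bsub>X\<^esub> tr e x y g"
      if "x \<in> Obj X" "c \<in> hom Y y y'" "g \<in> hom Y (FObj (fix_fst P T e) x) y" for x y y' c g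
      using tr_postcomp[OF that(2) e that(1)] that(3) by (simp add: fix_fst_def)
  qed
  have lam_j: "lam j \<in> hom Y (FObj T (e, FObj E\<^sub>X j)) (FObj E\<^sub>Y (FObj F j))"
    using nat_trans_hom[OF lam] j by (simp add: comp_funct_def fix_fst_def)
  note Eh = functor_hom[OF E\<^sub>Y h]
  have g: "FArr E\<^sub>Y h \<cdot>\<^bsub>Y\<^esub> lam j \<in> hom Y (FObj T (e, FObj E\<^sub>X j)) (FObj E\<^sub>Y f)"
    by (rule category_comp[OF Y lam_j Eh])
  note Tst = T_hom[OF s t]
  have \<phi>h: "\<phi> j f h \<in> hom (arrow_cat X) j (FObj G f)"
    using \<phi>_hom[OF Arr_hom[OF j] Arr_hom[OF f] h] by (simp add: G)
  note E\<phi>h = functor_hom[OF E\<^sub>X \<phi>h]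
  have "(FArr H (s, r) \<cdot>\<^bsub>X\<^esub> rho f) \<cdot>\<^bsub>X\<^esub> FArr E\<^sub>X (\<phi> j f h) \<cdot>\<^bsub>X\<^esub> t =
      FArr H (s, r) \<cdot>\<^bsub>X\<^esub> tr e (FObj E\<^sub>X j) (FObj E\<^sub>Y f) (FArr E\<^sub>Y h \<cdot>\<^bsub>Y\<^esub> lam j) \<cdot>\<^bsub>X\<^esub> t"
    using category_assoc[OF X t E\<phi>h rho] category_assoc[OF X category_comp[OF X t E\<phi>h] rho H_hom[OF s r]]
    by (simp add: rho_h)
  also have "\<dots> = tr B (Cod X j) (Dom Y f) (r \<cdot>\<^bsub>Y\<^esub> (FArr E\<^sub>Y h \<cdot>\<^bsub>Y\<^esub> lam j) \<cdot>\<^bsub>Y\<^esub> FArr T (s, t))"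
    by (rule tr_natural[OF s t r g, symmetric])
  finally show ?thesis using category_assoc[OF Y Tst lam_j Eh] by simp
qed

end


section \<open>Structured arrows and their canonical solutions\<close>

lemma factorization_hom:
  assumes W: "functorial_factorization C W" and f: "f \<in> Arr C"
  shows "lft W f \<in> hom C (Dom C f) (FObj (mid W) f)"
    and "rgt W f \<in> hom C (FObj (mid W) f) (Cod C f)"
  using W f by (auto simp: functorial_factorization_def nat_trans_def dom_funct_def cod_funct_def)

lemma coalg_ObjD:
  assumes W: "functorial_factorization C W" and y: "y \<in> Obj (coalg C W)"
  shows "fst y \<in> Arr C" "snd y \<in> hom C (Cod C (fst y)) (FObj (mid W) (fst y))"
proof -
  obtain j t where y_eq: "y = (j, t)" by (cases y)
  have j: "j \<in> Arr C" and
    sq: "(j, (Idt C (Dom C j), t), lft W j) \<in> hom (arrow_cat C) j (FObj (L_funct W) j)"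
    using y by (auto simp: y_eq coalg_def structured_arrow_cat_def comonad_coalgebra_def coalg_sq_def)
  show "fst y \<in> Arr C" using j by (simp add: y_eq)
  show "snd y \<in> hom C (Cod C (fst y)) (FObj (mid W) (fst y))"
    using sq homD[OF factorization_hom(1)[OF W j]] by (simp add: y_eq hom_arrow_cat_iff)
qed

lemma alg_ObjD:
  assumes W: "functorial_factorization C W" and z: "z \<in> Obj (alg C W)"
  shows "fst z \<in> Arr C" "snd z \<in> hom C (FObj (mid W) (fst z)) (Dom C (fst z))"
proof -
  obtain f r where z_eq: "z = (f, r)" by (cases z)
  have f: "f \<in> Arr C" and
    sq: "(rgt W f, (r, Idt C (Cod C f)), f) \<in> hom (arrow_cat C) (FObj (R_funct W) f) f"
    using z by (auto simp: z_eq alg_def structured_arrow_cat_def monad_algebra_def alg_sq_def)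
  show "fst z \<in> Arr C" using f by (simp add: z_eq)
  show "snd z \<in> hom C (FObj (mid W) (fst z)) (Dom C (fst z))"
    using sq homD[OF factorization_hom(2)[OF W f]] by (simp add: z_eq hom_arrow_cat_iff)
qed

lemma canonical_solution_eq:
  assumes "h \<in> hom (arrow_cat C) (fst y) (fst z)"
  shows "canonical_solution C W y (fst (snd h)) z = snd z \<cdot>\<^bsub>C\<^esub> FArr (mid W) h \<cdot>\<^bsub>C\<^esub> snd y"
  using assms by (auto elim!: hom_arrow_catE simp: canonical_solution_def split_beta)

lemma canonical_solution_hom:
  assumes C: "category C" and W: "functorial_factorization C W"
    and y: "y \<in> Obj (coalg C W)" and z: "z \<in> Obj (alg C W)"
    and h: "h \<in> hom (arrow_cat C) (fst y) (fst z)"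
  shows "canonical_solution C W y (fst (snd h)) z \<in> hom C (Cod C (fst y)) (Dom C (fst z))"
proof -
  have E: "is_functor (arrow_cat C) C (mid W)" using W by (simp add: functorial_factorization_def)
  show ?thesis
    unfolding canonical_solution_eq[OF h]
    by (rule category_comp[OF C category_comp[OF C coalg_ObjD(2)[OF W y] functor_hom[OF E h]]
          alg_ObjD(2)[OF W z]])
qed

lemma free_algebra:
  assumes W: "awfs C W" and f: "f \<in> Arr C"
  shows "(rgt W f, mult W f) \<in> Obj (alg C W)"
proof -
  have ff: "functorial_factorization C W" and
    mon: "monad (arrow_cat C) (R_funct W) (eta_sq C W) (mu_sq C W)"
    using W by (simp_all add: awfs_def)
  note R = homD[OF factorization_hom(2)[OF ff f]]
  have "mu_sq C W f = alg_sq C W (rgt W f, mult W f)"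
    using R by (simp add: mu_sq_def alg_sq_def)
  moreover have "monad_algebra (arrow_cat C) (R_funct W) (eta_sq C W) (mu_sq C W)
      (rgt W f) (mu_sq C W f)"
    using mon f R unfolding monad_def monad_algebra_def
    by (simp add: nat_trans_def comp_funct_def R_funct_def)
  ultimately show ?thesis by (simp add: alg_def structured_arrow_cat_def)
qed

text \<open>By the unit law of the monad, solving the unit square \<open>\<eta> : j \<Rightarrow> Rj\<close> against the free algebra gives back the
  structure map of the coalgebra.\<close>

lemma canonical_solution_free_algebra:
  assumes C: "category C" and W: "awfs C W" and y: "y \<in> Obj (coalg C W)"
  shows "eta_sq C W (fst y) \<in> hom (arrow_cat C) (fst y) (rgt W (fst y))"
    and "canonical_solution C W y (fst (snd (eta_sq C W (fst y)))) (rgt W (fst y), mult W (fst y)) = snd y"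
proof -
  obtain j s where y_eq: "y = (j, s)" by (cases y)
  have ff: "functorial_factorization C W" and
    mon: "monad (arrow_cat C) (R_funct W) (eta_sq C W) (mu_sq C W)"
    using W by (simp_all add: awfs_def)
  have j: "j \<in> Arr C" and s: "s \<in> hom C (Cod C j) (FObj (mid W) j)"
    using coalg_ObjD[OF ff y] by (simp_all add: y_eq)
  have E: "is_functor (arrow_cat C) C (mid W)" using ff by (simp add: functorial_factorization_def)
  have eta: "eta_sq C W j \<in> hom (arrow_cat C) j (rgt W j)"
    using mon j by (auto simp: monad_def nat_trans_def id_funct_def R_funct_def)
  then show eta': "eta_sq C W (fst y) \<in> hom (arrow_cat C) (fst y) (rgt W (fst y))"
    by (simp add: y_eq)
  have "mu_sq C W j \<cdot>\<^bsub>arrow_cat C\<^esub> FArr (R_funct W) (eta_sq C W j) = Idt (arrow_cat C) (FObj (R_funct W) j)"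
    using mon j by (simp add: monad_def)
  then have unit: "mult W j \<cdot>\<^bsub>C\<^esub> FArr (mid W) (eta_sq C W j) = Idt C (FObj (mid W) j)"
    using homD[OF factorization_hom(2)[OF ff j]]
    by (simp add: mu_sq_def eta_sq_def R_funct_def)
  have "mult W j \<in> hom C (FObj (mid W) (rgt W j)) (FObj (mid W) j)"
    using alg_ObjD(2)[OF ff free_algebra[OF W j]] homD[OF factorization_hom(2)[OF ff j]] by simp
  from category_assoc[OF C s functor_hom[OF E eta] this]
  have "mult W j \<cdot>\<^bsub>C\<^esub> (FArr (mid W) (eta_sq C W j) \<cdot>\<^bsub>C\<^esub> s) = s"
    by (simp add: unit category_id_left[OF C s])
  then show "canonical_solution C W y (fst (snd (eta_sq C W (fst y)))) (rgt W (fst y), mult W (fst y)) = snd y"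
    using canonical_solution_eq[of "eta_sq C W j" C y "(rgt W j, mult W j)" W] eta
    by (simp add: y_eq)
qed

lemma coalgebra_eqI:
  assumes C: "category C" and W: "awfs C W"
    and y: "y \<in> Obj (coalg C W)" "y' \<in> Obj (coalg C W)" "fst y = fst y'"
    and eq: "\<And>z h. z \<in> Obj (alg C W) \<Longrightarrow> h \<in> hom (arrow_cat C) (fst y) (fst z) \<Longrightarrow>
      canonical_solution C W y (fst (snd h)) z = canonical_solution C W y' (fst (snd h)) z"
  shows "y = y'"
proof (rule prod_eqI)
  have "fst y \<in> Arr C" using coalg_ObjD(1)[OF _ y(1)] W by (simp add: awfs_def)
  from eq[OF free_algebra[OF W this], of "eta_sq C W (fst y)"]
  show "snd y = snd y'"
    using canonical_solution_free_algebra[OF C W y(1)] canonical_solution_free_algebra[OF C W y(2)]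
    by (simp add: y(3))
qed (rule y)

text \<open>The comparison of algebras with chosen lifts is invertible, so an algebra is determined by
  its canonical solutions against the generators.\<close>

lemma generated_algebra_eqI:
  assumes gen: "generated_by C W J P U"
    and a: "a \<in> Obj (alg C W)" "a' \<in> Obj (alg C W)" "fst a = fst a'"
    and eq: "\<And>j w. j \<in> Obj J \<Longrightarrow> (fst (FObj U j), w, fst a) \<in> Arr (arrow_cat C) \<Longrightarrow>
      canonical_solution C W (FObj U j) w a = canonical_solution C W (FObj U j) w a'"
  shows "a = a'"
proof -
  have "canonical_lifts C W J U a = canonical_lifts C W J U a'"
    using a(3) eq by (auto simp: canonical_lifts_def fun_eq_iff)
  moreover obtain G where
    "functors_agree (alg C W) (G \<circ>\<^sub>F canonical_lifts_funct C W J U) id_funct"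
    using gen by (auto simp: generated_by_def is_isomorphism_def)
  then have "FObj G (canonical_lifts C W J U b) = b" if "b \<in> Obj (alg C W)" for b
    using that by (simp add: functors_agree_def comp_funct_def canonical_lifts_funct_def id_funct_def)
  ultimately show ?thesis using a by metis
qed

lemma generated_unit_Obj:
  "generated_by C W J P U \<Longrightarrow> j \<in> Obj J \<Longrightarrow> FObj U j \<in> Obj (coalg C W)"
  by (simp add: generated_by_def functor_over_def is_functor_def)

context leibniz_adjunction
begin

text \<open>Here \<open>a\<close> and \<open>a'\<close> stand for the algebras that two lifted adjunctions place on \<open>hom(i, f)\<close>, and \<open>sol\<close>,
  \<open>sol'\<close> for the canonical solutions of \<open>i \<otimes> y\<close> against \<open>f\<close>.  Surjectivity of the transposition of squares
  makes the algebras agree on all lifting problems from generators, hence be equal;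
  injectivity of the transposition of solutions then gives the agreement for every coalgebra \<open>y\<close>.\<close>

lemma determined_by_generators:
  assumes gen: "generated_by X W J P\<^sub>J U" and f: "f \<in> Arr Y"
    and a: "a \<in> Obj (alg X W)" "a' \<in> Obj (alg X W)" "fst a = G\<^sub>o f" "fst a' = G\<^sub>o f"
    and W: "functorial_factorization X W"
    and sol: "\<And>y h. y \<in> Obj (coalg X W) \<Longrightarrow> h \<in> hom (arrow_cat Y) (FObj F (fst y)) f \<Longrightarrow>
      sol y h \<in> hom Y (FObj T (B, Cod X (fst y))) (Dom Y f) \<and>
      canonical_solution X W y (fst (snd (\<phi> (fst y) f h))) a = tr B (Cod X (fst y)) (Dom Y f) (sol y h)"
    and sol': "\<And>y h. y \<in> Obj (coalg X W) \<Longrightarrow> h \<in> hom (arrow_cat Y) (FObj F (fst y)) f \<Longrightarrow>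
      sol' y h \<in> hom Y (FObj T (B, Cod X (fst y))) (Dom Y f) \<and>
      canonical_solution X W y (fst (snd (\<phi> (fst y) f h))) a' = tr B (Cod X (fst y)) (Dom Y f) (sol' y h)"
    and agree: "\<And>j h. j \<in> Obj J \<Longrightarrow> h \<in> hom (arrow_cat Y) (FObj F (fst (FObj U j))) f \<Longrightarrow>
      sol (FObj U j) h = sol' (FObj U j) h"
  shows "a = a'"
    and "\<And>y h. y \<in> Obj (coalg X W) \<Longrightarrow> h \<in> hom (arrow_cat Y) (FObj F (fst y)) f \<Longrightarrow> sol y h = sol' y h"
proof -
  note f' = Arr_hom[OF f]
  show eq: "a = a'"
  proof (rule generated_algebra_eqI[OF gen a(1,2)])
    fix j w
    assume j: "j \<in> Obj J" and w: "(fst (FObj U j), w, fst a) \<in> Arr (arrow_cat X)"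
    note y = generated_unit_Obj[OF gen j]
    have w': "(fst (FObj U j), w, G\<^sub>o f) \<in> hom (arrow_cat X) (fst (FObj U j)) (G\<^sub>o f)"
      using w by (simp add: a Arr_arrow_cat_iff)
    obtain h where h: "h \<in> hom (arrow_cat Y) (FObj F (fst (FObj U j))) f"
      and \<phi>h: "\<phi> (fst (FObj U j)) f h = (fst (FObj U j), w, G\<^sub>o f)"
      using \<phi>_surj[OF Arr_hom[OF coalg_ObjD(1)[OF W y]] f' w'] .
    show "canonical_solution X W (FObj U j) w a = canonical_solution X W (FObj U j) w a'"
      using sol[OF y h] sol'[OF y h] agree[OF j h] by (simp add: \<phi>h)
  qed (simp add: a)
  fix y h
  assume y: "y \<in> Obj (coalg X W)" and h: "h \<in> hom (arrow_cat Y) (FObj F (fst y)) f"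
  show "sol y h = sol' y h"
    using sol[OF y h] sol'[OF y h] eq
    by (intro tr_inj[OF B_Obj JL_Obj(2)[OF Arr_hom[OF coalg_ObjD(1)[OF W y]]] xy_Obj(1)[OF f']]) simp_all
qed

end


section \<open>Leibniz tensors and homs of a two-variable adjunction\<close>

text \<open>Exchanging the factors of \<open>K \<times> M\<close> turns the adjunction in the variable \<open>K\<close> into a parameterized adjunction
  with parameter in \<open>M\<close>.\<close>

definition swap_funct ::
    "('o \<times> 'p, 'a \<times> 'b, 'q, 'c) funct \<Rightarrow> ('p \<times> 'o, 'b \<times> 'a, 'q, 'c) funct" where
  "swap_funct T = \<lparr>FObj = FObj T \<circ> prod.swap, FArr = FArr T \<circ> prod.swap\<rparr>"

lemma swap_funct_simps [simp]:
  "FObj (swap_funct T) (x, y) = FObj T (y, x)" "FArr (swap_funct T) (f, g) = FArr T (g, f)"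
  by (simp_all add: swap_funct_def)

lemma fix_snd_eq: "fix_snd D T y = fix_fst D (swap_funct T) y"
  by (simp add: fix_snd_def fix_fst_def)

lemma is_functor_swap:
  assumes "is_functor (prod_cat C D) E T"
  shows "is_functor (prod_cat D C) E (swap_funct T)"
  using assms by (simp add: is_functor_def split_paired_Ball_Sigma)

lemma nat_trans_fix_fst:
  assumes C: "category C" and x: "x \<in> Obj C" and n: "nat_trans (prod_cat C D) E T T' \<tau>"
  shows "nat_trans D E (fix_fst C T x) (fix_fst C T' x) (\<lambda>y. \<tau> (x, y))"
proof -
  note i = category_id[OF C x]
  have "FArr T' (Idt C x, g) \<cdot>\<^bsub>E\<^esub> \<tau> (x, Dom D g) = \<tau> (x, Cod D g) \<cdot>\<^bsub>E\<^esub> FArr T (Idt C x, g)"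
    if "g \<in> Arr D" for g
    using nat_trans_square[OF n, of "(Idt C x, g)" "(x, Dom D g)" "(x, Cod D g)"] i Arr_hom[OF that]
    by simp
  then show ?thesis
    using n x by (simp add: nat_trans_def fix_fst_def)
qed

lemma nat_trans_fix_snd:
  assumes D: "category D" and y: "y \<in> Obj D" and n: "nat_trans (prod_cat C D) E T T' \<tau>"
  shows "nat_trans C E (fix_snd D T y) (fix_snd D T' y) (\<lambda>x. \<tau> (x, y))"
proof -
  note i = category_id[OF D y]
  have "FArr T' (g, Idt D y) \<cdot>\<^bsub>E\<^esub> \<tau> (Dom C g, y) = \<tau> (Cod C g, y) \<cdot>\<^bsub>E\<^esub> FArr T (g, Idt D y)"
    if "g \<in> Arr C" for g
    using nat_trans_square[OF n, of "(g, Idt D y)" "(Dom C g, y)" "(Cod C g, y)"] i Arr_hom[OF that]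
    by simp
  then show ?thesis
    using n y by (simp add: nat_trans_def fix_snd_def)
qed

lemma left_parameterized_adjunction:
  assumes "category K" "category M" "category N" and A: "two_var_adjunction K M N A"
  shows "parameterized_adjunction K M N (tens A) (homl A) (trl A)"
proof
  fix a p' p b x' x c y y' g
  assume "a \<in> hom K p' p" "b \<in> hom M x' x" "c \<in> hom N y y'" "g \<in> hom N (FObj (tens A) (p, x)) y"
  then show "trl A p' x' y' (c \<cdot>\<^bsub>N\<^esub> g \<cdot>\<^bsub>N\<^esub> FArr (tens A) (a, b)) =
      FArr (homl A) (a, c) \<cdot>\<^bsub>M\<^esub> trl A p x y g \<cdot>\<^bsub>M\<^esub> b"
    using A by (auto simp: two_var_adjunction_def hom_def)
qed (use assms in \<open>auto simp: two_var_adjunction_def\<close>)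

lemma right_parameterized_adjunction:
  assumes "category K" "category M" "category N" and A: "two_var_adjunction K M N A"
  shows "parameterized_adjunction M K N (swap_funct (tens A)) (homr A) (\<lambda>m k. trr A k m)"
proof
  fix a p' p b x' x c y y' g
  assume "a \<in> hom M p' p" "b \<in> hom K x' x" "c \<in> hom N y y'"
    "g \<in> hom N (FObj (swap_funct (tens A)) (p, x)) y"
  then show "trr A x' p' y' (c \<cdot>\<^bsub>N\<^esub> g \<cdot>\<^bsub>N\<^esub> FArr (swap_funct (tens A)) (a, b)) =
      FArr (homr A) (a, c) \<cdot>\<^bsub>K\<^esub> trr A x p y g \<cdot>\<^bsub>K\<^esub> b"
    using A by (auto simp: two_var_adjunction_def hom_def)
qed (use assms in \<open>auto simp: two_var_adjunction_def intro: is_functor_swap\<close>)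

lemma po_copair:
  assumes "has_pushouts C" "f \<in> Arr C" "g \<in> Arr C" "Dom C f = Dom C g"
    and "x \<in> hom C (Cod C f) z" "y \<in> hom C (Cod C g) z" "x \<cdot>\<^bsub>C\<^esub> f = y \<cdot>\<^bsub>C\<^esub> g"
  shows "po_copair C f g x y \<in> hom C (Cod C (fst (pushout_of C f g))) z"
    and "po_copair C f g x y \<cdot>\<^bsub>C\<^esub> fst (pushout_of C f g) = x"
    and "po_copair C f g x y \<cdot>\<^bsub>C\<^esub> snd (pushout_of C f g) = y"
  using pb_pair[of "op_cat C" f g x z y] assms
  by (simp_all add: po_copair_def pushout_of_def has_pushouts_def)

context parameterized_adjunction
begin

context
  fixes i j A B J L
  assumes pushouts: "has_pushouts Y" and i: "i \<in> hom P A B" and j: "j \<in> hom X J L"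
begin

lemma span:
  "FArr T (Idt P A, j) \<in> hom Y (FObj T (A, J)) (FObj T (A, L))"
  "FArr T (i, Idt X J) \<in> hom Y (FObj T (A, J)) (FObj T (B, J))"
  "span_fst P T i j = FArr T (Idt P A, j)"
  "span_snd X T i j = FArr T (i, Idt X J)"
  using T_hom[OF category_id[OF P category_hom_Obj(1)[OF P i]] j]
    T_hom[OF i category_id[OF X category_hom_Obj(1)[OF X j]]] homD[OF i] homD[OF j]
  by (simp_all add: span_fst_def span_snd_def)

lemma leibniz_injs_pushout:
  "is_pullback (op_cat Y) (FArr T (Idt P A, j)) (FArr T (i, Idt X J))
     (fst (leibniz_injs P X Y T i j)) (snd (leibniz_injs P X Y T i j))"
  using pullback_of_is_pullback[of "op_cat Y" "FArr T (Idt P A, j)" "FArr T (i, Idt X J)"] pushouts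
    homD[OF span(1)] homD[OF span(2)]
  by (simp add: leibniz_injs_def pushout_of_def span(3,4) has_pushouts_def)

lemma leibniz_copair:
  assumes "x \<in> hom Y (FObj T (A, L)) z" "y \<in> hom Y (FObj T (B, J)) z"
    "x \<cdot>\<^bsub>Y\<^esub> FArr T (Idt P A, j) = y \<cdot>\<^bsub>Y\<^esub> FArr T (i, Idt X J)"
  shows "po_copair Y (span_fst P T i j) (span_snd X T i j) x y \<in>
      hom Y (Cod Y (fst (leibniz_injs P X Y T i j))) z"
    and "po_copair Y (span_fst P T i j) (span_snd X T i j) x y \<cdot>\<^bsub>Y\<^esub> fst (leibniz_injs P X Y T i j) = x"
    and "po_copair Y (span_fst P T i j) (span_snd X T i j) x y \<cdot>\<^bsub>Y\<^esub> snd (leibniz_injs P X Y T i j) = y"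
  using po_copair[OF pushouts, of "FArr T (Idt P A, j)" "FArr T (i, Idt X J)" x z y] assms
    homD[OF span(1)] homD[OF span(2)]
  by (simp_all add: leibniz_injs_def span(3,4))

lemma leibniz_injs_hom:
  "fst (leibniz_injs P X Y T i j) \<in> hom Y (FObj T (A, L)) (Cod Y (fst (leibniz_injs P X Y T i j)))"
  "snd (leibniz_injs P X Y T i j) \<in> hom Y (FObj T (B, J)) (Cod Y (fst (leibniz_injs P X Y T i j)))"
  "fst (leibniz_injs P X Y T i j) \<cdot>\<^bsub>Y\<^esub> FArr T (Idt P A, j) =
   snd (leibniz_injs P X Y T i j) \<cdot>\<^bsub>Y\<^esub> FArr T (i, Idt X J)"
  using is_pullbackD[OF leibniz_injs_pushout] homD(3)[OF span(1)] homD(3)[OF span(2)] by simp_all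

lemma leibniz_tens_obj:
  "leibniz_tens_obj P X Y T i j \<in> hom Y (Cod Y (fst (leibniz_injs P X Y T i j))) (FObj T (B, L))"
  "leibniz_tens_obj P X Y T i j \<cdot>\<^bsub>Y\<^esub> fst (leibniz_injs P X Y T i j) = FArr T (i, Idt X L)"
  "leibniz_tens_obj P X Y T i j \<cdot>\<^bsub>Y\<^esub> snd (leibniz_injs P X Y T i j) = FArr T (Idt P B, j)"
proof -
  note iA = category_id[OF P category_hom_Obj(1)[OF P i]] and iB = category_id[OF P category_hom_Obj(2)[OF P i]]
    and iJ = category_id[OF X category_hom_Obj(1)[OF X j]] and iL = category_id[OF X category_hom_Obj(2)[OF X j]]
  have "FArr T (i, Idt X L) \<cdot>\<^bsub>Y\<^esub> FArr T (Idt P A, j) = FArr T (Idt P B, j) \<cdot>\<^bsub>Y\<^esub> FArr T (i, Idt X J)"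
    using T_comp[OF iA i j iL] T_comp[OF i iB iJ j]
    by (simp add: category_id_left[OF P i] category_id_right[OF P i]
        category_id_left[OF X j] category_id_right[OF X j])
  from leibniz_copair[OF T_hom[OF i iL] T_hom[OF iB j] this]
  show "leibniz_tens_obj P X Y T i j \<in> hom Y (Cod Y (fst (leibniz_injs P X Y T i j))) (FObj T (B, L))"
    "leibniz_tens_obj P X Y T i j \<cdot>\<^bsub>Y\<^esub> fst (leibniz_injs P X Y T i j) = FArr T (i, Idt X L)"
    "leibniz_tens_obj P X Y T i j \<cdot>\<^bsub>Y\<^esub> snd (leibniz_injs P X Y T i j) = FArr T (Idt P B, j)"
    by (simp_all add: leibniz_tens_obj_def homD[OF i] homD[OF j])
qed

end

lemma leibniz_tens_sq:
  assumes pushouts: "has_pushouts Y"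
    and ab: "(i, (a, b), i') \<in> hom (arrow_cat P) i i'" and cd: "(j, (c, d), j') \<in> hom (arrow_cat X) j j'"
  shows "\<exists>m\<in>hom Y (Cod Y (fst (leibniz_injs P X Y T i j))) (Cod Y (fst (leibniz_injs P X Y T i' j'))).
    FArr (leibniz_tens P X Y T) ((i, (a, b), i'), (j, (c, d), j')) =
      (leibniz_tens_obj P X Y T i j, (m, FArr T (b, d)), leibniz_tens_obj P X Y T i' j') \<and>
    m \<cdot>\<^bsub>Y\<^esub> fst (leibniz_injs P X Y T i j) = fst (leibniz_injs P X Y T i' j') \<cdot>\<^bsub>Y\<^esub> FArr T (a, d) \<and>
    m \<cdot>\<^bsub>Y\<^esub> snd (leibniz_injs P X Y T i j) = snd (leibniz_injs P X Y T i' j') \<cdot>\<^bsub>Y\<^esub> FArr T (b, c)"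
proof -
  let ?A = "Dom P i" and ?B = "Cod P i" and ?A' = "Dom P i'" and ?B' = "Cod P i'"
  let ?J = "Dom X j" and ?L = "Cod X j" and ?J' = "Dom X j'" and ?L' = "Cod X j'"
  let ?\<kappa>\<^sub>1 = "fst (leibniz_injs P X Y T i' j')" and ?\<kappa>\<^sub>2 = "snd (leibniz_injs P X Y T i' j')"
  have i: "i \<in> hom P ?A ?B" "i' \<in> hom P ?A' ?B'" and a: "a \<in> hom P ?A ?A'" and b: "b \<in> hom P ?B ?B'"
    and sq: "i' \<cdot>\<^bsub>P\<^esub> a = b \<cdot>\<^bsub>P\<^esub> i"
    using ab by (auto simp: hom_arrow_cat_iff Arr_hom)
  have j: "j \<in> hom X ?J ?L" "j' \<in> hom X ?J' ?L'" and c: "c \<in> hom X ?J ?J'" and d: "d \<in> hom X ?L ?L'"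
    and sq': "j' \<cdot>\<^bsub>X\<^esub> c = d \<cdot>\<^bsub>X\<^esub> j"
    using cd by (auto simp: hom_arrow_cat_iff Arr_hom)
  note iA = category_id[OF P category_hom_Obj(1)[OF P i(1)]] category_id[OF P category_hom_Obj(1)[OF P i(2)]]
    and iJ = category_id[OF X category_hom_Obj(1)[OF X j(1)]] category_id[OF X category_hom_Obj(1)[OF X j(2)]]
  note injs = leibniz_injs_hom[OF pushouts i(2) j(2)]
  note Tad = T_hom[OF a d] and Tbc = T_hom[OF b c] and Tac = T_hom[OF a c]
  note x = category_comp[OF Y Tad injs(1)] and y = category_comp[OF Y Tbc injs(2)]
  have "(?\<kappa>\<^sub>1 \<cdot>\<^bsub>Y\<^esub> FArr T (a, d)) \<cdot>\<^bsub>Y\<^esub> FArr T (Idt P ?A, j) =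
      ?\<kappa>\<^sub>1 \<cdot>\<^bsub>Y\<^esub> FArr T (Idt P ?A', j') \<cdot>\<^bsub>Y\<^esub> FArr T (a, c)"
    using T_comp[OF iA(1) a j(1) d] T_comp[OF a iA(2) c j(2)]
    by (simp add: category_assoc[OF Y T_hom[OF iA(1) j(1)] Tad injs(1)] sq'
        category_id_left[OF P a] category_id_right[OF P a])
  also have "\<dots> = ?\<kappa>\<^sub>2 \<cdot>\<^bsub>Y\<^esub> FArr T (i', Idt X ?J') \<cdot>\<^bsub>Y\<^esub> FArr T (a, c)"
    using injs(3) category_assoc[OF Y Tac T_hom[OF iA(2) j(2)] injs(1)]
      category_assoc[OF Y Tac T_hom[OF i(2) iJ(2)] injs(2)] by simp
  also have "\<dots> = (?\<kappa>\<^sub>2 \<cdot>\<^bsub>Y\<^esub> FArr T (b, c)) \<cdot>\<^bsub>Y\<^esub> FArr T (i, Idt X ?J)"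
    using T_comp[OF i(1) b iJ(1) c] T_comp[OF a i(2) c iJ(2)]
    by (simp add: category_assoc[OF Y T_hom[OF i(1) iJ(1)] Tbc injs(2)] sq
        category_id_left[OF X c] category_id_right[OF X c])
  finally show ?thesis
    using leibniz_copair[OF pushouts i(1) j(1) x y]
    by (intro bexI[of _ "po_copair Y (span_fst P T i j) (span_snd X T i j)
        (?\<kappa>\<^sub>1 \<cdot>\<^bsub>Y\<^esub> FArr T (a, d)) (?\<kappa>\<^sub>2 \<cdot>\<^bsub>Y\<^esub> FArr T (b, c))"])
      (simp_all add: leibniz_tens_def)
qed

end

lemma leibniz_two_var_simps:
  "tens (leibniz_two_var K M N A) = leibniz_tens K M N (tens A)"
  "homl (leibniz_two_var K M N A) = leibniz_hom K N M (homl A)"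
  "homr (leibniz_two_var K M N A) = leibniz_hom M N K (homr A)"
  by (simp_all add: leibniz_two_var_def)

lemma left_leibniz_adjunction:
  assumes cats: "category K" "category M" "category N" and A: "two_var_adjunction K M N A"
    and lims: "has_pullbacks M" "has_pushouts N" and i: "i \<in> Arr K"
  shows "leibniz_adjunction K M N (tens A) (homl A) (trl A) i
    (\<lambda>j. fst (leibniz_injs K M N (tens A) i j)) (\<lambda>j. snd (leibniz_injs K M N (tens A) i j))
    (fix_fst (arrow_cat K) (tens (leibniz_two_var K M N A)) i) (trl (leibniz_two_var K M N A) i)"
proof -
  interpret parameterized_adjunction K M N "tens A" "homl A" "trl A"
    by (rule left_parameterized_adjunction[OF cats A])
  note i' = Arr_hom[OF i]
  show ?thesis
  proof
    fix j assume "j \<in> Arr M"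
    note j = Arr_hom[OF this]
    show "is_pullback (op_cat N) (FArr (tens A) (Idt K (Dom K i), j)) (FArr (tens A) (i, Idt M (Dom M j)))
        (fst (leibniz_injs K M N (tens A) i j)) (snd (leibniz_injs K M N (tens A) i j))"
      by (rule leibniz_injs_pushout[OF lims(2) i' j])
  next
    fix j c d j' assume "(j, (c, d), j') \<in> hom (arrow_cat M) j j'"
    from leibniz_tens_sq[OF lims(2) _ this, of i "Idt K (Dom K i)" "Idt K (Cod K i)" i]
    show "\<exists>m\<in>hom N (Cod N (fst (leibniz_injs K M N (tens A) i j)))
                  (Cod N (fst (leibniz_injs K M N (tens A) i j'))).
        FArr (fix_fst (arrow_cat K) (tens (leibniz_two_var K M N A)) i) (j, (c, d), j') =
          (FObj (fix_fst (arrow_cat K) (tens (leibniz_two_var K M N A)) i) j,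
           (m, FArr (tens A) (Idt K (Cod K i), d)),
           FObj (fix_fst (arrow_cat K) (tens (leibniz_two_var K M N A)) i) j') \<and>
        m \<cdot>\<^bsub>N\<^esub> fst (leibniz_injs K M N (tens A) i j) =
          fst (leibniz_injs K M N (tens A) i j') \<cdot>\<^bsub>N\<^esub> FArr (tens A) (Idt K (Dom K i), d) \<and>
        m \<cdot>\<^bsub>N\<^esub> snd (leibniz_injs K M N (tens A) i j) =
          snd (leibniz_injs K M N (tens A) i j') \<cdot>\<^bsub>N\<^esub> FArr (tens A) (Idt K (Cod K i), c)"
      using category_id[OF category_arrow_cat[OF cats(1)], of i] i
      by (simp add: fix_fst_def leibniz_two_var_simps) (simp add: leibniz_tens_def)
  qed (use lims i leibniz_tens_obj[OF lims(2) i' Arr_hom]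
      in \<open>simp_all add: fix_fst_def leibniz_two_var_def leibniz_tens_def\<close>)
qed

lemma right_leibniz_adjunction:
  assumes cats: "category K" "category M" "category N" and A: "two_var_adjunction K M N A"
    and lims: "has_pullbacks K" "has_pushouts N" and j: "j \<in> Arr M"
  shows "leibniz_adjunction M K N (swap_funct (tens A)) (homr A) (\<lambda>m k. trr A k m) j
    (\<lambda>i. snd (leibniz_injs K M N (tens A) i j)) (\<lambda>i. fst (leibniz_injs K M N (tens A) i j))
    (fix_snd (arrow_cat M) (tens (leibniz_two_var K M N A)) j)
    (\<lambda>i. trr (leibniz_two_var K M N A) i j)"
proof -
  interpret parameterized_adjunction K M N "tens A" "homl A" "trl A"
    by (rule left_parameterized_adjunction[OF cats A])
  interpret right: parameterized_adjunction M K N "swap_funct (tens A)" "homr A" "\<lambda>m k. trr A k m"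
    by (rule right_parameterized_adjunction[OF cats A])
  note j' = Arr_hom[OF j]
  have Cod_injs: "Cod N (snd (leibniz_injs K M N (tens A) i j)) = Cod N (fst (leibniz_injs K M N (tens A) i j))"
    if "i \<in> Arr K" for i
    using homD(3)[OF leibniz_injs_hom(2)[OF lims(2) Arr_hom[OF that] j']] .
  show ?thesis
  proof
    fix i assume "i \<in> Arr K"
    note i = Arr_hom[OF this]
    show "is_pullback (op_cat N) (FArr (swap_funct (tens A)) (Idt M (Dom M j), i))
        (FArr (swap_funct (tens A)) (j, Idt K (Dom K i)))
        (snd (leibniz_injs K M N (tens A) i j)) (fst (leibniz_injs K M N (tens A) i j))"
      using is_pullback_sym[OF leibniz_injs_pushout[OF lims(2) i j']] by simp
  next
    fix i a b i' assume ab: "(i, (a, b), i') \<in> hom (arrow_cat K) i i'"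
    then have "i \<in> Arr K" "i' \<in> Arr K" by (simp_all add: hom_arrow_cat_iff)
    note C = Cod_injs[OF this(1)] Cod_injs[OF this(2)]
    from leibniz_tens_sq[OF lims(2) ab, of j "Idt M (Dom M j)" "Idt M (Cod M j)" j]
    show "\<exists>m\<in>hom N (Cod N (snd (leibniz_injs K M N (tens A) i j)))
                  (Cod N (snd (leibniz_injs K M N (tens A) i' j))).
        FArr (fix_snd (arrow_cat M) (tens (leibniz_two_var K M N A)) j) (i, (a, b), i') =
          (FObj (fix_snd (arrow_cat M) (tens (leibniz_two_var K M N A)) j) i,
           (m, FArr (swap_funct (tens A)) (Idt M (Cod M j), b)),
           FObj (fix_snd (arrow_cat M) (tens (leibniz_two_var K M N A)) j) i') \<and>
        m \<cdot>\<^bsub>N\<^esub> snd (leibniz_injs K M N (tens A) i j) =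
          snd (leibniz_injs K M N (tens A) i' j) \<cdot>\<^bsub>N\<^esub> FArr (swap_funct (tens A)) (Idt M (Dom M j), b) \<and>
        m \<cdot>\<^bsub>N\<^esub> fst (leibniz_injs K M N (tens A) i j) =
          fst (leibniz_injs K M N (tens A) i' j) \<cdot>\<^bsub>N\<^esub> FArr (swap_funct (tens A)) (Idt M (Cod M j), a)"
      using category_id[OF category_arrow_cat[OF cats(2)], of j] j
      by (simp add: fix_snd_def leibniz_two_var_simps C) (auto simp: leibniz_tens_def)
  qed (use lims j leibniz_tens_obj[OF lims(2) Arr_hom j'] Cod_injs
      in \<open>simp_all add: fix_snd_def leibniz_two_var_def leibniz_tens_def\<close>)
qed


section \<open>Two-variable adjunctions of awfs\<close>

text \<open>A morphism of structured arrows consists of its two ends and an underlying square, so a lift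
  of a given functor is determined by its values on objects.\<close>

lemma lifts_agreeI:
  fixes C :: "('o, 'a) cat"
  assumes L: "is_lift X Y (structured_arrow_cat C Ob Pr) F S" "is_lift X Y (structured_arrow_cat C Ob Pr) F S'"
    and ends: "\<And>f. f \<in> Arr (prod_cat X Y) \<Longrightarrow>
      Dom (prod_cat X Y) f \<in> Obj (prod_cat X Y) \<and> Cod (prod_cat X Y) f \<in> Obj (prod_cat X Y)"
    and obj: "\<And>x y. x \<in> Obj X \<Longrightarrow> y \<in> Obj Y \<Longrightarrow> FObj S (x, y) = FObj S' (x, y)"
  shows "functors_agree (prod_cat X Y) S S'"
proof -
  let ?Z = "structured_arrow_cat C Ob Pr"
  have obj': "FObj S x = FObj S' x" if "x \<in> Obj (prod_cat X Y)" for x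
    using obj that by (cases x) simp
  have "FArr S f = FArr S' f" if f: "f \<in> Arr (prod_cat X Y)" for f
  proof -
    let ?x = "Dom (prod_cat X Y) f" and ?y = "Cod (prod_cat X Y) f"
    have arr: "FArr L f \<in> hom ?Z (FObj L ?x) (FObj L ?y)"
      "FArr forget (FArr L f) = FArr F (FArr (forget \<times>\<^sub>F forget) f)"
      if "is_lift X Y ?Z F L" for L
      using that f by (auto simp: is_lift_def is_functor_def functors_agree_def comp_funct_def)
    have det: "g = g'" if "g \<in> hom ?Z x y" "g' \<in> hom ?Z x y" "FArr forget g = FArr forget g'"
      for g g' x y
      using that by (auto simp: hom_def structured_arrow_cat_def forget_def)
    show ?thesis
      using arr[OF L(1)] arr[OF L(2)] obj' ends[OF f] by (intro det) auto
  qed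
  with obj' show ?thesis by (simp add: functors_agree_def)
qed

lemma prod_cat_ends:
  assumes "\<And>f. f \<in> Arr C \<Longrightarrow> Dom C f \<in> Obj C \<and> Cod C f \<in> Obj C"
    and "\<And>f. f \<in> Arr D \<Longrightarrow> Dom D f \<in> Obj D \<and> Cod D f \<in> Obj D"
    and "f \<in> Arr (prod_cat C D)"
  shows "Dom (prod_cat C D) f \<in> Obj (prod_cat C D) \<and> Cod (prod_cat C D) f \<in> Obj (prod_cat C D)"
  using assms by (cases f) simp

lemma coalg_ends: "f \<in> Arr (coalg C W) \<Longrightarrow> Dom (coalg C W) f \<in> Obj (coalg C W) \<and> Cod (coalg C W) f \<in> Obj (coalg C W)"
  and alg_ends: "f \<in> Arr (alg C W) \<Longrightarrow> Dom (alg C W) f \<in> Obj (alg C W) \<and> Cod (alg C W) f \<in> Obj (alg C W)"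
  by (auto simp: coalg_def alg_def structured_arrow_cat_def)

locale two_variable_awfs =
  fixes K :: "('k, 'ka) cat" and M :: "('m, 'ma) cat" and N :: "('n, 'na) cat"
    and A :: "('k, 'ka, 'm, 'ma, 'n, 'na) two_var"
    and W\<^sub>K :: "('k, 'ka) awfs_data" and W\<^sub>M :: "('m, 'ma) awfs_data" and W\<^sub>N :: "('n, 'na) awfs_data"
  assumes cats: "category K" "category M" "category N"
    and pullbacks: "has_pullbacks K" "has_pullbacks M" and pushouts: "has_pushouts N"
    and A: "two_var_adjunction K M N A"
    and awfs: "awfs K W\<^sub>K" "awfs M W\<^sub>M" "awfs N W\<^sub>N"
begin

abbreviation "adj S \<equiv> two_var_adjunction_of_awfs K M N A W\<^sub>K W\<^sub>M W\<^sub>N S"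
abbreviation "tensor i j \<equiv> leibniz_tens_obj K M N (tens A) i j"
abbreviation "A\<^sub>L \<equiv> leibniz_two_var K M N A"

definition solution ::
    "('ka, 'ma, 'na) lifted_two_var \<Rightarrow> 'ka \<times> 'ka \<Rightarrow> 'ma \<times> 'ma \<Rightarrow> 'na \<times> 'na \<Rightarrow> ('na, 'na) sq \<Rightarrow> 'na" where
  "solution S x y z h = canonical_solution N W\<^sub>N (FObj (ltens S) (x, y)) (fst (snd h)) z"

lemma ff: "functorial_factorization K W\<^sub>K" "functorial_factorization M W\<^sub>M" "functorial_factorization N W\<^sub>N"
  using awfs by (simp_all add: awfs_def)

lemma mid_functor:
  "is_functor (arrow_cat K) K (mid W\<^sub>K)" "is_functor (arrow_cat M) M (mid W\<^sub>M)"
  "is_functor (arrow_cat N) N (mid W\<^sub>N)"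
  using ff by (simp_all add: functorial_factorization_def)

lemma ltens_Obj:
  assumes "adj S" "x \<in> Obj (coalg K W\<^sub>K)" "y \<in> Obj (coalg M W\<^sub>M)"
  shows "FObj (ltens S) (x, y) \<in> Obj (coalg N W\<^sub>N)"
    and "fst (FObj (ltens S) (x, y)) = tensor (fst x) (fst y)"
  using assms
  by (auto simp: two_var_adjunction_of_awfs_def is_lift_def is_functor_def functors_agree_def
      comp_funct_def prod_funct_def forget_def leibniz_tens_def leibniz_hom_def)

lemma lhoml_Obj:
  assumes "adj S" "x \<in> Obj (coalg K W\<^sub>K)" "z \<in> Obj (alg N W\<^sub>N)"
  shows "FObj (lhoml S) (x, z) \<in> Obj (alg M W\<^sub>M)"
    and "fst (FObj (lhoml S) (x, z)) = leibniz_hom_obj K N M (homl A) (fst x) (fst z)"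
  using assms
  by (auto simp: two_var_adjunction_of_awfs_def is_lift_def is_functor_def functors_agree_def
      comp_funct_def prod_funct_def forget_def leibniz_tens_def leibniz_hom_def)

lemma lhomr_Obj:
  assumes "adj S" "y \<in> Obj (coalg M W\<^sub>M)" "z \<in> Obj (alg N W\<^sub>N)"
  shows "FObj (lhomr S) (y, z) \<in> Obj (alg K W\<^sub>K)"
    and "fst (FObj (lhomr S) (y, z)) = leibniz_hom_obj M N K (homr A) (fst y) (fst z)"
  using assms
  by (auto simp: two_var_adjunction_of_awfs_def is_lift_def is_functor_def functors_agree_def
      comp_funct_def prod_funct_def forget_def leibniz_tens_def leibniz_hom_def)

lemma solution_hom:
  assumes S: "adj S"
    and x: "x \<in> Obj (coalg K W\<^sub>K)" and y: "y \<in> Obj (coalg M W\<^sub>M)" and z: "z \<in> Obj (alg N W\<^sub>N)"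
    and h: "h \<in> hom (arrow_cat N) (tensor (fst x) (fst y)) (fst z)"
  shows "solution S x y z h \<in> hom N (FObj (tens A) (Cod K (fst x), Cod M (fst y))) (Dom N (fst z))"
proof -
  interpret parameterized_adjunction K M N "tens A" "homl A" "trl A"
    by (rule left_parameterized_adjunction[OF cats A])
  note xy = Arr_hom[OF coalg_ObjD(1)[OF ff(1) x]] Arr_hom[OF coalg_ObjD(1)[OF ff(2) y]]
  show ?thesis
    using canonical_solution_hom[OF cats(3) ff(3) ltens_Obj(1)[OF S x y] z, of h]
      h homD(3)[OF leibniz_tens_obj(1)[OF pushouts xy]]
    by (simp add: solution_def ltens_Obj(2)[OF S x y])
qed

text \<open>The characterizing transformations express the three lifted structure maps through \<open>lam\<close>, \<open>rhol\<close> and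
  \<open>rhor\<close>, so the transposition of solutions along mates applies once in each of the two variables.\<close>

lemma solution_transposes:
  assumes S: "adj S"
    and x: "x \<in> Obj (coalg K W\<^sub>K)" and y: "y \<in> Obj (coalg M W\<^sub>M)" and z: "z \<in> Obj (alg N W\<^sub>N)"
    and h: "h \<in> hom (arrow_cat N) (tensor (fst x) (fst y)) (fst z)"
  shows "canonical_solution M W\<^sub>M y (fst (snd (trl A\<^sub>L (fst x) (fst y) (fst z) h))) (FObj (lhoml S) (x, z)) =
      trl A (Cod K (fst x)) (Cod M (fst y)) (Dom N (fst z)) (solution S x y z h)" (is ?left)
    and "canonical_solution K W\<^sub>K x (fst (snd (trr A\<^sub>L (fst x) (fst y) (fst z) h))) (FObj (lhomr S) (y, z)) =
      trr A (Cod K (fst x)) (Cod M (fst y)) (Dom N (fst z)) (solution S x y z h)" (is ?right)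
proof -
  obtain i s where x_eq: "x = (i, s)" by (cases x)
  obtain j t where y_eq: "y = (j, t)" by (cases y)
  obtain f r where z_eq: "z = (f, r)" by (cases z)
  have i_Arr: "i \<in> Arr K" and s: "s \<in> hom K (Cod K i) (FObj (mid W\<^sub>K) i)"
    using coalg_ObjD[OF ff(1) x] by (simp_all add: x_eq)
  have j_Arr: "j \<in> Arr M" and t: "t \<in> hom M (Cod M j) (FObj (mid W\<^sub>M) j)"
    using coalg_ObjD[OF ff(2) y] by (simp_all add: y_eq)
  have f: "f \<in> Arr N" and r: "r \<in> hom N (FObj (mid W\<^sub>N) f) (Dom N f)"
    using alg_ObjD[OF ff(3) z] by (simp_all add: z_eq)
  have h': "h \<in> hom (arrow_cat N) (tensor i j) f" using h by (simp add: x_eq y_eq z_eq)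
  let ?Q' = "FObj (mid W\<^sub>K) i" and ?Q = "FObj (mid W\<^sub>M) j"
  obtain lam rhol rhor where
    T: "characterizes_tens K M N (tens A) W\<^sub>K W\<^sub>M W\<^sub>N lam (ltens S)" and
    Hl: "characterizes_hom K N M (homl A) W\<^sub>K W\<^sub>N W\<^sub>M rhol (lhoml S)" and
    Hr: "characterizes_hom M N K (homr A) W\<^sub>M W\<^sub>N W\<^sub>K rhor (lhomr S)" and
    m: "parameterized_mates K M N A W\<^sub>K W\<^sub>M W\<^sub>N lam rhol rhor"
    using S unfolding two_var_adjunction_of_awfs_def by blast
  have FT: "FObj (ltens S) (x, y) = (tensor i j, lam (i, j) \<cdot>\<^bsub>N\<^esub> FArr (tens A) (s, t))"
    using T x y unfolding characterizes_tens_def x_eq y_eq by blast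
  have FHl: "FObj (lhoml S) (x, z) =
      (leibniz_hom_obj K N M (homl A) i f, FArr (homl A) (s, r) \<cdot>\<^bsub>M\<^esub> rhol (i, f))"
    using Hl x z unfolding characterizes_hom_def x_eq z_eq by blast
  have FHr: "FObj (lhomr S) (y, z) =
      (leibniz_hom_obj M N K (homr A) j f, FArr (homr A) (t, r) \<cdot>\<^bsub>K\<^esub> rhor (j, f))"
    using Hr y z unfolding characterizes_hom_def y_eq z_eq by blast
  have nat: "nat_trans (prod_cat (arrow_cat K) (arrow_cat M)) N
      (tens A \<circ>\<^sub>F (mid W\<^sub>K \<times>\<^sub>F mid W\<^sub>M)) (mid W\<^sub>N \<circ>\<^sub>F leibniz_tens K M N (tens A)) lam"
    using T by (simp add: characterizes_tens_def)
  have sol: "solution S x y z h =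
      r \<cdot>\<^bsub>N\<^esub> FArr (mid W\<^sub>N) h \<cdot>\<^bsub>N\<^esub> lam (i, j) \<cdot>\<^bsub>N\<^esub> FArr (tens A) (s, t)"
    using canonical_solution_eq[of h N "FObj (ltens S) (x, y)" z W\<^sub>N] h'
    by (simp add: solution_def FT z_eq)
  show ?left
  proof -
    interpret leibniz_adjunction K M N "tens A" "homl A" "trl A" i
      "\<lambda>j. fst (leibniz_injs K M N (tens A) i j)" "\<lambda>j. snd (leibniz_injs K M N (tens A) i j)"
      "fix_fst (arrow_cat K) (tens A\<^sub>L) i" "trl A\<^sub>L i"
      by (rule left_leibniz_adjunction[OF cats A pullbacks(2) pushouts i_Arr])
    have F: "FObj (fix_fst (arrow_cat K) (tens A\<^sub>L) i) j = tensor i j"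
      by (simp add: fix_fst_def leibniz_two_var_simps leibniz_tens_def)
    have h'': "h \<in> hom (arrow_cat N) (FObj (fix_fst (arrow_cat K) (tens A\<^sub>L) i) j) f"
      using h' by (simp add: F)
    have G: "FObj (fix_fst (arrow_cat K) (homl A\<^sub>L) i) f = leibniz_hom_obj K N M (homl A) i f" for f
      by (simp add: fix_fst_def leibniz_two_var_simps leibniz_hom_def)
    have lam: "nat_trans (arrow_cat M) N (fix_fst K (tens A) ?Q' \<circ>\<^sub>F mid W\<^sub>M)
        (mid W\<^sub>N \<circ>\<^sub>F fix_fst (arrow_cat K) (tens A\<^sub>L) i) (\<lambda>j. lam (i, j))"
      using nat_trans_fix_fst[OF category_arrow_cat[OF cats(1)] _ nat, of i] i_Arr
        functor_id[OF mid_functor(1), of i]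
      by (simp add: fix_fst_def comp_funct_def prod_funct_def leibniz_two_var_simps comp_def)
    have mates: "mates (arrow_cat M) (arrow_cat N)
        (fix_fst (arrow_cat K) (tens A\<^sub>L) i) (fix_fst (arrow_cat K) (homl A\<^sub>L) i) (trl A\<^sub>L i)
        M N (fix_fst K (tens A) ?Q') (fix_fst K (homl A) ?Q') (trl A ?Q')
        (mid W\<^sub>M) (mid W\<^sub>N) (\<lambda>j. lam (i, j)) (\<lambda>f. rhol (i, f))"
      using m i_Arr by (simp add: parameterized_mates_def Let_def)
    have rho: "rhol (i, f) \<in> hom M (FObj (mid W\<^sub>M) (FObj (fix_fst (arrow_cat K) (homl A\<^sub>L) i) f))
        (FObj (homl A) (?Q', FObj (mid W\<^sub>N) f))"
      using Hl i_Arr f unfolding characterizes_hom_def nat_trans_def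
      by (simp add: comp_funct_def prod_funct_def G) (simp add: leibniz_hom_def)
    have "trl A\<^sub>L i j f h \<in> hom (arrow_cat M) j (leibniz_hom_obj K N M (homl A) i f)"
      by (rule \<phi>_hom[OF Arr_hom[OF j_Arr] Arr_hom[OF f] h''])
    then show ?thesis
      using transpose_solution[OF G mid_functor(2,3) lam mates rho s t j_Arr r h'']
        canonical_solution_eq[of "trl A\<^sub>L i j f h" M y "FObj (lhoml S) (x, z)" W\<^sub>M]
      by (simp add: sol FHl) (simp add: x_eq y_eq z_eq)
  qed
  show ?right
  proof -
    interpret leibniz_adjunction M K N "swap_funct (tens A)" "homr A" "\<lambda>m k. trr A k m" j
      "\<lambda>i. snd (leibniz_injs K M N (tens A) i j)" "\<lambda>i. fst (leibniz_injs K M N (tens A) i j)"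
      "fix_snd (arrow_cat M) (tens A\<^sub>L) j" "\<lambda>i. trr A\<^sub>L i j"
      by (rule right_leibniz_adjunction[OF cats A pullbacks(1) pushouts j_Arr])
    have F: "FObj (fix_snd (arrow_cat M) (tens A\<^sub>L) j) i = tensor i j"
      by (simp add: fix_snd_def leibniz_two_var_simps leibniz_tens_def)
    have h'': "h \<in> hom (arrow_cat N) (FObj (fix_snd (arrow_cat M) (tens A\<^sub>L) j) i) f"
      using h' by (simp add: F)
    have G: "FObj (fix_fst (arrow_cat M) (homr A\<^sub>L) j) f = leibniz_hom_obj M N K (homr A) j f" for f
      by (simp add: fix_fst_def leibniz_two_var_simps leibniz_hom_def)
    have lam: "nat_trans (arrow_cat K) N (fix_fst M (swap_funct (tens A)) ?Q \<circ>\<^sub>F mid W\<^sub>K)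
        (mid W\<^sub>N \<circ>\<^sub>F fix_snd (arrow_cat M) (tens A\<^sub>L) j) (\<lambda>i. lam (i, j))"
      using nat_trans_fix_snd[OF category_arrow_cat[OF cats(2)] _ nat, of j] j_Arr
        functor_id[OF mid_functor(2), of j]
      by (simp add: fix_snd_def fix_fst_def comp_funct_def prod_funct_def leibniz_two_var_simps comp_def)
    have mates: "mates (arrow_cat K) (arrow_cat N)
        (fix_snd (arrow_cat M) (tens A\<^sub>L) j) (fix_fst (arrow_cat M) (homr A\<^sub>L) j) (\<lambda>i. trr A\<^sub>L i j)
        K N (fix_fst M (swap_funct (tens A)) ?Q) (fix_fst M (homr A) ?Q) (\<lambda>k. trr A k ?Q)
        (mid W\<^sub>K) (mid W\<^sub>N) (\<lambda>i. lam (i, j)) (\<lambda>f. rhor (j, f))"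
      using m j_Arr by (simp add: parameterized_mates_def Let_def fix_snd_eq[of M "tens A"])
    have rho: "rhor (j, f) \<in> hom K (FObj (mid W\<^sub>K) (FObj (fix_fst (arrow_cat M) (homr A\<^sub>L) j) f))
        (FObj (homr A) (?Q, FObj (mid W\<^sub>N) f))"
      using Hr j_Arr f unfolding characterizes_hom_def nat_trans_def
      by (simp add: comp_funct_def prod_funct_def G) (simp add: leibniz_hom_def)
    have "trr A\<^sub>L i j f h \<in> hom (arrow_cat K) i (leibniz_hom_obj M N K (homr A) j f)"
      by (rule \<phi>_hom[OF Arr_hom[OF i_Arr] Arr_hom[OF f] h''])
    then show ?thesis
      using transpose_solution[OF G mid_functor(1,3) lam mates rho t s i_Arr r h'']
        canonical_solution_eq[of "trr A\<^sub>L i j f h" K x "FObj (lhomr S) (y, z)" W\<^sub>K]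
      by (simp add: sol FHr) (simp add: x_eq y_eq z_eq)
  qed
qed

definition solutions_agree where
  "solutions_agree S S' x y z \<longleftrightarrow>
     (\<forall>h \<in> hom (arrow_cat N) (tensor (fst x) (fst y)) (fst z). solution S x y z h = solution S' x y z h)"

lemma left_determined:
  assumes gen: "generated_by M W\<^sub>M J P\<^sub>J U" and S: "adj S" "adj S'"
    and x: "x \<in> Obj (coalg K W\<^sub>K)" and z: "z \<in> Obj (alg N W\<^sub>N)"
    and agree: "\<And>j. j \<in> Obj J \<Longrightarrow> solutions_agree S S' x (FObj U j) z"
  shows "FObj (lhoml S) (x, z) = FObj (lhoml S') (x, z)"
    and "y \<in> Obj (coalg M W\<^sub>M) \<Longrightarrow> solutions_agree S S' x y z"
proof -
  interpret leibniz_adjunction K M N "tens A" "homl A" "trl A" "fst x"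
    "\<lambda>j. fst (leibniz_injs K M N (tens A) (fst x) j)" "\<lambda>j. snd (leibniz_injs K M N (tens A) (fst x) j)"
    "fix_fst (arrow_cat K) (tens A\<^sub>L) (fst x)" "trl A\<^sub>L (fst x)"
    by (rule left_leibniz_adjunction[OF cats A pullbacks(2) pushouts coalg_ObjD(1)[OF ff(1) x]])
  have F: "FObj (fix_fst (arrow_cat K) (tens A\<^sub>L) (fst x)) j = tensor (fst x) j" for j
    by (simp add: fix_fst_def leibniz_two_var_simps leibniz_tens_def)
  have sol: "solution L x y z h \<in> hom N (FObj (tens A) (Cod K (fst x), Cod M (fst y))) (Dom N (fst z)) \<and>
      canonical_solution M W\<^sub>M y (fst (snd (trl A\<^sub>L (fst x) (fst y) (fst z) h))) (FObj (lhoml L) (x, z)) =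
        trl A (Cod K (fst x)) (Cod M (fst y)) (Dom N (fst z)) (solution L x y z h)"
    if "adj L" "y \<in> Obj (coalg M W\<^sub>M)"
      "h \<in> hom (arrow_cat N) (FObj (fix_fst (arrow_cat K) (tens A\<^sub>L) (fst x)) (fst y)) (fst z)" for L y h
    using solution_hom[OF that(1) x that(2) z] solution_transposes(1)[OF that(1) x that(2) z] that(3)
    by (simp add: F)
  have "solution S x (FObj U j) z h = solution S' x (FObj U j) z h"
    if "j \<in> Obj J" "h \<in> hom (arrow_cat N)
      (FObj (fix_fst (arrow_cat K) (tens A\<^sub>L) (fst x)) (fst (FObj U j))) (fst z)" for j h
    using agree[OF that(1)] that(2) by (simp add: solutions_agree_def F)
  note eq_and_agree = determined_by_generators[OF gen alg_ObjD(1)[OF ff(3) z]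
      lhoml_Obj(1)[OF S(1) x z] lhoml_Obj(1)[OF S(2) x z] lhoml_Obj(2)[OF S(1) x z] lhoml_Obj(2)[OF S(2) x z]
      ff(2) sol[OF S(1)] sol[OF S(2)] this]
  show "FObj (lhoml S) (x, z) = FObj (lhoml S') (x, z)" by (rule eq_and_agree(1))
  show "solutions_agree S S' x y z" if "y \<in> Obj (coalg M W\<^sub>M)"
    unfolding solutions_agree_def
    by (intro ballI eq_and_agree(2)) (simp_all add: that F)
qed

lemma right_determined:
  assumes gen: "generated_by K W\<^sub>K I P\<^sub>I U" and S: "adj S" "adj S'"
    and y: "y \<in> Obj (coalg M W\<^sub>M)" and z: "z \<in> Obj (alg N W\<^sub>N)"
    and agree: "\<And>i. i \<in> Obj I \<Longrightarrow> solutions_agree S S' (FObj U i) y z"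
  shows "FObj (lhomr S) (y, z) = FObj (lhomr S') (y, z)"
    and "x \<in> Obj (coalg K W\<^sub>K) \<Longrightarrow> solutions_agree S S' x y z"
proof -
  interpret leibniz_adjunction M K N "swap_funct (tens A)" "homr A" "\<lambda>m k. trr A k m" "fst y"
    "\<lambda>i. snd (leibniz_injs K M N (tens A) i (fst y))" "\<lambda>i. fst (leibniz_injs K M N (tens A) i (fst y))"
    "fix_snd (arrow_cat M) (tens A\<^sub>L) (fst y)" "\<lambda>i. trr A\<^sub>L i (fst y)"
    by (rule right_leibniz_adjunction[OF cats A pullbacks(1) pushouts coalg_ObjD(1)[OF ff(2) y]])
  have F: "FObj (fix_snd (arrow_cat M) (tens A\<^sub>L) (fst y)) i = tensor i (fst y)" for i
    by (simp add: fix_snd_def leibniz_two_var_simps leibniz_tens_def)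
  have sol: "solution L x y z h \<in>
        hom N (FObj (swap_funct (tens A)) (Cod M (fst y), Cod K (fst x))) (Dom N (fst z)) \<and>
      canonical_solution K W\<^sub>K x (fst (snd (trr A\<^sub>L (fst x) (fst y) (fst z) h))) (FObj (lhomr L) (y, z)) =
        trr A (Cod K (fst x)) (Cod M (fst y)) (Dom N (fst z)) (solution L x y z h)"
    if "adj L" "x \<in> Obj (coalg K W\<^sub>K)"
      "h \<in> hom (arrow_cat N) (FObj (fix_snd (arrow_cat M) (tens A\<^sub>L) (fst y)) (fst x)) (fst z)" for L x h
    using solution_hom[OF that(1,2) y z] solution_transposes(2)[OF that(1,2) y z] that(3)
    by (simp add: F)
  have "solution S (FObj U i) y z h = solution S' (FObj U i) y z h"
    if "i \<in> Obj I" "h \<in> hom (arrow_cat N)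
      (FObj (fix_snd (arrow_cat M) (tens A\<^sub>L) (fst y)) (fst (FObj U i))) (fst z)" for i h
    using agree[OF that(1)] that(2) by (simp add: solutions_agree_def F)
  note eq_and_agree = determined_by_generators[OF gen alg_ObjD(1)[OF ff(3) z]
      lhomr_Obj(1)[OF S(1) y z] lhomr_Obj(1)[OF S(2) y z] lhomr_Obj(2)[OF S(1) y z] lhomr_Obj(2)[OF S(2) y z]
      ff(1) sol[OF S(1)] sol[OF S(2)] this]
  show "FObj (lhomr S) (y, z) = FObj (lhomr S') (y, z)" by (rule eq_and_agree(1))
  show "solutions_agree S S' x y z" if "x \<in> Obj (coalg K W\<^sub>K)"
    unfolding solutions_agree_def
    by (intro ballI eq_and_agree(2)) (simp_all add: that F)
qed

text \<open>The canonical solutions of all \<open>x \<otimes> y\<close> against all \<open>z\<close> carry the whole structure: a coalgebra is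
  recovered from its solutions against free algebras, and the two algebras from the transposed solutions.\<close>

lemma determined_by_solutions:
  assumes genI: "generated_by K W\<^sub>K I P\<^sub>I U\<^sub>I" and genJ: "generated_by M W\<^sub>M J P\<^sub>J U\<^sub>J"
    and S: "adj S" "adj S'"
    and agree: "\<And>x y z. x \<in> Obj (coalg K W\<^sub>K) \<Longrightarrow> y \<in> Obj (coalg M W\<^sub>M) \<Longrightarrow> z \<in> Obj (alg N W\<^sub>N) \<Longrightarrow>
      solutions_agree S S' x y z"
  shows "lifted_two_var_agree K M N W\<^sub>K W\<^sub>M W\<^sub>N S S'"
proof -
  have T: "FObj (ltens S) (x, y) = FObj (ltens S') (x, y)"
    if x: "x \<in> Obj (coalg K W\<^sub>K)" and y: "y \<in> Obj (coalg M W\<^sub>M)" for x y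
    using agree[OF x y, unfolded solutions_agree_def solution_def] ltens_Obj[OF S(1) x y] ltens_Obj[OF S(2) x y]
    by (intro coalgebra_eqI[OF cats(3) awfs(3)]) simp_all
  have L: "FObj (lhoml S) (x, z) = FObj (lhoml S') (x, z)"
    if x: "x \<in> Obj (op_cat (coalg K W\<^sub>K))" and z: "z \<in> Obj (alg N W\<^sub>N)" for x z
    using x z generated_unit_Obj[OF genJ] agree by (intro left_determined(1)[OF genJ S]) simp_all
  have R: "FObj (lhomr S) (y, z) = FObj (lhomr S') (y, z)"
    if y: "y \<in> Obj (op_cat (coalg M W\<^sub>M))" and z: "z \<in> Obj (alg N W\<^sub>N)" for y z
    using y z generated_unit_Obj[OF genI] agree by (intro right_determined(1)[OF genI S]) simp_all
  have lifts: "is_lift (coalg K W\<^sub>K) (coalg M W\<^sub>M) (coalg N W\<^sub>N) (leibniz_tens K M N (tens A)) (ltens L)"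
    "is_lift (op_cat (coalg K W\<^sub>K)) (alg N W\<^sub>N) (alg M W\<^sub>M) (leibniz_hom K N M (homl A)) (lhoml L)"
    "is_lift (op_cat (coalg M W\<^sub>M)) (alg N W\<^sub>N) (alg K W\<^sub>K) (leibniz_hom M N K (homr A)) (lhomr L)"
    if "adj L" for L
    using that by (simp_all add: two_var_adjunction_of_awfs_def)
  show ?thesis
    unfolding lifted_two_var_agree_def
  proof (intro conjI)
    show "functors_agree (prod_cat (coalg K W\<^sub>K) (coalg M W\<^sub>M)) (ltens S) (ltens S')"
      by (rule lifts_agreeI[OF lifts(1)[OF S(1), unfolded coalg_def[of N]]
            lifts(1)[OF S(2), unfolded coalg_def[of N]] _ T])
        (rule prod_cat_ends[OF coalg_ends coalg_ends])
    show "functors_agree (prod_cat (op_cat (coalg K W\<^sub>K)) (alg N W\<^sub>N)) (lhoml S) (lhoml S')"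
      by (rule lifts_agreeI[OF lifts(2)[OF S(1), unfolded alg_def[of M]]
            lifts(2)[OF S(2), unfolded alg_def[of M]] _ L])
        (rule prod_cat_ends[OF _ alg_ends], simp_all add: coalg_ends del: prod_cat_simps)
    show "functors_agree (prod_cat (op_cat (coalg M W\<^sub>M)) (alg N W\<^sub>N)) (lhomr S) (lhomr S')"
      by (rule lifts_agreeI[OF lifts(3)[OF S(1), unfolded alg_def[of K]]
            lifts(3)[OF S(2), unfolded alg_def[of K]] _ R])
        (rule prod_cat_ends[OF _ alg_ends], simp_all add: coalg_ends del: prod_cat_simps)
  qed
qed

text \<open>Agreement spreads from generators in both variables, first to all \<open>y\<close> for \<open>x\<close> a generator, then to
  all \<open>x\<close> for arbitrary \<open>y\<close>.\<close>

lemma determined_on_generators: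
  assumes genI: "generated_by K W\<^sub>K I P\<^sub>I U\<^sub>I" and genJ: "generated_by M W\<^sub>M J P\<^sub>J U\<^sub>J"
    and S: "adj S" "adj S'"
    and gens: "\<And>i j. i \<in> Obj I \<Longrightarrow> j \<in> Obj J \<Longrightarrow>
      FObj (ltens S) (FObj U\<^sub>I i, FObj U\<^sub>J j) = FObj (ltens S') (FObj U\<^sub>I i, FObj U\<^sub>J j)"
  shows "lifted_two_var_agree K M N W\<^sub>K W\<^sub>M W\<^sub>N S S'"
proof (rule determined_by_solutions[OF genI genJ S])
  fix x y z
  assume x: "x \<in> Obj (coalg K W\<^sub>K)" and y: "y \<in> Obj (coalg M W\<^sub>M)" and z: "z \<in> Obj (alg N W\<^sub>N)"
  have "solutions_agree S S' (FObj U\<^sub>I i) y z" if i: "i \<in> Obj I" for i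
  proof (rule left_determined(2)[OF genJ S generated_unit_Obj[OF genI i] z _ y])
    show "solutions_agree S S' (FObj U\<^sub>I i) (FObj U\<^sub>J j) z" if "j \<in> Obj J" for j
      using gens[OF i that] by (simp add: solutions_agree_def solution_def)
  qed
  then show "solutions_agree S S' x y z"
    by (rule right_determined(2)[OF genI S y z _ x])
qed

end

theorem theorem6p15:
  fixes K :: "('k, 'ka) cat" and M :: "('m, 'ma) cat" and N :: "('n, 'na) cat"
    and A :: "('k, 'ka, 'm, 'ma, 'n, 'na) two_var"
    and W\<^sub>K :: "('k, 'ka) awfs_data" and W\<^sub>M :: "('m, 'ma) awfs_data" and W\<^sub>N :: "('n, 'na) awfs_data"
    and I :: "('i, 'ia) cat" and J :: "('j, 'ja) cat"
    and P\<^sub>I :: "('i, 'ia, 'ka, ('ka, 'ka) sq) funct" and P\<^sub>J :: "('j, 'ja, 'ma, ('ma, 'ma) sq) funct"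
    and U\<^sub>I :: "('i, 'ia, 'ka \<times> 'ka, ('ka \<times> 'ka, 'ka) sq) funct"
    and U\<^sub>J :: "('j, 'ja, 'ma \<times> 'ma, ('ma \<times> 'ma, 'ma) sq) funct"
    and G :: "('i \<times> 'j, 'ia \<times> 'ja, 'na \<times> 'na, ('na \<times> 'na, 'na) sq) funct"
    and S S' :: "('ka, 'ma, 'na) lifted_two_var"
  assumes "category K" and "category M" and "category N"
    and "has_pullbacks K" and "has_pullbacks M" and "has_pushouts N"
    and "two_var_adjunction K M N A"
    and "awfs K W\<^sub>K" and "awfs M W\<^sub>M" and "awfs N W\<^sub>N"
    and "category I" and "is_functor I (arrow_cat K) P\<^sub>I" and "generated_by K W\<^sub>K I P\<^sub>I U\<^sub>I"
    and "category J" and "is_functor J (arrow_cat M) P\<^sub>J" and "generated_by M W\<^sub>M J P\<^sub>J U\<^sub>J"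
    and "is_functor (prod_cat I J) (coalg N W\<^sub>N) G"
    and "two_var_adjunction_of_awfs K M N A W\<^sub>K W\<^sub>M W\<^sub>N S"
    and "functors_agree (prod_cat I J) (ltens S \<circ>\<^sub>F (U\<^sub>I \<times>\<^sub>F U\<^sub>J)) G"
    and "two_var_adjunction_of_awfs K M N A W\<^sub>K W\<^sub>M W\<^sub>N S'"
    and "functors_agree (prod_cat I J) (ltens S' \<circ>\<^sub>F (U\<^sub>I \<times>\<^sub>F U\<^sub>J)) G"
  shows "lifted_two_var_agree K M N W\<^sub>K W\<^sub>M W\<^sub>N S S'"
proof -
  interpret two_variable_awfs K M N A W\<^sub>K W\<^sub>M W\<^sub>N
    using assms(1-10) by unfold_locales
  show ?thesis
  proof (rule determined_on_generators[OF assms(13,16,18,20)])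
    fix i j assume "i \<in> Obj I" "j \<in> Obj J"
    then show "FObj (ltens S) (FObj U\<^sub>I i, FObj U\<^sub>J j) = FObj (ltens S') (FObj U\<^sub>I i, FObj U\<^sub>J j)"
      using assms(19,21) by (simp add: functors_agree_def comp_funct_def prod_funct_def)
  qed
qed

end
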